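(* (i) Let $m\ge4$. For every non-trivial bicolouring of the vertices of a convex $m$-gon $\mathcal{P}_m$, the subcomplex $\mathcal{Y}(\mathcal{P}_m)$ is a closed ball of dimension $m-4$. (ii) Let $m\ge2$. For every bicolouring of the vertices of a once-punctured $m$-gon $\mathcal{P}_m^\times$, the subcomplex $\mathcal{Y}(\mathcal{P}_m^\times)$ is a closed ball of dimension $m-2$.
   Context: $\mathcal{P}_m$ is a convex polygon with $m$ vertices. Its diagonals are the segments joining two non-consecutive vertices. $\mathcal{P}_m^\times$ is a polygon with $m$ vertices with one interior puncture. Its diagonals are the homotopy classes (relative to endpoints) of embedded arcs with endpoints at vertices (the two endpoints may coincide) and interior contained in the interior of the punctured polygon, not homotopic to a point or to an edge of the polygon; no diagonal ends at the puncture. The arc complex $\mathcal{A}(\mathcal{P}_m)$ (resp. $\mathcal{A}(\mathcal{P}_m^\times)$) is the simplicial complex whose $0$-simplices are the diagonals and whose $k$-simplices are the $(k+1)$-tuples of distinct diagonals that can be realised pairwise disjointly (except possibly at endpoints). A bicolouring is a colouring of the vertices of the polygon with two colours, red ($R$) and blue ($B$), using each colour at least once. It is non-trivial if at least one diagonal has both endpoints red (an $R-R$ diagonal; in the punctured case this includes a diagonal with both endpoints at the same red vertex). The subcomplex $\mathcal{Y}(\mathcal{P}_m)\subset\mathcal{A}(\mathcal{P}_m)$ (resp. $\mathcal{Y}(\mathcal{P}_m^\times)\subset\mathcal{A}(\mathcal{P}_m^\times)$) consists of all simplices whose diagonals are all $R-B$ or $B-B$, i.e. each has at least one blue endpoint.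 *)

theory Defs
  imports "HOL-Analysis.Analysis"
begin

section \<open>Abstract simplicial complexes and their geometric realization\<close>

text \<open>
  An abstract simplicial complex is given by the set of its simplices, each of which is a nonempty
  finite set of vertices. A point of the realization is a family of barycentric coordinates, and
  the topology is the coherent (weak) one: a set is open iff its trace on every closed simplex is.
\<close>

definition realization_points :: "'v set set \<Rightarrow> ('v \<Rightarrow> real) set" where
  "realization_points K =
     {f. (\<forall>v. 0 \<le> f v) \<and> {v. f v \<noteq> 0} \<in> K \<and> (\<Sum>v | f v \<noteq> 0. f v) = 1}"

definition closed_simplex :: "'v set set \<Rightarrow> 'v set \<Rightarrow> ('v \<Rightarrow> real) set" where
  "closed_simplex K \<sigma> = {f \<in> realization_points K. {v. f v \<noteq> 0} \<subseteq> \<sigma>}"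

definition realization :: "'v set set \<Rightarrow> ('v \<Rightarrow> real) topology" where
  "realization K = topology (\<lambda>U. U \<subseteq> realization_points K \<and>
     (\<forall>\<sigma>\<in>K. openin (subtopology (powertop_real UNIV) (closed_simplex K \<sigma>)) (U \<inter> closed_simplex K \<sigma>)))"

lemma openin_realization:
  "openin (realization K) U \<longleftrightarrow> U \<subseteq> realization_points K \<and>
     (\<forall>\<sigma>\<in>K. openin (subtopology (powertop_real UNIV) (closed_simplex K \<sigma>)) (U \<inter> closed_simplex K \<sigma>))"
proof -
  let ?T = "\<lambda>\<sigma>. subtopology (powertop_real UNIV) (closed_simplex K \<sigma>)"
  have "istopology (\<lambda>U. U \<subseteq> realization_points K \<and>
          (\<forall>\<sigma>\<in>K. openin (?T \<sigma>) (U \<inter> closed_simplex K \<sigma>)))" (is "istopology ?P")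
    unfolding istopology_def
  proof (intro conjI allI impI)
    fix S T assume S: "?P S" and T: "?P T"
    show "S \<inter> T \<subseteq> realization_points K" using S by blast
    show "\<forall>\<sigma>\<in>K. openin (?T \<sigma>) (S \<inter> T \<inter> closed_simplex K \<sigma>)"
    proof
      fix \<sigma> assume "\<sigma> \<in> K"
      then have "openin (?T \<sigma>) ((S \<inter> closed_simplex K \<sigma>) \<inter> (T \<inter> closed_simplex K \<sigma>))"
        using S T by (rule_tac openin_Int) auto
      then show "openin (?T \<sigma>) (S \<inter> T \<inter> closed_simplex K \<sigma>)"
        by (rule back_subst[where P = "openin (?T \<sigma>)"]) blast
    qed
  next
    fix \<K> assume *: "\<forall>U\<in>\<K>. ?P U"
    then show "\<Union>\<K> \<subseteq> realization_points K" by blast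
    show "\<forall>\<sigma>\<in>K. openin (?T \<sigma>) (\<Union>\<K> \<inter> closed_simplex K \<sigma>)"
    proof
      fix \<sigma> assume "\<sigma> \<in> K"
      then have "openin (?T \<sigma>) (\<Union>U\<in>\<K>. U \<inter> closed_simplex K \<sigma>)"
        using * by (rule_tac openin_Union) auto
      then show "openin (?T \<sigma>) (\<Union>\<K> \<inter> closed_simplex K \<sigma>)"
        by (rule back_subst[where P = "openin (?T \<sigma>)"]) blast
    qed
  qed
  then show ?thesis
    by (simp add: realization_def)
qed

definition closed_ball_space :: "nat \<Rightarrow> (nat \<Rightarrow> real) topology" where
  "closed_ball_space n = subtopology (Euclidean_space n) {x. (\<Sum>i<n. (x i)\<^sup>2) \<le> 1}"

definition is_closed_ball :: "'v set set \<Rightarrow> nat \<Rightarrow> bool" where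
  "is_closed_ball K n \<longleftrightarrow> realization K homeomorphic_space closed_ball_space n"

definition bicolouring :: "'a set \<Rightarrow> 'a set \<Rightarrow> 'a set \<Rightarrow> bool" where
  "bicolouring V R B \<longleftrightarrow> R \<union> B = V \<and> R \<inter> B = {} \<and> R \<noteq> {} \<and> B \<noteq> {}"

section \<open>Convex polygons\<close>

definition vertices :: "complex set \<Rightarrow> complex set" where
  "vertices P = {v. v extreme_point_of P}"

definition convex_polygon :: "nat \<Rightarrow> complex set \<Rightarrow> bool" where
  "convex_polygon m P \<longleftrightarrow> polytope P \<and> aff_dim P = 2 \<and> card (vertices P) = m"

definition diagonals :: "complex set \<Rightarrow> complex set set" where
  "diagonals P = {closed_segment a b | a b.
     a \<in> vertices P \<and> b \<in> vertices P \<and> a \<noteq> b \<and> \<not> closed_segment a b edge_of P}"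

text \<open>
  A diagonal contains no vertices other than its two endpoints. Hence diagonals are disjoint
  except possibly at endpoints iff they meet only in vertices.
\<close>

definition arc_complex :: "complex set \<Rightarrow> complex set set set" where
  "arc_complex P = {\<sigma>. \<sigma> \<noteq> {} \<and> finite \<sigma> \<and> \<sigma> \<subseteq> diagonals P \<and>
     pairwise (\<lambda>d e. d \<inter> e \<subseteq> vertices P) \<sigma>}"

definition nontrivial_bicolouring :: "complex set \<Rightarrow> complex set \<Rightarrow> complex set \<Rightarrow> bool" where
  "nontrivial_bicolouring P R B \<longleftrightarrow> bicolouring (vertices P) R B \<and>
     (\<exists>a\<in>R. \<exists>b\<in>R. closed_segment a b \<in> diagonals P)"

definition Y_complex :: "complex set \<Rightarrow> complex set \<Rightarrow> complex set set set" where
  "Y_complex P B = {\<sigma> \<in> arc_complex P. \<forall>d\<in>\<sigma>. \<exists>a b. d = closed_segment a b \<and> (a \<in> B \<or> b \<in> B)}"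

section \<open>Once-punctured polygons\<close>

text \<open>
  Since a punctured polygon may have only two vertices, polygons are understood topologically here:
  \<open>P\<close> is a closed disc in the plane, \<open>V\<close> a set of marked points on its boundary curve (the frontier
  of \<open>P\<close>, by invariance of domain), and \<open>x\<close> the puncture. The punctured polygon is \<open>P - {x}\<close>.
\<close>

definition punctured_polygon :: "nat \<Rightarrow> complex set \<Rightarrow> complex set \<Rightarrow> complex \<Rightarrow> bool" where
  "punctured_polygon m P V x \<longleftrightarrow> P homeomorphic cball (0::complex) 1 \<and>
     V \<subseteq> frontier P \<and> finite V \<and> card V = m \<and> x \<in> interior P"

text \<open>The edges, in both orientations; this presupposes that there are at least two vertices.\<close>

definition polygon_edge :: "complex set \<Rightarrow> complex set \<Rightarrow> (real \<Rightarrow> complex) \<Rightarrow> bool" where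
  "polygon_edge P V e \<longleftrightarrow> arc e \<and> path_image e \<subseteq> frontier P \<and>
     path_image e \<inter> V = {pathstart e, pathfinish e}"

text \<open>As \<^const>\<open>simple_path\<close> admits closed paths, the two endpoints may coincide.\<close>

definition embedded_arc :: "complex set \<Rightarrow> complex set \<Rightarrow> complex \<Rightarrow> (real \<Rightarrow> complex) \<Rightarrow> bool" where
  "embedded_arc P V x p \<longleftrightarrow> simple_path p \<and> pathstart p \<in> V \<and> pathfinish p \<in> V \<and>
     p ` {0<..<1} \<subseteq> interior (P - {x})"

definition essential_arc :: "complex set \<Rightarrow> complex set \<Rightarrow> complex \<Rightarrow> (real \<Rightarrow> complex) \<Rightarrow> bool" where
  "essential_arc P V x p \<longleftrightarrow> embedded_arc P V x p \<and>
     \<not> homotopic_paths (P - {x}) p (\<lambda>_. pathstart p) \<and>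
     (\<forall>e. polygon_edge P V e \<longrightarrow> \<not> homotopic_paths (P - {x}) p e)"

text \<open>
  Arcs are not oriented, so a path and its reverse represent the same arc. A diagonal is the set of
  all parametrised embedded arcs in a homotopy class.
\<close>

definition arc_class ::
    "complex set \<Rightarrow> complex set \<Rightarrow> complex \<Rightarrow> (real \<Rightarrow> complex) \<Rightarrow> (real \<Rightarrow> complex) set" where
  "arc_class P V x p = {q. embedded_arc P V x q \<and>
     (homotopic_paths (P - {x}) p q \<or> homotopic_paths (P - {x}) (reversepath p) q)}"

definition punctured_diagonals ::
    "complex set \<Rightarrow> complex set \<Rightarrow> complex \<Rightarrow> (real \<Rightarrow> complex) set set" where
  "punctured_diagonals P V x = arc_class P V x ` {p. essential_arc P V x p}"

text \<open>
  The relative interior of an embedded arc avoids the boundary curve, hence \<open>V\<close>; so again arcs are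
  disjoint except possibly at endpoints iff they meet only in \<open>V\<close>.
\<close>

definition punctured_arc_complex ::
    "complex set \<Rightarrow> complex set \<Rightarrow> complex \<Rightarrow> (real \<Rightarrow> complex) set set set" where
  "punctured_arc_complex P V x = {\<sigma>. \<sigma> \<noteq> {} \<and> finite \<sigma> \<and> \<sigma> \<subseteq> punctured_diagonals P V x \<and>
     (\<exists>r. (\<forall>d\<in>\<sigma>. r d \<in> d) \<and> pairwise (\<lambda>d e. path_image (r d) \<inter> path_image (r e) \<subseteq> V) \<sigma>)}"

definition punctured_Y_complex ::
    "complex set \<Rightarrow> complex set \<Rightarrow> complex \<Rightarrow> complex set \<Rightarrow> (real \<Rightarrow> complex) set set set" where
  "punctured_Y_complex P V x B =
     {\<sigma> \<in> punctured_arc_complex P V x. \<forall>d\<in>\<sigma>. \<forall>p\<in>d. pathstart p \<in> B \<or> pathfinish p \<in> B}"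

end

theory Submission
  imports Defs
begin

text \<open>
  The proof identifies weighted systems of disjoint diagonals with height functions on the vertices.
  Number the vertices by integers and place them on a parabola, so that affine functions of the
  plane become quadratic functions of the index. A system of noncrossing arcs \<open>(a, b)\<close> with weights
  \<open>w\<close> gives the function \<open>i \<mapsto> \<Sum> w (a, b) * max 0 ((b - i) * (i - a))\<close>, which is
  (the restriction to the vertices of) the convex piecewise linear function bent along the arcs by the
  amounts \<open>w\<close>. Conversely every height function is, modulo quadratic functions, such a sum in
  exactly one way; the arcs that occur are the bending edges of its lower convex hull. A polygon
  corresponds to the indices \<open>0, ..., m - 1\<close>; a once-punctured polygon corresponds to all of
  \<open>\<int>\<close> with \<open>m\<close>-periodic weights and heights (its universal covering), where the only periodic
  quadratic functions are the constants. Existence (\<open>lamination_exists\<close>) peels off arcs spanning the gaps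
  between consecutive zeros of a nonnegative function, and the same gaps give uniqueness
  (\<open>lamination_unique\<close>).

  An arc \<open>(a, b)\<close> occurs in the decomposition of \<open>h\<close> iff it is exposed: some quadratic function
  lies below \<open>h\<close> and touches it exactly at \<open>a\<close> and \<open>b\<close> (\<open>lamination_exposed\<close>,
  \<open>exposed_lamination\<close>). Hence the cone over \<open>Y\<close> is the set of heights for which no red-red
  arc is exposed. Add \<open>t > 0\<close> to all red heights: if a red-red arc is exposed afterwards, by
  \<open>l\<close>, then \<open>l - t\<close> exposes it before. So the cone is closed upwards in the direction of the
  indicator function of the red vertices, and in fact moving upwards leads into its interior
  (\<open>red_contact_imp_red_chord\<close> and \<open>red_contact_imp_exposed_periodic\<close> with \<open>not_touches_open\<close>). Its complement
  is open (\<open>exposed_open\<close>) and contains the negative of that indicator function. Therefore the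
  cone is the epigraph of a continuous, positively homogeneous function on the quotient by this direction,
  and the rays of such a cone form a closed ball of the dimension of the quotient
  (\<open>ball_criterion\<close>). The quotient has dimension \<open>m - 4\<close>, respectively \<open>m - 2\<close>.

  What remains is to see that the geometric complexes are the combinatorial ones. For convex polygons
  this is the cyclic order of the vertices and the sign of oriented areas. For a punctured disc, paths are
  lifted to the upper half plane; the homotopy class of an arc is given by the endpoints of
  a lift, simple arcs wind at most once around the puncture and arcs with interlacing lifts meet by the
  Fashoda meet theorem, while parabolas over the real line realize every noncrossing
  system by disjoint arcs simultaneously.
\<close>

section \<open>Finite complexes and their realizations\<close>

lemma continuous_on_coordinate: "continuous_on S (\<lambda>f::'a \<Rightarrow> real. f v)"
  by (rule continuous_on_subset[OF continuous_on_product_coordinates subset_UNIV])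

lemma Hausdorff_euclidean_functions: "Hausdorff_space (euclidean :: ('a \<Rightarrow> real) topology)"
  unfolding euclidean_product_topology[symmetric] by (simp add: Hausdorff_space_product_topology)

definition finite_complex :: "'v set set \<Rightarrow> bool" where
  "finite_complex K \<longleftrightarrow> finite K \<and> (\<forall>\<sigma>\<in>K. finite \<sigma> \<and> \<sigma> \<noteq> {}) \<and> (\<forall>\<sigma>\<in>K. \<forall>\<tau>. \<tau> \<noteq> {} \<and> \<tau> \<subseteq> \<sigma> \<longrightarrow> \<tau> \<in> K)"

lemma finite_complexD:
  assumes "finite_complex K"
  shows "finite K" "\<sigma> \<in> K \<Longrightarrow> finite \<sigma>" "\<sigma> \<in> K \<Longrightarrow> \<sigma> \<noteq> {}" "\<sigma> \<in> K \<Longrightarrow> \<tau> \<noteq> {} \<Longrightarrow> \<tau> \<subseteq> \<sigma> \<Longrightarrow> \<tau> \<in> K"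
  using assms unfolding finite_complex_def by blast+

lemma closed_simplex_eq:
  assumes "finite_complex K" "\<sigma> \<in> K"
  shows "closed_simplex K \<sigma> = {f. (\<forall>v. 0 \<le> f v) \<and> (\<forall>v. v \<notin> \<sigma> \<longrightarrow> f v = 0) \<and> sum f \<sigma> = 1}"
    (is "_ = ?R")
proof -
  have fin: "finite \<sigma>" using assms by (auto simp: finite_complex_def)
  have eq: "sum f {v. f v \<noteq> 0} = sum f \<sigma>" if "{v. f v \<noteq> 0} \<subseteq> \<sigma>" for f :: "'a \<Rightarrow> real"
    using fin that by (intro sum.mono_neutral_left) auto
  show ?thesis
  proof (intro set_eqI iffI)
    fix f assume "f \<in> closed_simplex K \<sigma>"
    then show "f \<in> ?R" using eq[of f] by (auto simp: closed_simplex_def realization_points_def)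
  next
    fix f assume f: "f \<in> ?R"
    then have f': "\<forall>v. 0 \<le> f v" "\<forall>v. v \<notin> \<sigma> \<longrightarrow> f v = 0" "sum f \<sigma> = 1" by blast+
    have sub: "{v. f v \<noteq> 0} \<subseteq> \<sigma>" using f'(2) by blast
    have "{v. f v \<noteq> 0} \<noteq> {}"
    proof
      assume "{v. f v \<noteq> 0} = {}"
      then have "sum f \<sigma> = 0" by auto
      then show False using f'(3) by simp
    qed
    then have inK: "{v. f v \<noteq> 0} \<in> K" by (rule finite_complexD(4)[OF assms _ sub])
    have sm: "sum f {v. f v \<noteq> 0} = 1" using eq[OF sub] f'(3) by (rule trans)
    show "f \<in> closed_simplex K \<sigma>"
      unfolding closed_simplex_def realization_points_def
      by (intro CollectI conjI f'(1) inK sm sub)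
  qed
qed

lemma compact_closed_simplex:
  assumes "finite_complex K" "\<sigma> \<in> K"
  shows "compact (closed_simplex K \<sigma>)"
proof -
  have fin: "finite \<sigma>" using assms by (auto simp: finite_complex_def)
  let ?C = "PiE UNIV (\<lambda>_::'a. {0..1::real})"
  have "compactin (powertop_real UNIV) ?C"
    by (simp add: compactin_PiE)
  then have C: "compact ?C" by (simp add: euclidean_product_topology)
  have ge: "closed {f::'a \<Rightarrow> real. 0 \<le> f v}" for v
    by (rule closed_Collect_le[OF continuous_on_const continuous_on_coordinate])
  have eq0: "closed {f::'a \<Rightarrow> real. f v = 0}" for v
    by (rule closed_Collect_eq[OF continuous_on_coordinate continuous_on_const])
  have 1: "closed {f::'a \<Rightarrow> real. \<forall>v. 0 \<le> f v}"
    unfolding Collect_all_eq using ge by (intro closed_INT) auto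
  have "{f::'a \<Rightarrow> real. \<forall>v. v \<notin> \<sigma> \<longrightarrow> f v = 0} = (\<Inter>v\<in>-\<sigma>. {f. f v = 0})" by auto
  then have 2: "closed {f::'a \<Rightarrow> real. \<forall>v. v \<notin> \<sigma> \<longrightarrow> f v = 0}"
    using eq0 by (simp only:) (intro closed_INT, auto)
  have "continuous_on UNIV (\<lambda>f::'a \<Rightarrow> real. sum f \<sigma>)"
    by (rule continuous_on_sum, rule continuous_on_coordinate)
  then have 3: "closed {f::'a \<Rightarrow> real. sum f \<sigma> = 1}"
    by (rule closed_Collect_eq[OF _ continuous_on_const])
  have "closed (closed_simplex K \<sigma>)"
    unfolding closed_simplex_eq[OF assms] by (rule closed_Collect_conj[OF 1 closed_Collect_conj[OF 2 3]])
  moreover have "closed_simplex K \<sigma> \<subseteq> ?C"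
  proof
    fix f assume "f \<in> closed_simplex K \<sigma>"
    then have f: "\<And>v. 0 \<le> f v" "\<And>v. v \<notin> \<sigma> \<Longrightarrow> f v = 0" "sum f \<sigma> = 1"
      unfolding closed_simplex_eq[OF assms] by auto
    have "f v \<le> 1" for v
      using member_le_sum[of v \<sigma> f] f fin by (cases "v \<in> \<sigma>") auto
    then show "f \<in> ?C" using f by auto
  qed
  ultimately show ?thesis using C by (metis compact_Int_closed inf.absorb_iff2)
qed

lemma realization_points_eq_UN:
  assumes "finite_complex K"
  shows "realization_points K = (\<Union>\<sigma>\<in>K. closed_simplex K \<sigma>)"
  by (auto simp: closed_simplex_def realization_points_def)

lemma compact_realization_points:
  assumes K: "finite_complex K"
  shows "compact (realization_points K)"
  unfolding realization_points_eq_UN[OF K]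
proof (rule compact_UN)
  show "finite K" using K by (simp add: finite_complex_def)
qed (rule compact_closed_simplex[OF K])

text \<open>
  Finitely many compact simplices cover the realization, so a set that is closed in each of
  them is closed: the coherent topology is that of pointwise convergence.
\<close>

lemma realization_eq_top_of_set:
  assumes K: "finite_complex K"
  shows "realization K = top_of_set (realization_points K)"
proof (rule topology_eq[THEN iffD2], intro allI iffI)
  fix U
  assume "openin (top_of_set (realization_points K)) U"
  then obtain W where W: "open W" "U = realization_points K \<inter> W"
    by (auto simp: openin_open)
  have "U \<inter> closed_simplex K \<sigma> = closed_simplex K \<sigma> \<inter> W" for \<sigma>
    unfolding W by (auto simp: closed_simplex_def)
  then show "openin (realization K) U"
    using W by (auto simp: openin_realization euclidean_product_topology openin_open)
next
  fix U
  assume U: "openin (realization K) U"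
  have cl: "compact (closed_simplex K \<sigma> - U)" if "\<sigma> \<in> K" for \<sigma>
  proof -
    have "openin (top_of_set (closed_simplex K \<sigma>)) (U \<inter> closed_simplex K \<sigma>)"
      using U that by (auto simp: openin_realization euclidean_product_topology)
    then obtain W where W: "open W" "U \<inter> closed_simplex K \<sigma> = closed_simplex K \<sigma> \<inter> W"
      by (auto simp: openin_open)
    then have "closed_simplex K \<sigma> - U = closed_simplex K \<sigma> \<inter> - W" by blast
    then show ?thesis using W compact_closed_simplex[OF K that] by (simp add: compact_Int_closed closed_Compl)
  qed
  have "compact (\<Union>\<sigma>\<in>K. closed_simplex K \<sigma> - U)"
    by (rule compact_UN[OF finite_complexD(1)[OF K] cl])
  moreover have "(\<Union>\<sigma>\<in>K. closed_simplex K \<sigma> - U) = realization_points K - U"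
    unfolding realization_points_eq_UN[OF K] by blast
  ultimately have "closed (realization_points K - U)"
    using compactin_imp_closedin[OF Hausdorff_euclidean_functions] by simp
  moreover have "U = realization_points K \<inter> - (realization_points K - U)"
    using U by (auto simp: openin_realization)
  ultimately show "openin (top_of_set (realization_points K)) U"
    by (metis open_Compl openin_open_Int)
qed

text \<open>
  Lets the combinatorial complexes below be treated with pairs of integers as vertices.
\<close>

lemma is_closed_ball_relabel:
  assumes inj: "inj_on c D" and K: "finite_complex K" "\<Union>K \<subseteq> D" and ball: "is_closed_ball K n"
  shows "is_closed_ball ((`) c ` K) n"
proof -
  let ?K = "(`) c ` K"
  have K': "finite_complex ?K"
    unfolding finite_complex_def
  proof (intro conjI ballI allI impI)
    show "finite ?K" using K by (auto simp: finite_complex_def)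
  next
    fix \<sigma>' \<tau>' assume s: "\<sigma>' \<in> ?K" and t: "\<tau>' \<noteq> {} \<and> \<tau>' \<subseteq> \<sigma>'"
    then obtain \<sigma> where \<sigma>: "\<sigma> \<in> K" "\<sigma>' = c ` \<sigma>" by auto
    then obtain \<tau> where \<tau>: "\<tau> \<subseteq> \<sigma>" "\<tau>' = c ` \<tau>" using t by (metis subset_imageE)
    then have "\<tau> \<in> K" using finite_complexD(4)[OF K(1) \<sigma>(1)] t by blast
    then show "\<tau>' \<in> ?K" using \<tau> by auto
  qed (use K in \<open>auto simp: finite_complex_def\<close>)
  define F where "F = (\<lambda>f v. if v \<in> c ` D then f (inv_into D c v) else (0::real))"
  have Fc: "F f (c d) = f d" if "d \<in> D" for f d
    using that inj by (auto simp: F_def)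
  have supp: "{v. F f v \<noteq> 0} = c ` {d. f d \<noteq> 0}" if "{d. f d \<noteq> 0} \<subseteq> D" for f
  proof (intro set_eqI iffI)
    fix v assume v: "v \<in> {v. F f v \<noteq> 0}"
    then have "v \<in> c ` D" unfolding F_def by (auto split: if_splits)
    then obtain d where "d \<in> D" "v = c d" by auto
    then show "v \<in> c ` {d. f d \<noteq> 0}" using v Fc by auto
  next
    fix v assume "v \<in> c ` {d. f d \<noteq> 0}"
    then show "v \<in> {v. F f v \<noteq> 0}" using Fc that by auto
  qed
  have sm: "sum (F f) {v. F f v \<noteq> 0} = sum f {d. f d \<noteq> 0}" if "{d. f d \<noteq> 0} \<subseteq> D" for f
    unfolding supp[OF that]
    using that inj by (subst sum.reindex) (auto intro: inj_on_subset simp: Fc intro!: sum.cong)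
  have inD: "{d. f d \<noteq> 0} \<subseteq> D" if "f \<in> realization_points K" for f
    using that K(2) by (auto simp: realization_points_def)
  have map: "F ` realization_points K = realization_points ?K"
  proof (intro equalityI subsetI)
    fix g assume "g \<in> F ` realization_points K"
    then obtain f where f: "f \<in> realization_points K" "g = F f" by auto
    have "\<forall>v. 0 \<le> F f v" using f by (auto simp: F_def realization_points_def)
    then show "g \<in> realization_points ?K"
      using f supp[OF inD[OF f(1)]] sm[OF inD[OF f(1)]] by (auto simp: realization_points_def)
  next
    fix g assume g: "g \<in> realization_points ?K"
    then obtain \<sigma> where \<sigma>: "\<sigma> \<in> K" "{v. g v \<noteq> 0} = c ` \<sigma>" by (auto simp: realization_points_def)
    define f where "f = (\<lambda>d. if d \<in> \<sigma> then g (c d) else 0)"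
    have sD: "\<sigma> \<subseteq> D" using \<sigma> K by auto
    have sf: "{d. f d \<noteq> 0} = \<sigma>" using \<sigma> by (auto simp: f_def)
    have Fg: "F f = g"
    proof
      fix v show "F f v = g v"
      proof (cases "v \<in> c ` \<sigma>")
        case True
        then obtain d where "d \<in> \<sigma>" "v = c d" by auto
        then show ?thesis using Fc[of d f] sD by (auto simp: f_def)
      next
        case False
        then have "g v = 0" using \<sigma> by blast
        moreover have "F f v = 0"
        proof (rule ccontr)
          assume "F f v \<noteq> 0"
          then have "v \<in> c ` {d. f d \<noteq> 0}" using supp[of f] sf sD by auto
          then show False using False sf by auto
        qed
        ultimately show ?thesis by simp
      qed
    qed
    have "\<forall>d. 0 \<le> f d" using g by (auto simp: f_def realization_points_def)
    moreover have "sum f {d. f d \<noteq> 0} = 1" using sm[of f] sf sD Fg g by (auto simp: realization_points_def)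
    ultimately have "f \<in> realization_points K" using sf \<sigma> by (auto simp: realization_points_def)
    then show "g \<in> F ` realization_points K" using Fg by auto
  qed
  have inj': "inj_on F (realization_points K)"
  proof (rule inj_onI, rule ext)
    fix f g d assume f: "f \<in> realization_points K" "g \<in> realization_points K" "F f = F g"
    show "f d = g d"
    proof (cases "d \<in> D")
      case True then show ?thesis using Fc f by metis
    next
      case False then have "f d = 0" "g d = 0" using inD f by blast+
      then show ?thesis by simp
    qed
  qed
  have contF: "continuous_on (realization_points K) F"
  proof (rule continuous_on_coordinatewise_then_product)
    fix v show "continuous_on (realization_points K) (\<lambda>f. F f v)"
      unfolding F_def by (cases "v \<in> c ` D") (auto intro: continuous_on_coordinate)
  qed
  have "homeomorphic_map (realization K) (realization ?K) F"
    unfolding realization_eq_top_of_set[OF K(1)] realization_eq_top_of_set[OF K']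
    using map inj' contF compact_realization_points[OF K(1)]
    by (intro continuous_imp_homeomorphic_map Hausdorff_space_subtopology Hausdorff_euclidean_functions)
      (auto simp: compact_space_subtopology)
  then show ?thesis using ball unfolding is_closed_ball_def
    by (meson homeomorphic_map_imp_homeomorphic_space homeomorphic_space_sym homeomorphic_space_trans)
qed

section \<open>A cone that is an epigraph has a ball as its link\<close>

text \<open>
  The cone over the realization: barycentric coordinates without the normalization, together
  with the apex.
\<close>

definition weight_cone :: "'v set set \<Rightarrow> ('v \<Rightarrow> real) set" where
  "weight_cone K = {f. (\<forall>v. 0 \<le> f v) \<and> ({v. f v \<noteq> 0} \<in> K \<or> {v. f v \<noteq> 0} = {})}"

lemma realization_subset_cone: "realization_points K \<subseteq> weight_cone K"
  unfolding realization_points_def weight_cone_def by blast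

lemma weight_cone_scale:
  assumes "f \<in> weight_cone K" "0 \<le> r"
  shows "(\<lambda>v. r * f v) \<in> weight_cone K"
proof (cases "r = 0")
  case True then show ?thesis by (simp add: weight_cone_def)
next
  case False
  then have eq: "{v. r * f v \<noteq> 0} = {v. f v \<noteq> 0}" by simp
  show ?thesis using assms unfolding weight_cone_def mem_Collect_eq eq by simp
qed

lemma cone_normalize:
  assumes K: "finite_complex K" and f: "f \<in> weight_cone K" and nz: "f v0 \<noteq> 0"
  obtains s where "s > 0" "(\<lambda>v. f v / s) \<in> realization_points K"
proof -
  define s where "s = sum f {v. f v \<noteq> 0}"
  have inK: "{v. f v \<noteq> 0} \<in> K" and nn: "\<forall>v. 0 \<le> f v" using f nz unfolding weight_cone_def by blast+
  have fin: "finite {v. f v \<noteq> 0}" by (rule finite_complexD(2)[OF K inK])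
  have "f v0 \<le> s" unfolding s_def using fin nn nz by (intro member_le_sum) auto
  moreover have "0 < f v0" using nn nz by (simp add: order_less_le)
  ultimately have s: "s > 0" by linarith
  have eq: "{v. f v / s \<noteq> 0} = {v. f v \<noteq> 0}" using s by simp
  have "sum (\<lambda>v. f v / s) {v. f v / s \<noteq> 0} = 1"
    unfolding eq sum_divide_distrib[symmetric] using s by (simp add: s_def)
  then have "(\<lambda>v. f v / s) \<in> realization_points K"
    unfolding realization_points_def using inK nn s eq by simp
  then show thesis using that s by blast
qed

text \<open>
  Here \<open>(X, T)\<close> are coordinates on the cone over \<open>K\<close> and \<open>G x t\<close> says that
  \<open>(x, t)\<close> is in its image. By \<open>above\<close> and \<open>below\<close> the image is the epigraph of a
  continuous function \<open>L\<close>, positively homogeneous because the image is a cone. Subtracting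
  \<open>L\<close> from the last coordinate straightens the epigraph to a half space, and radial projection of
  the half space to the set where \<open>nrm x + s = 1\<close> identifies the link of the apex with the unit ball,
  in which \<open>x\<close> is a coordinate.
\<close>

theorem ball_criterion:
  fixes K :: "'v set set" and n :: nat
    and X :: "('v \<Rightarrow> real) \<Rightarrow> nat \<Rightarrow> real" and T :: "('v \<Rightarrow> real) \<Rightarrow> real"
    and G :: "(nat \<Rightarrow> real) \<Rightarrow> real \<Rightarrow> bool" and E :: "(nat \<Rightarrow> real) set"
  defines "E \<equiv> {x. \<forall>i\<ge>n. x i = 0}"
  assumes K: "finite_complex K"
    and XE: "\<And>f. X f \<in> E"
    and contX: "\<And>i. continuous_on UNIV (\<lambda>f. X f i)" and contT: "continuous_on UNIV T"
    and homX: "\<And>r f i. 0 \<le> r \<Longrightarrow> X (\<lambda>v. r * f v) i = r * X f i"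
    and homT: "\<And>r f. 0 \<le> r \<Longrightarrow> T (\<lambda>v. r * f v) = r * T f"
    and img: "\<And>f. f \<in> weight_cone K \<Longrightarrow> G (X f) (T f)"
    and surj: "\<And>x t. x \<in> E \<Longrightarrow> G x t \<Longrightarrow> \<exists>f\<in>weight_cone K. X f = x \<and> T f = t"
    and inj: "\<And>f g. f \<in> weight_cone K \<Longrightarrow> g \<in> weight_cone K \<Longrightarrow> X f = X g \<Longrightarrow> T f = T g \<Longrightarrow> f = g"
    and above: "\<And>x t t'. x \<in> E \<Longrightarrow> G x t \<Longrightarrow> t < t' \<Longrightarrow>
       \<exists>\<delta>>0. \<forall>y\<in>E. \<forall>s. (\<forall>i<n. \<bar>y i - x i\<bar> < \<delta>) \<and> \<bar>s - t'\<bar> < \<delta> \<longrightarrow> G y s"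
    and below: "\<And>x t. x \<in> E \<Longrightarrow> \<not> G x t \<Longrightarrow>
       \<exists>\<delta>>0. \<forall>y\<in>E. \<forall>s. (\<forall>i<n. \<bar>y i - x i\<bar> < \<delta>) \<and> \<bar>s - t\<bar> < \<delta> \<longrightarrow> \<not> G y s"
    and neg: "\<not> G (\<lambda>_. 0) (-1)"
  shows "is_closed_ball K n"
proof -
  have zero_cone: "(\<lambda>_. 0) \<in> weight_cone K" by (simp add: weight_cone_def)
  have X0: "X (\<lambda>_. 0) = (\<lambda>_. 0)" using homX[of 0 "\<lambda>_. 0"] by auto
  have T0: "T (\<lambda>_. 0) = 0" using homT[of 0 "\<lambda>_. 0"] by auto
  have G00: "G (\<lambda>_. 0) 0" using img[OF zero_cone] X0 T0 by simp
  have zE: "(\<lambda>_. 0) \<in> E" by (simp add: E_def)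
  have sE: "(\<lambda>i. r * x i) \<in> E" if "x \<in> E" for r x using that by (simp add: E_def)
  have hom: "G (\<lambda>i. r * x i) (r * t)" if x: "x \<in> E" and g: "G x t" and r: "0 \<le> r" for x t r
  proof -
    obtain f where f: "f \<in> weight_cone K" "X f = x" "T f = t" using surj[OF x g] by blast
    have "X (\<lambda>v. r * f v) = (\<lambda>i. r * x i)" using homX[OF r] f by auto
    then show ?thesis using img[OF weight_cone_scale[OF f(1) r]] homT[OF r] f by simp
  qed
  have up: "G x t'" if "x \<in> E" "G x t" "t \<le> t'" for x t t'
    using above[OF that(1,2), of t'] that by (cases "t = t'") force+
  \<comment> \<open>Rescaling moves any point close to the axis, where both a point of the cone and a point
     outside of it are surrounded by points of the same kind.\<close>
  have scale: "\<exists>r>0. \<forall>i<n. \<bar>r * x i\<bar> < \<delta>" if "0 < \<delta>" for x :: "nat \<Rightarrow> real" and \<delta>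
  proof -
    define M where "M = 1 + (\<Sum>i<n. \<bar>x i\<bar>)"
    have M: "M > 0" unfolding M_def by (smt (verit) sum_nonneg abs_ge_zero)
    have "\<bar>x i\<bar> < M" if "i < n" for i
      using member_le_sum[of i "{..<n}" "\<lambda>i. \<bar>x i\<bar>"] that unfolding M_def by auto
    then have "\<bar>\<delta> / M * x i\<bar> < \<delta>" if "i < n" for i
      using that \<open>0 < \<delta>\<close> M by (simp add: abs_mult pos_divide_less_eq mult.commute)
    then show ?thesis using M that by (intro exI[of _ "\<delta> / M"]) auto
  qed
  have ex: "\<exists>t. G x t" if x: "x \<in> E" for x
  proof -
    obtain \<delta> where \<delta>: "\<delta> > 0" "\<And>y s. y \<in> E \<Longrightarrow> (\<forall>i<n. \<bar>y i - 0\<bar> < \<delta>) \<Longrightarrow> \<bar>s - 1\<bar> < \<delta> \<Longrightarrow> G y s"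
      using above[OF zE G00, of 1] by auto
    obtain r where r: "r > 0" "\<forall>i<n. \<bar>r * x i\<bar> < \<delta>" using scale[OF \<delta>(1)] by blast
    then have "G (\<lambda>i. r * x i) 1" using \<delta> sE[OF x] by auto
    from hom[OF sE[OF x] this, of "1/r"] show ?thesis using r by auto
  qed
  have nex: "\<exists>t. \<not> G x t" if x: "x \<in> E" for x
  proof -
    obtain \<delta> where \<delta>: "\<delta> > 0" "\<And>y s. y \<in> E \<Longrightarrow> (\<forall>i<n. \<bar>y i - 0\<bar> < \<delta>) \<Longrightarrow> \<bar>s - (-1)\<bar> < \<delta> \<Longrightarrow> \<not> G y s"
      using below[OF zE neg] by auto
    obtain r where r: "r > 0" "\<forall>i<n. \<bar>r * x i\<bar> < \<delta>" using scale[OF \<delta>(1)] by blast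
    then have "\<not> G (\<lambda>i. r * x i) (-1)" using \<delta> sE[OF x] by auto
    then have "\<not> G x (-1/r)" using hom[OF x, of "-1/r" r] r by auto
    then show ?thesis by blast
  qed
  define L where "L = (\<lambda>x. Inf {t. G x t})"
  have GL: "G x t \<longleftrightarrow> L x \<le> t" if x: "x \<in> E" for x t
  proof -
    obtain t0 where t0: "\<not> G x t0" using nex[OF x] by blast
    have bdd: "bdd_below {t. G x t}"
      using up[OF x] t0 by (intro bdd_belowI[of _ t0]) (meson linear mem_Collect_eq)
    have "G x (L x)"
    proof (rule ccontr)
      assume "\<not> G x (L x)"
      from below[OF x this] obtain \<delta> where d0: "\<delta> > 0"
        and d1: "\<forall>y\<in>E. \<forall>s. (\<forall>i<n. \<bar>y i - x i\<bar> < \<delta>) \<and> \<bar>s - L x\<bar> < \<delta> \<longrightarrow> \<not> G y s" by blast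
      have \<delta>: "\<delta> > 0" "\<And>s. \<bar>s - L x\<bar> < \<delta> \<Longrightarrow> \<not> G x s"
        using d0 d1[rule_format, OF x] by simp_all
      have "{t. G x t} \<noteq> {}" using ex[OF x] by simp
      then have "\<exists>t\<in>{t. G x t}. t < L x + \<delta>"
        using cInf_less_iff[OF _ bdd, of "L x + \<delta>"] \<delta>(1) unfolding L_def by simp
      then obtain t where t: "G x t" "t < L x + \<delta>" by auto
      moreover have "L x \<le> t" unfolding L_def using t bdd by (intro cInf_lower) auto
      ultimately show False using \<delta>(2)[of t] by auto
    qed
    then show ?thesis
      using up[OF x, of "L x" t] cInf_lower[OF _ bdd, of t] unfolding L_def by blast
  qed
  have Lhom: "L (\<lambda>i. r * x i) = r * L x" if x: "x \<in> E" and r: "r > 0" for x r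
  proof (rule antisym)
    show "L (\<lambda>i. r * x i) \<le> r * L x"
      using hom[OF x, of "L x" r] GL[OF x] GL[OF sE[OF x]] r by simp
    have "G (\<lambda>i. (1/r) * (r * x i)) ((1/r) * L (\<lambda>i. r * x i))"
      using GL[OF sE[OF x]] r by (intro hom[OF sE[OF x]]) auto
    then have "G x (L (\<lambda>i. r * x i) / r)" using r by simp
    then show "r * L x \<le> L (\<lambda>i. r * x i)"
      using GL[OF x] r by (simp add: pos_le_divide_eq mult.commute)
  qed
  have L0: "L (\<lambda>_. 0) = 0" using Lhom[OF zE, of 2] by simp
  have contL: "continuous_on UNIV (\<lambda>g. L (X g))"
  proof -
    have "((\<lambda>g. L (X g)) \<longlongrightarrow> L (X g)) (at g)" for g
    proof (rule tendstoI)
      fix e :: real assume e: "e > 0"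
      have "\<not> G (X g) (L (X g) - e/2)" using GL[OF XE] e by simp
      from below[OF XE this] obtain d1 where d1: "d1 > 0"
        "\<And>y. y \<in> E \<Longrightarrow> (\<forall>i<n. \<bar>y i - X g i\<bar> < d1) \<Longrightarrow> \<not> G y (L (X g) - e/2)"
        by (metis abs_zero diff_self)
      have "G (X g) (L (X g))" using GL[OF XE] by simp
      moreover have "L (X g) < L (X g) + e/2" using e by simp
      ultimately obtain d2 where d2: "d2 > 0"
        "\<And>y. y \<in> E \<Longrightarrow> (\<forall>i<n. \<bar>y i - X g i\<bar> < d2) \<Longrightarrow> G y (L (X g) + e/2)"
        using above[OF XE] by (metis abs_zero diff_self)
      define d where "d = min d1 d2"
      have d: "d > 0" using d1 d2 by (simp add: d_def)
      have tX: "((\<lambda>h. X h i) \<longlongrightarrow> X g i) (at g)" for i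
        using contX[of i] unfolding continuous_on_def by simp
      have "\<forall>\<^sub>F h in at g. \<bar>X h i - X g i\<bar> < d" for i
        using tendstoD[OF tX d] by (simp add: dist_real_def)
      then have "\<forall>\<^sub>F h in at g. \<forall>i\<in>{..<n}. \<bar>X h i - X g i\<bar> < d"
        by (intro eventually_ball_finite) auto
      then show "\<forall>\<^sub>F h in at g. dist (L (X h)) (L (X g)) < e"
      proof (rule eventually_mono)
        fix h assume h: "\<forall>i\<in>{..<n}. \<bar>X h i - X g i\<bar> < d"
        have "\<not> G (X h) (L (X g) - e/2)" using h by (intro d1(2) XE) (auto simp: d_def)
        moreover have "G (X h) (L (X g) + e/2)" using h by (intro d2(2) XE) (auto simp: d_def)
        ultimately show "dist (L (X h)) (L (X g)) < e"
          using GL[OF XE, of h] e by (simp add: dist_real_def)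
      qed
    qed
    then show ?thesis by (simp add: continuous_on_def)
  qed
  define nrm where "nrm = (\<lambda>x::nat\<Rightarrow>real. sqrt (\<Sum>i<n. (x i)\<^sup>2))"
  have nrm0: "0 \<le> nrm x" for x unfolding nrm_def by (simp add: sum_nonneg)
  have nrm_scale: "nrm (\<lambda>i. x i / r) = nrm x / r" if "r > 0" for x r
    using that by (simp add: nrm_def power_divide sum_divide_distrib[symmetric] real_sqrt_divide)
  have nrm_zero: "x = (\<lambda>_. 0)" if "nrm x = 0" "x \<in> E" for x
  proof
    fix i show "x i = 0"
    proof (cases "i < n")
      case True
      have "(\<Sum>i<n. (x i)\<^sup>2) = 0" using that by (simp add: nrm_def)
      then show ?thesis using True by (simp add: sum_nonneg_eq_0_iff)
    next
      case False then show ?thesis using that by (simp add: E_def)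
    qed
  qed
  \<comment> \<open>The norm after straightening the epigraph, with respect to which the cone is normalized.\<close>
  define N where "N = (\<lambda>g. nrm (X g) + (T g - L (X g)))"
  have LT: "L (X g) \<le> T g" if "g \<in> weight_cone K" for g using img[OF that] GL[OF XE] by simp
  have Npos: "N g > 0" if g: "g \<in> weight_cone K" "g \<noteq> (\<lambda>_. 0)" for g
  proof (rule ccontr)
    assume "\<not> N g > 0"
    then have "nrm (X g) = 0" and T: "T g = L (X g)"
      using LT[OF g(1)] nrm0[of "X g"] unfolding N_def by linarith+
    then have x: "X g = (\<lambda>_. 0)" using nrm_zero XE by blast
    then have "T g = 0" using T L0 by simp
    then show False using inj[OF g(1) zero_cone] x X0 T0 g(2) by simp
  qed
  have scaleN: "X (\<lambda>v. g v / r) = (\<lambda>i. X g i / r)" "T (\<lambda>v. g v / r) = T g / r"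
     "L (X (\<lambda>v. g v / r)) = L (X g) / r" "N (\<lambda>v. g v / r) = N g / r" if r: "r > 0" for g r
  proof -
    show 1: "X (\<lambda>v. g v / r) = (\<lambda>i. X g i / r)" using homX[of "1/r" g] r by auto
    show 2: "T (\<lambda>v. g v / r) = T g / r" using homT[of "1/r" g] r by auto
    show 3: "L (X (\<lambda>v. g v / r)) = L (X g) / r" using Lhom[OF XE, of "1/r" g] r 1 by simp
    show "N (\<lambda>v. g v / r) = N g / r"
      unfolding N_def 2 3 unfolding 1 using nrm_scale[OF r] by (simp add: diff_divide_distrib add_divide_distrib)
  qed
  define F where "F = (\<lambda>g i. X g i / N g)"
  let ?P = "realization_points K"
  have Pnz: "g \<noteq> (\<lambda>_. 0)" if "g \<in> ?P" for g
    using that by (auto simp: realization_points_def)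
  have PN: "N g > 0" if "g \<in> ?P" for g using Npos Pnz that realization_subset_cone by blast
  have nF: "nrm (F g) = nrm (X g) / N g" if "g \<in> ?P" for g
    unfolding F_def by (rule nrm_scale[OF PN[OF that]])
  have ball: "x \<in> topspace (closed_ball_space n) \<longleftrightarrow> x \<in> E \<and> nrm x \<le> 1" for x
    by (auto simp: closed_ball_space_def topspace_Euclidean_space E_def nrm_def)
  have into: "F g \<in> topspace (closed_ball_space n)" if g: "g \<in> ?P" for g
  proof -
    have "nrm (X g) \<le> N g" using LT g realization_subset_cone unfolding N_def by fastforce
    moreover have "F g \<in> E" using XE[of g] by (simp add: F_def E_def)
    ultimately show ?thesis unfolding ball nF[OF g] using PN[OF g] by simp
  qed
  have onto: "x \<in> F ` ?P" if x: "x \<in> topspace (closed_ball_space n)" for x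
  proof -
    have xE: "x \<in> E" and x1: "nrm x \<le> 1" using x ball by auto
    define t where "t = L x + (1 - nrm x)"
    have "G x t" using GL[OF xE] x1 by (simp add: t_def)
    from surj[OF xE this] obtain f where f: "f \<in> weight_cone K" "X f = x" "T f = t" by blast
    have Nf: "N f = 1" using f by (simp add: N_def t_def)
    have "f \<noteq> (\<lambda>_. 0)"
    proof
      assume "f = (\<lambda>_. 0)"
      then have "N f = 0" using X0 T0 L0 by (simp add: N_def nrm_def)
      then show False using Nf by simp
    qed
    then obtain v0 where "f v0 \<noteq> 0" by auto
    from cone_normalize[OF K f(1) this] obtain s where s: "s > 0" "(\<lambda>v. f v / s) \<in> ?P" .
    have "F (\<lambda>v. f v / s) = x"
      unfolding F_def scaleN(4)[OF s(1)] scaleN(1)[OF s(1)] using Nf f s(1) by simp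
    then show ?thesis using s(2) by blast
  qed
  have injF: "inj_on F ?P"
  proof (rule inj_onI)
    fix g h assume gh: "g \<in> ?P" "h \<in> ?P" "F g = F h"
    let ?g = "\<lambda>v. g v / N g" let ?h = "\<lambda>v. h v / N h"
    have c: "?g \<in> weight_cone K" "?h \<in> weight_cone K"
      using weight_cone_scale[of g K "1 / N g"] weight_cone_scale[of h K "1 / N h"] gh PN realization_subset_cone
      by (auto simp: less_imp_le)
    have eX: "X ?g = X ?h" using gh scaleN(1)[OF PN[OF gh(1)], of g] scaleN(1)[OF PN[OF gh(2)], of h]
      by (simp add: F_def)
    have "N ?g = 1" "N ?h = 1" using scaleN(4)[OF PN[OF gh(1)], of g] scaleN(4)[OF PN[OF gh(2)], of h] PN gh
      by (auto simp: less_imp_neq[symmetric])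
    then have "T ?g = T ?h" using eX unfolding N_def by simp
    then have eq: "?g = ?h" using inj[OF c eX] by blast
    then have eq': "g v / N g = h v / N h" for v by metis
    have S: "{v. g v \<noteq> 0} = {v. h v \<noteq> 0}"
    proof -
      have "g v = 0 \<longleftrightarrow> h v = 0" for v using eq'[of v] PN[OF gh(1)] PN[OF gh(2)] by (metis divide_eq_0_iff less_irrefl)
      then show ?thesis by simp
    qed
    have sg: "sum g {v. g v \<noteq> 0} = 1" and sh: "sum h {v. g v \<noteq> 0} = 1"
      using gh S by (auto simp: realization_points_def)
    have "1 / N g = sum (\<lambda>v. g v / N g) {v. g v \<noteq> 0}" by (simp add: sum_divide_distrib[symmetric] sg)
    also have "\<dots> = sum (\<lambda>v. h v / N h) {v. g v \<noteq> 0}" using eq' by simp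
    also have "\<dots> = 1 / N h" by (simp add: sum_divide_distrib[symmetric] sh)
    finally have "N g = N h" by simp
    then show "g = h" using eq' PN[OF gh(2)] by (intro ext) (metis divide_cancel_right less_irrefl)
  qed
  have contF: "continuous_on ?P F"
  proof (rule continuous_on_coordinatewise_then_product)
    fix i
    have "continuous_on UNIV (\<lambda>g. N g)"
      unfolding N_def nrm_def by (intro continuous_intros contX contT contL)
    then have "continuous_on ?P N" "continuous_on ?P (\<lambda>g. X g i)"
      using contX continuous_on_subset by blast+
    then show "continuous_on ?P (\<lambda>g. F g i)"
      unfolding F_def using PN by (intro continuous_on_divide) (auto simp: less_imp_neq[symmetric])
  qed
  have cm: "continuous_map (top_of_set ?P) (closed_ball_space n) F"
    using contF into unfolding closed_ball_space_def Euclidean_space_def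
    by (auto simp: continuous_map_in_subtopology euclidean_product_topology)
  have "homeomorphic_map (top_of_set ?P) (closed_ball_space n) F"
  proof (rule continuous_imp_homeomorphic_map[OF cm])
    show "compact_space (top_of_set ?P)"
      using compact_realization_points[OF K] by (simp add: compact_space_subtopology)
    show "Hausdorff_space (closed_ball_space n)"
      unfolding closed_ball_space_def Euclidean_space_def
      by (intro Hausdorff_space_subtopology) (simp add: Hausdorff_space_product_topology)
    show "F ` topspace (top_of_set ?P) = topspace (closed_ball_space n)"
      using into onto by auto
    show "inj_on F (topspace (top_of_set ?P))" using injF by simp
  qed
  then show ?thesis
    unfolding is_closed_ball_def realization_eq_top_of_set[OF K]
    by (rule homeomorphic_map_imp_homeomorphic_space)
qed

section \<open>Noncrossing arcs and heights over an interval\<close>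

definition quadratic :: "(int \<Rightarrow> real) \<Rightarrow> bool" where
  "quadratic l \<longleftrightarrow> (\<exists>A B C. \<forall>i. l i = A + B * real_of_int i + C * (real_of_int i)\<^sup>2)"

lemma quadI: "(\<And>i. l i = A + B * real_of_int i + C * (real_of_int i)\<^sup>2) \<Longrightarrow> quadratic l"
  unfolding quadratic_def by blast

lemma quad_const: "quadratic (\<lambda>_. c)"
  by (rule quadI[of _ c 0 0]) simp

lemma quad_add: assumes "quadratic f" "quadratic g" shows "quadratic (\<lambda>i. f i + g i)"
proof -
  obtain A B C A' B' C' where "\<And>i. f i = A + B * real_of_int i + C * (real_of_int i)\<^sup>2"
    "\<And>i. g i = A' + B' * real_of_int i + C' * (real_of_int i)\<^sup>2" using assms unfolding quadratic_def by blast
  then show ?thesis by (intro quadI[of _ "A + A'" "B + B'" "C + C'"]) (simp add: algebra_simps)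
qed

lemma quad_scale: assumes "quadratic f" shows "quadratic (\<lambda>i. c * f i)"
proof -
  obtain A B C where "\<And>i. f i = A + B * real_of_int i + C * (real_of_int i)\<^sup>2"
    using assms unfolding quadratic_def by blast
  then show ?thesis by (intro quadI[of _ "c * A" "c * B" "c * C"]) (simp add: algebra_simps)
qed

lemma quad_diff: assumes "quadratic f" "quadratic g" shows "quadratic (\<lambda>i. f i - g i)"
  using quad_add[OF assms(1) quad_scale[OF assms(2), of "-1"]] by simp

lemma quad_sum: "(\<And>d. d \<in> S \<Longrightarrow> quadratic (f d)) \<Longrightarrow> quadratic (\<lambda>i. \<Sum>d\<in>S. f d i)"
  by (induction S rule: infinite_finite_induct) (auto intro: quad_const quad_add)

lemma quad_shift: assumes "quadratic f" shows "quadratic (\<lambda>i. f (i + k))"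
proof -
  obtain A B C where f: "\<And>i. f i = A + B * real_of_int i + C * (real_of_int i)\<^sup>2"
    using assms unfolding quadratic_def by blast
  show ?thesis
    by (rule quadI[of _ "A + B * k + C * k^2" "B + 2 * C * k" C]) (simp add: f algebra_simps power2_eq_square)
qed

text \<open>
  The quadratic function with leading coefficient \<open>-1\<close> vanishing at \<open>a\<close> and
  \<open>b\<close>. For integers on a parabola it is the affine function that vanishes on the chord joining
  \<open>a\<close> and \<open>b\<close>.
\<close>

definition cap :: "int \<Rightarrow> int \<Rightarrow> int \<Rightarrow> real" where
  "cap a b i = real_of_int (b - i) * real_of_int (i - a)"

lemma quad_cap: "quadratic (cap a b)"
  by (rule quadI[of _ "- (a * b)" "a + b" "-1"]) (simp add: cap_def algebra_simps power2_eq_square)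

lemma cap_pos: "a < i \<Longrightarrow> i < b \<Longrightarrow> 0 < cap a b i"
  by (simp add: cap_def)

lemma cap_nonneg: "a \<le> i \<Longrightarrow> i \<le> b \<Longrightarrow> 0 \<le> cap a b i"
  by (simp add: cap_def)

lemma cap_neg: "a < b \<Longrightarrow> i < a \<or> b < i \<Longrightarrow> cap a b i < 0"
  by (auto simp: cap_def mult_less_0_iff)

lemma cap_end [simp]: "cap a b a = 0" "cap a b b = 0"
  by (simp_all add: cap_def)

definition bump :: "int \<Rightarrow> int \<Rightarrow> int \<Rightarrow> real" where
  "bump a b i = max 0 (cap a b i)"

lemma bump_nonneg: "0 \<le> bump a b i" by (simp add: bump_def)

lemma cap_le_bump: "cap a b i \<le> bump a b i" by (simp add: bump_def)

lemma bump_in: "a \<le> i \<Longrightarrow> i \<le> b \<Longrightarrow> bump a b i = cap a b i"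
  using cap_nonneg by (simp add: bump_def)

lemma bump_out: "a < b \<Longrightarrow> i \<le> a \<or> b \<le> i \<Longrightarrow> bump a b i = 0"
  using cap_neg[of a b i] cap_end[of a b] unfolding bump_def by (cases "i = a \<or> i = b") auto

lemma bump_pos_iff: "a < b \<Longrightarrow> 0 < bump a b i \<longleftrightarrow> a < i \<and> i < b"
  using bump_out[of a b i] bump_in[of a i b] cap_pos[of a i b] by force

lemma quad_chord:
  assumes "\<And>i. l i = A + B * real_of_int i + C * (real_of_int i)\<^sup>2"
  shows "(z - x) * l y = (z - y) * l x + (y - x) * l z - C * ((y - x) * (z - y) * (z - x))"
  unfolding assms by (simp add: algebra_simps power2_eq_square)

lemma quad_concave:
  assumes l: "\<And>i. l i = A + B * real_of_int i + C * (real_of_int i)\<^sup>2" and C: "C \<le> 0"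
    and xyz: "x < y" "y < z"
  shows "min (l x) (l z) \<le> l y"
proof -
  let ?m = "min (l x) (l z)"
  have "0 \<le> (- C) * ((y - x) * (z - y) * (z - x))" using C xyz by (intro mult_nonneg_nonneg) auto
  then have "(z - y) * l x + (y - x) * l z \<le> (z - x) * l y" using quad_chord[OF l, of z x y] by simp
  moreover have "(z - y) * ?m \<le> (z - y) * l x" "(y - x) * ?m \<le> (y - x) * l z"
    using xyz by (auto intro!: mult_left_mono)
  ultimately have "(z - x) * ?m \<le> (z - x) * l y" by (simp add: algebra_simps)
  then show ?thesis using xyz by (simp add: mult_le_cancel_left)
qed

lemma quad_convex:
  assumes l: "\<And>i. l i = A + B * real_of_int i + C * (real_of_int i)\<^sup>2" and C: "0 \<le> C"
    and xyz: "x < y" "y < z"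
  shows "l y \<le> max (l x) (l z)"
proof -
  have "min (- l x) (- l z) \<le> - l y"
    using quad_concave[of "\<lambda>i. - l i" "-A" "-B" "-C" x y z] l C xyz by simp
  then show ?thesis by linarith
qed

text \<open>
  A quadratic function changes sign at most twice. This is the reason why exposed arcs do not cross.
\<close>

lemma quad_sign_changes:
  assumes "quadratic l" "a < c" "c < b" "b < e" "0 < l a" "l c < 0" "0 < l b" "l e < 0"
  shows False
proof -
  obtain A B C where l: "\<And>i. l i = A + B * real_of_int i + C * (real_of_int i)\<^sup>2"
    using assms(1) unfolding quadratic_def by blast
  show False
  proof (cases "C \<le> 0")
    case True
    then show False using quad_concave[OF l True assms(2,3)] assms by linarith
  next
    case False
    then show False using quad_convex[OF l _ assms(3,4)] assms by linarith
  qed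
qed

definition crosses :: "int \<times> int \<Rightarrow> int \<times> int \<Rightarrow> bool" where
  "crosses d e \<longleftrightarrow> (fst d < fst e \<and> fst e < snd d \<and> snd d < snd e) \<or>
     (fst e < fst d \<and> fst d < snd e \<and> snd e < snd d)"

definition noncrossing :: "(int \<times> int) set \<Rightarrow> bool" where
  "noncrossing S \<longleftrightarrow> (\<forall>d\<in>S. \<forall>e\<in>S. \<not> crosses d e)"

lemma crosses_sym: "crosses d e = crosses e d" by (auto simp: crosses_def)
lemma not_crosses_self: "\<not> crosses d d" by (auto simp: crosses_def)

text \<open>
  The arc is an edge of the lower convex hull of the heights along which the hull is strictly bent:
  there are supporting functions whose contact set consists of the two endpoints.
\<close>

definition exposed :: "int set \<Rightarrow> (int \<Rightarrow> real) \<Rightarrow> int \<Rightarrow> int \<Rightarrow> bool" where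
  "exposed I h a b \<longleftrightarrow> a \<in> I \<and> b \<in> I \<and> a < b \<and>
     (\<exists>l. quadratic l \<and> (\<forall>i\<in>I. l i \<le> h i \<and> (l i = h i \<longleftrightarrow> i = a \<or> i = b)))"

lemma exposedD:
  assumes "exposed I h a b"
  obtains l where "quadratic l" "\<And>i. i \<in> I \<Longrightarrow> l i \<le> h i" "\<And>i. i \<in> I \<Longrightarrow> i \<noteq> a \<Longrightarrow> i \<noteq> b \<Longrightarrow> l i < h i"
    "l a = h a" "l b = h b" "a \<in> I" "b \<in> I" "a < b"
  using assms unfolding exposed_def by (metis order_le_less)

lemma exposedI:
  assumes "quadratic l" "\<And>i. i \<in> I \<Longrightarrow> i \<noteq> a \<Longrightarrow> i \<noteq> b \<Longrightarrow> l i < h i"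
    "l a = h a" "l b = h b" "a \<in> I" "b \<in> I" "a < b"
  shows "exposed I h a b"
  unfolding exposed_def using assms by (metis order_le_less order_less_irrefl)

lemma exposed_not_crosses:
  assumes "exposed I h a b" "exposed I h c e"
  shows "\<not> crosses (a, b) (c, e)"
proof -
  have *: False if e1: "exposed I h a b" and e2: "exposed I h c e" and o: "a < c" "c < b" "b < e" for a b c e
  proof -
    obtain l where l: "quadratic l" "\<And>i. i \<in> I \<Longrightarrow> i \<noteq> a \<Longrightarrow> i \<noteq> b \<Longrightarrow> l i < h i" "l a = h a" "l b = h b" "a \<in> I" "b \<in> I"
      using exposedD[OF e1] by metis
    obtain k where k: "quadratic k" "\<And>i. i \<in> I \<Longrightarrow> i \<noteq> c \<Longrightarrow> i \<noteq> e \<Longrightarrow> k i < h i" "k c = h c" "k e = h e" "c \<in> I" "e \<in> I"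
      using exposedD[OF e2] by metis
    show False
      using quad_sign_changes[OF quad_diff[OF l(1) k(1)] o] l(2)[of c] l(2)[of e] k(2)[of a] k(2)[of b] l k o
      by force
  qed
  show ?thesis using *[OF assms] *[OF assms(2,1)] by (auto simp: crosses_def)
qed

text \<open>
  Used to tilt a supporting function a little without losing finitely many strict inequalities.
\<close>

lemma small_multiples:
  assumes "finite A" "\<And>i. i \<in> A \<Longrightarrow> 0 < (g i :: real)"
  shows "\<exists>\<epsilon>>0. \<forall>s. 0 \<le> s \<and> s \<le> \<epsilon> \<longrightarrow> (\<forall>i\<in>A. s * f i < g i)"
  using assms
proof (induction A rule: finite_induct)
  case empty
  then show ?case by (intro exI[of _ 1]) auto
next
  case (insert x A)
  then obtain \<epsilon> where \<epsilon>: "\<epsilon> > 0" "\<And>s i. 0 \<le> s \<Longrightarrow> s \<le> \<epsilon> \<Longrightarrow> i \<in> A \<Longrightarrow> s * f i < g i" by auto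
  define \<eta> where "\<eta> = g x / (1 + \<bar>f x\<bar>)"
  have gx: "g x > 0" using insert by auto
  then have \<eta>: "\<eta> > 0" by (simp add: \<eta>_def add_pos_nonneg)
  have "s * f x < g x" if "0 \<le> s" "s \<le> \<eta>" for s
  proof -
    have "s * f x \<le> s * \<bar>f x\<bar>" using that by (intro mult_left_mono) auto
    also have "\<dots> \<le> \<eta> * \<bar>f x\<bar>" using that by (intro mult_right_mono) auto
    also have "\<dots> < \<eta> * (1 + \<bar>f x\<bar>)" using \<eta> by simp
    also have "\<dots> = g x" by (simp add: \<eta>_def add_nonneg_eq_0_iff)
    finally show ?thesis .
  qed
  then show ?case using \<epsilon> \<eta> by (intro exI[of _ "min \<epsilon> \<eta>"]) auto
qed

definition arcs_in :: "int \<Rightarrow> int \<Rightarrow> (int \<times> int) set" where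
  "arcs_in p q = {(a, b). p \<le> a \<and> a + 2 \<le> b \<and> b \<le> q}"

lemma arcs_in_iff: "(a, b) \<in> arcs_in p q \<longleftrightarrow> p \<le> a \<and> a + 2 \<le> b \<and> b \<le> q" by (simp add: arcs_in_def)

lemma finite_arcs_in: "finite (arcs_in p q)"
  by (rule finite_subset[of _ "{p..q} \<times> {p..q}"]) (auto simp: arcs_in_def)

text \<open>
  Nonnegative weights on pairwise noncrossing arcs, in analogy with weighted multicurves.
\<close>

definition lamination :: "int \<Rightarrow> int \<Rightarrow> (int \<times> int \<Rightarrow> real) \<Rightarrow> bool" where
  "lamination p q w \<longleftrightarrow> (\<forall>d. 0 \<le> w d) \<and> {d. w d \<noteq> 0} \<subseteq> arcs_in p q \<and> noncrossing {d. w d \<noteq> 0}"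

lemma laminationI:
  assumes "\<And>d. 0 \<le> w d" "\<And>d. w d \<noteq> 0 \<Longrightarrow> d \<in> arcs_in p q" "\<And>d e. w d \<noteq> 0 \<Longrightarrow> w e \<noteq> 0 \<Longrightarrow> \<not> crosses d e"
  shows "lamination p q w"
  unfolding lamination_def noncrossing_def using assms by blast

lemma laminationD:
  assumes "lamination p q w"
  shows "0 \<le> w d" "w d \<noteq> 0 \<Longrightarrow> d \<in> arcs_in p q" "w d \<noteq> 0 \<Longrightarrow> w e \<noteq> 0 \<Longrightarrow> \<not> crosses d e"
  using assms unfolding lamination_def noncrossing_def by blast+

definition height :: "int \<Rightarrow> int \<Rightarrow> (int \<times> int \<Rightarrow> real) \<Rightarrow> int \<Rightarrow> real" where
  "height p q w i = (\<Sum>d\<in>arcs_in p q. w d * bump (fst d) (snd d) i)"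

lemma height_nonneg: "lamination p q w \<Longrightarrow> 0 \<le> height p q w i"
  unfolding height_def using laminationD(1) bump_nonneg by (intro sum_nonneg mult_nonneg_nonneg) auto

lemma height_pos_iff:
  assumes w: "lamination p q w"
  shows "0 < height p q w i \<longleftrightarrow> (\<exists>a b. w (a, b) \<noteq> 0 \<and> a < i \<and> i < b)"
proof -
  have nn: "0 \<le> w d * bump (fst d) (snd d) i" for d
    using laminationD(1)[OF w] bump_nonneg by simp
  have iff: "w d * bump (fst d) (snd d) i \<noteq> 0 \<longleftrightarrow> w d \<noteq> 0 \<and> fst d < i \<and> i < snd d" if "d \<in> arcs_in p q" for d
  proof -
    have "fst d < snd d" using that by (auto simp: arcs_in_def)
    from bump_pos_iff[OF this, of i] show ?thesis using bump_nonneg[of "fst d" "snd d" i] by auto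
  qed
  have "0 < height p q w i \<longleftrightarrow> height p q w i \<noteq> 0" using height_nonneg[OF w, of i] by auto
  also have "\<dots> \<longleftrightarrow> (\<exists>d\<in>arcs_in p q. w d * bump (fst d) (snd d) i \<noteq> 0)"
    unfolding height_def using nn finite_arcs_in by (subst sum_nonneg_eq_0_iff) auto
  also have "\<dots> \<longleftrightarrow> (\<exists>d\<in>arcs_in p q. w d \<noteq> 0 \<and> fst d < i \<and> i < snd d)" using iff by blast
  also have "\<dots> \<longleftrightarrow> (\<exists>a b. w (a, b) \<noteq> 0 \<and> a < i \<and> i < b)"
    using laminationD(2)[OF w] by force
  finally show ?thesis .
qed

lemma height_end:
  assumes "lamination p q w" "i \<le> p \<or> q \<le> i"
  shows "height p q w i = 0"
proof -
  have "\<not> 0 < height p q w i" unfolding height_pos_iff[OF assms(1)]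
    using laminationD(2)[OF assms(1)] assms(2) arcs_in_iff by fastforce
  then show ?thesis using height_nonneg[OF assms(1), of i] by linarith
qed

lemma height_update:
  assumes "(a, b) \<in> arcs_in p q"
  shows "height p q (w((a, b) := w (a, b) + s)) i = height p q w i + s * bump a b i"
proof -
  have "height p q (w((a, b) := w (a, b) + s)) i =
      (\<Sum>d\<in>arcs_in p q. w d * bump (fst d) (snd d) i + (if d = (a, b) then s * bump a b i else 0))"
    unfolding height_def by (rule sum.cong) (auto simp: algebra_simps)
  also have "\<dots> = height p q w i + s * bump a b i"
    using assms by (simp add: sum.distrib height_def finite_arcs_in)
  finally show ?thesis .
qed

lemma gap_exists:
  fixes h :: "int \<Rightarrow> real"
  assumes "h p = 0" "h q = 0" "i \<in> {p..q}" "h i \<noteq> 0"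
  obtains a b where "p \<le> a" "a < i" "i < b" "b \<le> q" "h a = 0" "h b = 0" "\<And>j. a < j \<Longrightarrow> j < b \<Longrightarrow> h j \<noteq> 0"
proof -
  define A where "A = {j\<in>{p..i}. h j = 0}"
  define B where "B = {j\<in>{i..q}. h j = 0}"
  have fin: "finite A" "finite B" unfolding A_def B_def by (rule finite_subset[of _ "{p..i}"], auto, rule finite_subset[of _ "{i..q}"], auto)
  have A: "finite A" "p \<in> A" and B: "finite B" "q \<in> B" using assms fin by (auto simp: A_def B_def)
  have a: "Max A \<in> A" and b: "Min B \<in> B" using A B by (auto intro: Max_in Min_in)
  show thesis
  proof (rule that[of "Max A" "Min B"])
    show "p \<le> Max A" "Min B \<le> q" "h (Max A) = 0" "h (Min B) = 0" using a b by (auto simp: A_def B_def)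
    show "Max A < i" "i < Min B" using a b assms(4) by (auto simp: A_def B_def order_le_less)
    fix j assume j: "Max A < j" "j < Min B"
    show "h j \<noteq> 0"
    proof
      assume "h j = 0"
      then have "j \<in> A \<or> j \<in> B" using j a b by (auto simp: A_def B_def)
      then show False using j Max_ge[OF A(1), of j] Min_le[OF B(1), of j] by auto
    qed
  qed
qed

text \<open>
  If the heights vanish at \<open>a\<close> and \<open>b\<close> but nowhere in between, the arcs over the
  points in between cannot leave \<open>[a, b]\<close>. The longest of them that starts at \<open>a\<close> ends at a point
  which no other arc passes over without crossing it, so it must end at \<open>b\<close>.
\<close>

lemma gap_arc:
  assumes w: "lamination p q w" and ab: "a + 2 \<le> b"
    and 0: "height p q w a = 0" "height p q w b = 0" and pos: "\<And>j. a < j \<Longrightarrow> j < b \<Longrightarrow> 0 < height p q w j"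
  shows "w (a, b) \<noteq> 0"
proof -
  have na: False if "w (c, e) \<noteq> 0" "c < a" "a < e" for c e using height_pos_iff[OF w, of a] 0 that by auto
  have nb: False if "w (c, e) \<noteq> 0" "c < b" "b < e" for c e using height_pos_iff[OF w, of b] 0 that by auto
  define M where "M = {e. a < e \<and> w (a, e) \<noteq> 0}"
  have "M \<subseteq> {..q}" "M \<subseteq> {a..}" using laminationD(2)[OF w] by (auto simp: M_def arcs_in_def)
  then have "M \<subseteq> {a..q}" by auto
  then have fin: "finite M" by (rule finite_subset) simp
  obtain c e where ce: "w (c, e) \<noteq> 0" "c < a + 1" "a + 1 < e"
    using pos[of "a + 1"] ab height_pos_iff[OF w] by auto
  then have "c = a" using na[of c e] by force
  then have "e \<in> M" using ce by (auto simp: M_def)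
  then have M: "Max M \<in> M" using fin by (intro Max_in) auto
  define m where "m = Max M"
  have m: "a < m" "w (a, m) \<noteq> 0" using M by (auto simp: M_def m_def)
  have "m \<le> b" using nb[OF m(2)] ab by force
  moreover have False if mb: "m < b"
  proof -
    obtain c' e' where c': "w (c', e') \<noteq> 0" "c' < m" "m < e'"
      using pos[OF m(1) mb] height_pos_iff[OF w] by auto
    then have "a \<le> c'" using na[of c' e'] m by force
    moreover have "c' \<noteq> a"
    proof
      assume "c' = a"
      then have "e' \<in> M" using c' m by (auto simp: M_def)
      then show False using Max_ge[OF fin, of e'] c' by (auto simp: m_def)
    qed
    ultimately show False using laminationD(3)[OF w m(2) c'(1)] c' m by (auto simp: crosses_def)
  qed
  ultimately show ?thesis using m by force
qed

lemma lamination_add_arc: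
  assumes w: "lamination p q w" and ab: "(a, b) \<in> arcs_in p q" and s: "0 \<le> w (a, b) + s"
    and nc: "\<And>d. w d \<noteq> 0 \<Longrightarrow> \<not> crosses (a, b) d"
  shows "lamination p q (w((a, b) := w (a, b) + s))"
proof (rule laminationI)
  fix d e assume "(w((a, b) := w (a, b) + s)) d \<noteq> 0" "(w((a, b) := w (a, b) + s)) e \<noteq> 0"
  then show "\<not> crosses d e"
    using laminationD(3)[OF w, of d e] nc[of d] nc[of e] crosses_sym not_crosses_self
    by (cases "d = (a, b)"; cases "e = (a, b)") (auto simp: crosses_sym)
next
  fix d assume "(w((a, b) := w (a, b) + s)) d \<noteq> 0"
  then show "d \<in> arcs_in p q" using laminationD(2)[OF w, of d] ab by (cases "d = (a, b)") auto
qed (use laminationD(1)[OF w] s in auto)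

lemma not_crosses_zeros:
  assumes w: "lamination p q w" and "height p q w a = 0" "height p q w b = 0" "w d \<noteq> 0"
  shows "\<not> crosses (a, b) d"
proof -
  obtain c e where d: "d = (c, e)" by force
  have "\<not> (c < a \<and> a < e)" "\<not> (c < b \<and> b < e)"
    using assms height_pos_iff[OF w, of a] height_pos_iff[OF w, of b] unfolding d by auto
  then show ?thesis unfolding d crosses_def by auto
qed

text \<open>
  Subtract the largest multiple of the bump over a gap that keeps the function nonnegative. This
  creates a new zero inside the gap, so the number of nonzero values drops. The arcs used later do not
  pass over zeros and hence do not cross the arc of the gap.
\<close>

theorem lamination_exists:
  assumes "h p = 0" "h q = 0" "\<And>i. i \<in> {p..q} \<Longrightarrow> 0 \<le> h i"
  shows "\<exists>w. lamination p q w \<and> (\<forall>i\<in>{p..q}. h i = height p q w i)"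
  using assms
proof (induction "card {i\<in>{p..q}. h i \<noteq> 0}" arbitrary: h rule: less_induct)
  case less
  show ?case
  proof (cases "\<exists>i\<in>{p..q}. h i \<noteq> 0")
    case False
    have "lamination p q (\<lambda>_. 0)" by (rule laminationI) auto
    moreover have "\<forall>i\<in>{p..q}. h i = height p q (\<lambda>_. 0) i" using False by (simp add: height_def)
    ultimately show ?thesis by blast
  next
    case True
    then obtain i where i: "i \<in> {p..q}" "h i \<noteq> 0" by blast
    obtain a b where ab: "p \<le> a" "a < i" "i < b" "b \<le> q" "h a = 0" "h b = 0"
      "\<And>j. a < j \<Longrightarrow> j < b \<Longrightarrow> h j \<noteq> 0" using gap_exists[OF less(2,3) i] by blast
    have arc: "(a, b) \<in> arcs_in p q" using ab by (simp add: arcs_in_iff)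
    let ?r = "\<lambda>j. h j / bump a b j"
    define \<mu> where "\<mu> = Min (?r ` {a<..<b})"
    have ne: "{a<..<b} \<noteq> {}" using ab by auto
    have bp: "0 < bump a b j" if "j \<in> {a<..<b}" for j using that bump_pos_iff[of a b j] by auto
    have hp: "0 < h j" if "j \<in> {a<..<b}" for j using that ab(1,4) ab(7)[of j] less(4)[of j] by fastforce
    have "\<mu> \<in> ?r ` {a<..<b}" unfolding \<mu>_def using ne by (intro Min_in) auto
    then obtain k where k: "k \<in> {a<..<b}" "\<mu> = h k / bump a b k" by auto
    have \<mu>pos: "\<mu> > 0" using k hp bp by simp
    have \<mu>le: "\<mu> * bump a b j \<le> h j" if "j \<in> {a<..<b}" for j
    proof -
      have "\<mu> \<le> ?r j" unfolding \<mu>_def using that by (intro Min_le) auto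
      then show ?thesis using bp[OF that] by (simp add: pos_le_divide_eq)
    qed
    have out: "bump a b j = 0" if "j \<notin> {a<..<b}" for j using that ab by (intro bump_out) auto
    define h' where "h' = (\<lambda>j. h j - \<mu> * bump a b j)"
    have h'out: "h' j = h j" if "j \<notin> {a<..<b}" for j using out[OF that] by (simp add: h'_def)
    have h'k: "h' k = 0" using k bp[OF k(1)] by (simp add: h'_def)
    have sub: "{i\<in>{p..q}. h' i \<noteq> 0} \<subset> {i\<in>{p..q}. h i \<noteq> 0}"
    proof
      show "{i\<in>{p..q}. h' i \<noteq> 0} \<subseteq> {i\<in>{p..q}. h i \<noteq> 0}" using h'out ab(7) by fastforce
      have "k \<in> {i\<in>{p..q}. h i \<noteq> 0}" "k \<notin> {i\<in>{p..q}. h' i \<noteq> 0}" using k ab hp[OF k(1)] h'k by auto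
      then show "{i\<in>{p..q}. h' i \<noteq> 0} \<noteq> {i\<in>{p..q}. h i \<noteq> 0}" by blast
    qed
    have "\<exists>w. lamination p q w \<and> (\<forall>i\<in>{p..q}. h' i = height p q w i)"
    proof (rule less(1))
      show "card {i\<in>{p..q}. h' i \<noteq> 0} < card {i\<in>{p..q}. h i \<noteq> 0}"
        using sub by (intro psubset_card_mono finite_subset[of "{i\<in>{p..q}. h i \<noteq> 0}" "{p..q}"]) auto
      show "h' p = 0" "h' q = 0" using h'out[of p] h'out[of q] ab less(2,3) by auto
      show "0 \<le> h' j" if "j \<in> {p..q}" for j
        using h'out[of j] \<mu>le[of j] less(4)[OF that] by (cases "j \<in> {a<..<b}") (auto simp: h'_def)
    qed
    then obtain w where w: "lamination p q w" "\<And>j. j \<in> {p..q} \<Longrightarrow> h' j = height p q w j" by blast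
    have z: "height p q w a = 0" "height p q w b = 0"
      using w(2)[of a] w(2)[of b] h'out[of a] h'out[of b] ab by auto
    have "lamination p q (w((a, b) := w (a, b) + \<mu>))"
      using \<mu>pos laminationD(1)[OF w(1), of "(a, b)"] not_crosses_zeros[OF w(1) z]
      by (intro lamination_add_arc[OF w(1) arc]) auto
    moreover have "\<forall>j\<in>{p..q}. h j = height p q (w((a, b) := w (a, b) + \<mu>)) j"
    proof
      fix j assume "j \<in> {p..q}"
      then show "h j = height p q (w((a, b) := w (a, b) + \<mu>)) j"
        using w(2)[of j] height_update[OF arc, of w \<mu> j] unfolding h'_def by linarith
    qed
    ultimately show ?thesis by blast
  qed
qed

text \<open>
  Both laminations contain the arc of a gap. Remove from both the smaller of its two weights; were
  the heights still nonzero throughout the gap, the arc would still be in both of them.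
\<close>

theorem lamination_unique:
  assumes "lamination p q w" "lamination p q v" "\<And>i. i \<in> {p..q} \<Longrightarrow> height p q w i = height p q v i"
  shows "w = v"
  using assms
proof (induction "card {i\<in>{p..q}. height p q w i \<noteq> 0}" arbitrary: w v rule: less_induct)
  case less
  note w = less(2) and v = less(3) and eq = less(4)
  show ?case
  proof (cases "\<exists>i\<in>{p..q}. height p q w i \<noteq> 0")
    case False
    have "u d = 0" if u: "lamination p q u" "\<And>i. i \<in> {p..q} \<Longrightarrow> height p q u i = 0" for u d
    proof (rule ccontr)
      assume d: "u d \<noteq> 0"
      obtain a b where ab: "d = (a, b)" by force
      have "p \<le> a" "a + 2 \<le> b" "b \<le> q" using laminationD(2)[OF u(1) d] by (auto simp: ab arcs_in_iff)
      then have "u (a, b) \<noteq> 0 \<and> a < a + 1 \<and> a + 1 < b" "a + 1 \<in> {p..q}" using d ab by auto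
      then have "0 < height p q u (a + 1)" "a + 1 \<in> {p..q}"
        using height_pos_iff[OF u(1)] by blast+
      then show False using u(2) by force
    qed
    then show ?thesis using w v eq False by (metis ext)
  next
    case True
    then obtain i where i: "i \<in> {p..q}" "height p q w i \<noteq> 0" by blast
    obtain a b where ab: "p \<le> a" "a < i" "i < b" "b \<le> q" "height p q w a = 0" "height p q w b = 0"
      "\<And>j. a < j \<Longrightarrow> j < b \<Longrightarrow> height p q w j \<noteq> 0"
      using gap_exists[of "height p q w", OF height_end[OF w] height_end[OF w] i] by blast
    have arc: "(a, b) \<in> arcs_in p q" using ab by (simp add: arcs_in_iff)
    have wab: "u (a, b) > 0" if u: "lamination p q u" "\<And>i. i \<in> {a..b} \<Longrightarrow> height p q u i = 0 \<longleftrightarrow> i = a \<or> i = b" for u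
    proof -
      have "u (a, b) \<noteq> 0"
      proof (rule gap_arc[OF u(1)])
        show "height p q u a = 0" "height p q u b = 0" using u(2)[of a] u(2)[of b] ab by auto
        show "0 < height p q u j" if "a < j" "j < b" for j
          using u(2)[of j] that height_nonneg[OF u(1), of j] by force
      qed (use ab in auto)
      then show ?thesis using laminationD(1)[OF u(1), of "(a, b)"] by auto
    qed
    define s where "s = min (w (a, b)) (v (a, b))"
    have zw: "height p q w i = 0 \<longleftrightarrow> i = a \<or> i = b" if "i \<in> {a..b}" for i
      using that ab by (metis atLeastAtMost_iff order_le_less)
    have zv: "height p q v i = 0 \<longleftrightarrow> i = a \<or> i = b" if "i \<in> {a..b}" for i
      using zw[OF that] eq[of i] that ab by auto
    have s: "s > 0" using wab[OF w zw] wab[OF v zv] by (simp add: s_def)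
    let ?w = "w((a, b) := w (a, b) + - s)" and ?v = "v((a, b) := v (a, b) + - s)"
    have zv': "height p q v a = 0" "height p q v b = 0" using zv ab by auto
    have lw: "lamination p q ?w" and lv: "lamination p q ?v"
      using lamination_add_arc[OF w arc _ not_crosses_zeros[OF w ab(5,6)], of "-s"]
        lamination_add_arc[OF v arc _ not_crosses_zeros[OF v zv'], of "-s"] by (auto simp: s_def)
    have hw: "height p q ?w i = height p q w i - s * bump a b i"
      and hv: "height p q ?v i = height p q v i - s * bump a b i" for i
      using height_update[OF arc, of w "-s" i] height_update[OF arc, of v "-s" i] by auto
    have eq': "height p q ?w i = height p q ?v i" if "i \<in> {p..q}" for i
      using eq[OF that] hw hv by simp
    have out: "bump a b j = 0" if "j \<notin> {a<..<b}" for j using that ab by (intro bump_out) auto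
    \<comment> \<open>Otherwise both laminations would still contain the arc, whereas one of them has lost it.\<close>
    have "\<exists>j. a < j \<and> j < b \<and> height p q ?w j = 0"
    proof (rule ccontr)
      assume neg: "\<not> ?thesis"
      have z: "height p q ?w i = 0 \<longleftrightarrow> i = a \<or> i = b" if "i \<in> {a..b}" for i
      proof -
        have "height p q ?w a = 0" "height p q ?w b = 0"
          using hw[of a] hw[of b] ab(5,6) out[of a] out[of b] by auto
        moreover have "height p q ?w i \<noteq> 0" if "a < i" "i < b" using neg that by blast
        ultimately show ?thesis using \<open>i \<in> {a..b}\<close> by (cases "i = a"; cases "i = b") auto
      qed
      have z': "height p q ?v i = 0 \<longleftrightarrow> i = a \<or> i = b" if "i \<in> {a..b}" for i
        using z[OF that] eq'[of i] that ab by auto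
      show False using wab[OF lw z] wab[OF lv z'] by (auto simp: s_def min_def split: if_splits)
    qed
    then obtain k where k: "a < k" "k < b" "height p q ?w k = 0" by blast
    have "?w = ?v"
    proof (rule less(1)[OF _ lw lv eq'])
      show "card {i\<in>{p..q}. height p q ?w i \<noteq> 0} < card {i\<in>{p..q}. height p q w i \<noteq> 0}"
      proof (rule psubset_card_mono)
        show "{i\<in>{p..q}. height p q ?w i \<noteq> 0} \<subset> {i\<in>{p..q}. height p q w i \<noteq> 0}"
        proof
          show "{i\<in>{p..q}. height p q ?w i \<noteq> 0} \<subseteq> {i\<in>{p..q}. height p q w i \<noteq> 0}"
          proof
            fix i assume i: "i \<in> {i\<in>{p..q}. height p q ?w i \<noteq> 0}"
            have "height p q w i \<noteq> 0"
            proof (cases "a < i \<and> i < b")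
              case False then show ?thesis using i hw[of i] out[of i] by auto
            qed (use ab(7) in blast)
            then show "i \<in> {i\<in>{p..q}. height p q w i \<noteq> 0}" using i by blast
          qed
          have "k \<in> {i\<in>{p..q}. height p q w i \<noteq> 0}" using k ab by auto
          then show "{i\<in>{p..q}. height p q ?w i \<noteq> 0} \<noteq> {i\<in>{p..q}. height p q w i \<noteq> 0}" using k(3) by blast
        qed
      qed (rule finite_subset[of _ "{p..q}"], auto)
    qed
    then have e: "?w d = ?v d" for d by simp
    have "w d = v d" for d using e[of d] by (cases "d = (a, b)") auto
    then show ?thesis by blast
  qed
qed

text \<open>
  Over each arc that passes over \<open>(a, b)\<close> replace the bump by its parabola, halve the weight of
  \<open>(a, b)\<close>, and drop all other arcs. As no arc crosses \<open>(a, b)\<close>, this changes nothing at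
  \<open>a\<close> and \<open>b\<close>. The bound outside of \<open>[p, q]\<close> is what periodic heights need.
\<close>

theorem lamination_exposed:
  assumes w: "lamination p q w" and ab: "w (a, b) \<noteq> 0"
  obtains l where "quadratic l" "l a = height p q w a" "l b = height p q w b"
    "\<And>i. i \<in> {p..q} \<Longrightarrow> i \<noteq> a \<Longrightarrow> i \<noteq> b \<Longrightarrow> l i < height p q w i"
    "\<And>i. i \<notin> {p..q} \<Longrightarrow> l i < 0"
proof -
  have arc: "(a, b) \<in> arcs_in p q" using laminationD(2)[OF w ab] .
  then have ab': "p \<le> a" "a + 2 \<le> b" "b \<le> q" by (auto simp: arcs_in_iff)
  have wab: "w (a, b) > 0" using ab laminationD(1)[OF w, of "(a, b)"] by auto
  define N where "N = {d\<in>arcs_in p q. fst d \<le> a \<and> b \<le> snd d}"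
  define c where "c = (\<lambda>d. if d = (a, b) then w d / 2 else w d)"
  define l where "l = (\<lambda>i. \<Sum>d\<in>N. c d * cap (fst d) (snd d) i)"
  have fN: "finite N" unfolding N_def using finite_arcs_in by auto
  have abN: "(a, b) \<in> N" using arc by (simp add: N_def)
  have c0: "0 \<le> c d" for d using laminationD(1)[OF w, of d] by (auto simp: c_def)
  have q: "quadratic l" unfolding l_def by (intro quad_sum quad_scale quad_cap)
  have hN: "height p q w i = (\<Sum>d\<in>N. w d * bump (fst d) (snd d) i)
       + (\<Sum>d\<in>arcs_in p q - N. w d * bump (fst d) (snd d) i)" for i
    unfolding height_def using finite_arcs_in by (subst sum.subset_diff[of N]) (auto simp: N_def add.commute)
  have rest: "0 \<le> (\<Sum>d\<in>arcs_in p q - N. w d * bump (fst d) (snd d) i)" for i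
    using laminationD(1)[OF w] bump_nonneg by (intro sum_nonneg mult_nonneg_nonneg) auto
  have at: "l i = height p q w i" if i: "i = a \<or> i = b" for i
  proof -
    have "c d * cap (fst d) (snd d) i = w d * bump (fst d) (snd d) i" if "d \<in> N" for d
    proof (cases "d = (a, b)")
      case True then show ?thesis using i bump_in[of a i b] ab' by auto
    next
      case False then show ?thesis using that i ab' bump_in[of "fst d" i "snd d"] by (auto simp: c_def N_def)
    qed
    then have "l i = (\<Sum>d\<in>N. w d * bump (fst d) (snd d) i)" unfolding l_def by (intro sum.cong) auto
    moreover have "w d * bump (fst d) (snd d) i = 0" if d: "d \<in> arcs_in p q - N" for d
    proof (cases "w d = 0")
      case False
      have lt: "fst d < snd d" using d by (auto simp: arcs_in_def)
      have "i \<le> fst d \<or> snd d \<le> i"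
        using laminationD(3)[OF w ab False] d i ab' by (auto simp: crosses_def N_def)
      then show ?thesis using bump_out[OF lt] by simp
    qed simp
    then have "(\<Sum>d\<in>arcs_in p q - N. w d * bump (fst d) (snd d) i) = 0" by (intro sum.neutral) auto
    ultimately show ?thesis using hN[of i] by simp
  qed
  have le: "c d * cap (fst d) (snd d) i \<le> w d * bump (fst d) (snd d) i" if "d \<in> N" for d i
  proof -
    have "c d * cap (fst d) (snd d) i \<le> c d * bump (fst d) (snd d) i"
      using c0 cap_le_bump by (intro mult_left_mono)
    also have "\<dots> \<le> w d * bump (fst d) (snd d) i"
      using laminationD(1)[OF w, of d] bump_nonneg by (intro mult_right_mono) (auto simp: c_def)
    finally show ?thesis .
  qed
  have lt: "c (a, b) * cap a b i < w (a, b) * bump a b i" if "i \<noteq> a" "i \<noteq> b" for i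
  proof (cases "a < i \<and> i < b")
    case True
    then show ?thesis using cap_pos[of a i b] bump_in[of a i b] wab by (simp add: c_def)
  next
    case False
    then have "cap a b i < 0" using that ab' by (intro cap_neg) auto
    then have "c (a, b) * cap a b i < 0" using wab by (simp add: c_def mult_pos_neg)
    moreover have "0 \<le> w (a, b) * bump a b i" using wab bump_nonneg[of a b i] by simp
    ultimately show ?thesis by linarith
  qed
  have strict: "l i < height p q w i" if "i \<noteq> a" "i \<noteq> b" for i
  proof -
    have "l i < (\<Sum>d\<in>N. w d * bump (fst d) (snd d) i)"
      unfolding l_def
    proof (rule sum_strict_mono_ex1[OF fN])
      show "\<forall>d\<in>N. c d * cap (fst d) (snd d) i \<le> w d * bump (fst d) (snd d) i" using le by blast
      show "\<exists>d\<in>N. c d * cap (fst d) (snd d) i < w d * bump (fst d) (snd d) i"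
        using lt[OF that] abN by (intro bexI[of _ "(a, b)"]) auto
    qed
    then show ?thesis using hN[of i] rest[of i] by linarith
  qed
  show thesis
  proof (rule that[OF q])
    show "l a = height p q w a" "l b = height p q w b" using at by auto
    show "\<And>i. i \<in> {p..q} \<Longrightarrow> i \<noteq> a \<Longrightarrow> i \<noteq> b \<Longrightarrow> l i < height p q w i" using strict by blast
    show "l i < 0" if "i \<notin> {p..q}" for i
    proof -
      have "height p q w i = 0" using that by (intro height_end[OF w]) auto
      moreover have "i \<noteq> a" "i \<noteq> b" using that ab' by auto
      ultimately show ?thesis using strict[of i] by simp
    qed
  qed
qed

lemma lamination_exposed_in:
  assumes "lamination p q w" "w (a, b) \<noteq> 0"
  shows "exposed {p..q} (height p q w) a b"
proof -
  obtain l where "quadratic l" "l a = height p q w a" "l b = height p q w b"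
    "\<And>i. i \<in> {p..q} \<Longrightarrow> i \<noteq> a \<Longrightarrow> i \<noteq> b \<Longrightarrow> l i < height p q w i"
    using lamination_exposed[OF assms] by metis
  moreover have "a \<in> {p..q}" "b \<in> {p..q}" "a < b"
    using laminationD(2)[OF assms] by (auto simp: arcs_in_iff)
  ultimately show ?thesis using exposedI[where I = "{p..q}" and h = "height p q w"] by blast
qed

text \<open>
  Subtract a small multiple of the bump of an exposed arc. The arc stays exposed, so it crosses no arc of the
  decomposition of what is left; adding the multiple back gives a lamination with the
  original heights, which by uniqueness is the original one.
\<close>

theorem exposed_lamination:
  assumes w: "lamination p q w" and arc: "(a, b) \<in> arcs_in p q"
    and ex: "exposed {p..q} (height p q w) a b"
    and pos: "\<And>j. a < j \<Longrightarrow> j < b \<Longrightarrow> 0 < height p q w j"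
  shows "w (a, b) \<noteq> 0"
proof -
  have ab: "p \<le> a" "a + 2 \<le> b" "b \<le> q" using arc by (auto simp: arcs_in_iff)
  let ?h = "height p q w"
  obtain l where l: "quadratic l" "\<And>i. i \<in> {p..q} \<Longrightarrow> l i \<le> ?h i" "\<And>i. i \<in> {p..q} \<Longrightarrow> i \<noteq> a \<Longrightarrow> i \<noteq> b \<Longrightarrow> l i < ?h i"
    "l a = ?h a" "l b = ?h b" using exposedD[OF ex] by metis
  have g: "0 < min (?h i) (?h i - l i)" if "i \<in> {a<..<b}" for i
    using pos[of i] l(3)[of i] that ab by auto
  obtain \<epsilon> where \<epsilon>: "\<epsilon> > 0" "\<And>i. i \<in> {a<..<b} \<Longrightarrow> \<epsilon> * bump a b i < min (?h i) (?h i - l i)"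
  proof -
    have "finite {a<..<b}" by simp
    from small_multiples[where g = "\<lambda>i. min (?h i) (?h i - l i)" and f = "bump a b", OF this g] obtain \<epsilon> where
      "\<epsilon> > 0" "\<forall>s. 0 \<le> s \<and> s \<le> \<epsilon> \<longrightarrow> (\<forall>i\<in>{a<..<b}. s * bump a b i < min (?h i) (?h i - l i))" by blast
    then show thesis using that[of \<epsilon>] by simp
  qed
  have out: "bump a b j = 0" if "j \<notin> {a<..<b}" for j using that ab by (intro bump_out) auto
  define h' where "h' = (\<lambda>i. ?h i - \<epsilon> * bump a b i)"
  have h'out: "h' j = ?h j" if "j \<notin> {a<..<b}" for j using out[OF that] by (simp add: h'_def)
  have nn: "0 \<le> h' i" for i
    using \<epsilon>(2)[of i] h'out[of i] height_nonneg[OF w, of i] by (cases "i \<in> {a<..<b}") (auto simp: h'_def)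
  have "h' p = 0" "h' q = 0" using h'out[of p] h'out[of q] height_end[OF w] ab by auto
  from lamination_exists[OF this nn] obtain v where
    v: "lamination p q v" "\<And>i. i \<in> {p..q} \<Longrightarrow> h' i = height p q v i" by blast
  have "exposed {p..q} (height p q v) a b"
  proof (rule exposedI[OF l(1)])
    fix i assume i: "i \<in> {p..q}" "i \<noteq> a" "i \<noteq> b"
    show "l i < height p q v i"
      using \<epsilon>(2)[of i] h'out[of i] l(3)[OF i] v(2)[OF i(1)] by (cases "i \<in> {a<..<b}") (auto simp: h'_def)
  qed (use v(2)[of a] v(2)[of b] h'out l ab in auto)
  then have nc: "\<not> crosses (a, b) d" if "v d \<noteq> 0" for d
    using exposed_not_crosses lamination_exposed_in[OF v(1)] that by (cases d) blast
  let ?v = "v((a, b) := v (a, b) + \<epsilon>)"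
  have "w = ?v"
  proof (rule lamination_unique[OF w])
    show "lamination p q ?v"
      using \<epsilon>(1) laminationD(1)[OF v(1), of "(a, b)"] nc by (intro lamination_add_arc[OF v(1) arc]) auto
    show "?h i = height p q ?v i" if "i \<in> {p..q}" for i
      using v(2)[OF that] height_update[OF arc, of v \<epsilon> i] by (simp add: h'_def)
  qed
  then have "w (a, b) = v (a, b) + \<epsilon>" by simp
  then show ?thesis using \<epsilon>(1) laminationD(1)[OF v(1), of "(a, b)"] by linarith
qed

section \<open>Stability of exposed arcs, and balls from heights\<close>

text \<open>
  The criterion in terms of heights on \<open>V\<close>. The functions \<open>e k\<close> for \<open>k \<in> Z\<close> span the
  trivial heights and interpolate on \<open>Z\<close>; \<open>N\<close> holds for the heights outside of the cone and \<open>u\<close> is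
  the upward direction. Normalizing heights to vanish on \<open>Z\<close>, and at \<open>k0\<close> by subtracting
  a multiple of \<open>u\<close>, leaves the values on the other points of \<open>V\<close> as coordinates.
\<close>

theorem ball_from_heights:
  fixes K :: "'v set set" and H :: "('v \<Rightarrow> real) \<Rightarrow> int \<Rightarrow> real" and V Z :: "int set"
    and N :: "(int \<Rightarrow> real) \<Rightarrow> bool" and u :: "int \<Rightarrow> real" and e :: "int \<Rightarrow> int \<Rightarrow> real"
  assumes K: "finite_complex K"
    and V: "finite V" "Z \<subseteq> V" "k0 \<in> V" "k0 \<notin> Z" "card (V - Z - {k0}) = n"
    and contH: "\<And>i. continuous_on UNIV (\<lambda>f. H f i)"
    and homH: "\<And>r f i. 0 \<le> r \<Longrightarrow> H (\<lambda>v. r * f v) i = r * H f i"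
    and e: "\<And>k j. k \<in> Z \<Longrightarrow> j \<in> Z \<Longrightarrow> e k j = (if j = k then 1 else 0)"
    and u: "u k0 \<noteq> (\<Sum>k\<in>Z. u k * e k k0)"
    and Ncong: "\<And>h h'. (\<And>i. i \<in> V \<Longrightarrow> h i = h' i) \<Longrightarrow> N h \<longleftrightarrow> N h'"
    and Ninv: "\<And>h c. N (\<lambda>i. h i + (\<Sum>k\<in>Z. c k * e k i)) \<longleftrightarrow> N h"
    and img: "\<And>f. f \<in> weight_cone K \<Longrightarrow> \<not> N (H f)"
    and surj: "\<And>h. \<not> N h \<Longrightarrow> \<exists>f\<in>weight_cone K. \<exists>c. \<forall>i\<in>V. h i = H f i + (\<Sum>k\<in>Z. c k * e k i)"
    and inj: "\<And>f g c. f \<in> weight_cone K \<Longrightarrow> g \<in> weight_cone K \<Longrightarrow>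
        (\<And>i. i \<in> V \<Longrightarrow> H f i = H g i + (\<Sum>k\<in>Z. c k * e k i)) \<Longrightarrow> f = g"
    and Nopen: "\<And>h. N h \<Longrightarrow> \<exists>\<delta>>0. \<forall>h'. (\<forall>i\<in>V. \<bar>h' i - h i\<bar> < \<delta>) \<longrightarrow> N h'"
    and strict: "\<And>h t. \<not> N h \<Longrightarrow> 0 < t \<Longrightarrow> \<exists>\<delta>>0. \<forall>h'. (\<forall>i\<in>V. \<bar>h' i - (h i + t * u i)\<bar> < \<delta>) \<longrightarrow> \<not> N h'"
    and neg: "N (\<lambda>i. - u i)"
  shows "is_closed_ball K n"
proof -
  define W where "W = V - Z - {k0}"
  have "finite W" using V by (simp add: W_def)
  then obtain \<beta> where \<beta>: "bij_betw \<beta> {..<n} W"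
    using V(5) by (metis W_def atLeast0LessThan ex_bij_betw_nat_finite)
  define L where "L = (\<lambda>h i. \<Sum>k\<in>Z. h k * e k i)"
  define P where "P = (\<lambda>h i. h i - L h i)"
  have finZ: "finite Z" using V finite_subset by blast
  have LZ: "L h k = h k" if "k \<in> Z" for h k
  proof -
    have "L h k = (\<Sum>j\<in>Z. if j = k then h j else 0)"
      unfolding L_def using e that by (intro sum.cong) auto
    then show ?thesis using that finZ by simp
  qed
  have PZ: "P h k = 0" if "k \<in> Z" for h k using LZ[OF that] by (simp add: P_def)
  have Pu: "P u k0 \<noteq> 0" using u by (simp add: P_def L_def)
  have Lcong: "L h i = L h' i" if "\<And>k. k \<in> Z \<Longrightarrow> h k = h' k" for h h' i
    using that by (simp add: L_def)
  have Llin: "L (\<lambda>i. h i + t * h' i) i = L h i + t * L h' i" for h h' t i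
    by (simp add: L_def sum.distrib sum_distrib_left algebra_simps)
  define T where "T = (\<lambda>f. P (H f) k0 / P u k0)"
  define X where "X = (\<lambda>f j. if j < n then P (H f) (\<beta> j) - T f * P u (\<beta> j) else 0)"
  define ex where "ex = (\<lambda>(x::nat\<Rightarrow>real) i. if i \<in> W then x (inv_into {..<n} \<beta> i) else 0)"
  define lf where "lf = (\<lambda>x t i. ex x i + t * u i)"
  have ex\<beta>: "ex x (\<beta> j) = x j" if "j < n" for x j
    using that \<beta> by (auto simp: ex_def bij_betw_def bij_betw_apply)
  have exX: "ex (X f) i = P (H f) i - T f * P u i" if iV: "i \<in> V" for f i
  proof (cases "i \<in> W")
    case True
    then obtain j where "j < n" "i = \<beta> j" using \<beta> by (auto simp: bij_betw_def)
    then show ?thesis using ex\<beta>[of j "X f"] by (simp add: X_def)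
  next
    case False
    then consider "i \<in> Z" | "i = k0" using iV by (auto simp: W_def)
    then show ?thesis
      using False PZ Pu by cases (simp_all add: ex_def T_def)
  qed
  have lfX: "H f i = lf (X f) (T f) i + (\<Sum>k\<in>Z. (H f k - T f * u k) * e k i)" if "i \<in> V" for f i
  proof -
    have "(\<Sum>k\<in>Z. (H f k - T f * u k) * e k i) = L (H f) i - T f * L u i"
      by (simp add: L_def sum_subtractf sum_distrib_left algebra_simps)
    then show ?thesis using exX[OF that, of f] by (simp add: lf_def P_def algebra_simps)
  qed
  have NX: "N (lf (X f) (T f)) \<longleftrightarrow> N (H f)" for f
  proof -
    have "N (H f) \<longleftrightarrow> N (\<lambda>i. lf (X f) (T f) i + (\<Sum>k\<in>Z. (H f k - T f * u k) * e k i))"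
      by (rule Ncong) (rule lfX)
    then show ?thesis using Ninv by simp
  qed
  have lf_near: "\<bar>lf y s i - lf x t i\<bar> < \<delta>"
    if d: "\<forall>i<n. \<bar>y i - x i\<bar> < \<delta> / (1 + (\<Sum>i\<in>V. \<bar>u i\<bar>))" "\<bar>s - t\<bar> < \<delta> / (1 + (\<Sum>i\<in>V. \<bar>u i\<bar>))"
      "0 < \<delta>" "i \<in> V" for x y s t i \<delta>
  proof -
    let ?M = "\<Sum>i\<in>V. \<bar>u i\<bar>"
    let ?d = "\<delta> / (1 + ?M)"
    have M: "0 \<le> ?M" by (simp add: sum_nonneg)
    have d0: "0 < ?d" using d(3) M by (intro divide_pos_pos) linarith+
    have ui: "\<bar>u i\<bar> \<le> ?M" using member_le_sum[of i V "\<lambda>i. \<bar>u i\<bar>"] d(4) V(1) by simp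
    have 1: "\<bar>ex y i - ex x i\<bar> < ?d"
    proof (cases "i \<in> W")
      case True
      then obtain j where "j < n" "i = \<beta> j" using \<beta> by (auto simp: bij_betw_def)
      then show ?thesis using ex\<beta> d(1) by simp
    next
      case False then show ?thesis using d0 by (simp add: ex_def)
    qed
    have "\<bar>s * u i - t * u i\<bar> = \<bar>s - t\<bar> * \<bar>u i\<bar>" by (simp add: abs_mult[symmetric] algebra_simps)
    also have "\<dots> \<le> ?d * ?M" using d(2) ui M d0 by (intro mult_mono) auto
    finally have "\<bar>lf y s i - lf x t i\<bar> < ?d + ?d * ?M" using 1 unfolding lf_def by linarith
    also have "\<dots> = ?d * (1 + ?M)" by (simp only: distrib_left mult_1_right)
    also have "\<dots> = \<delta>"
    proof -
      have "1 + ?M \<noteq> 0" using M by linarith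
      then show ?thesis by simp
    qed
    finally show ?thesis .
  qed
  have den: "0 < 1 + (\<Sum>i\<in>V. \<bar>u i\<bar>)" by (simp add: add_pos_nonneg sum_nonneg)
  have contP: "continuous_on UNIV (\<lambda>f. P (H f) i)" for i
    unfolding P_def L_def by (intro continuous_on_diff continuous_on_sum continuous_on_mult contH continuous_on_const)
  have contT: "continuous_on UNIV T"
    unfolding T_def using Pu by (intro continuous_on_divide contP continuous_on_const) auto
  have homP: "P (H (\<lambda>v. r * f v)) i = r * P (H f) i" if "0 \<le> r" for r f i
    unfolding P_def L_def homH[OF that] by (simp add: sum_distrib_left right_diff_distrib mult.assoc)
  have homT: "T (\<lambda>v. r * f v) = r * T f" if "0 \<le> r" for r f
    unfolding T_def homP[OF that] by simp
  show ?thesis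
  proof (rule ball_criterion[where X = X and T = T and G = "\<lambda>x t. \<not> N (lf x t)", OF K])
    show "X f \<in> {x. \<forall>i\<ge>n. x i = 0}" for f by (simp add: X_def)
    show "continuous_on UNIV (\<lambda>f. X f i)" for i
      unfolding X_def by (cases "i < n") (auto intro!: continuous_on_diff continuous_on_mult contP contT)
    show "continuous_on UNIV T" by (rule contT)
    show "X (\<lambda>v. r * f v) i = r * X f i" if "0 \<le> r" for r f i
      unfolding X_def homT[OF that] homP[OF that] by (simp add: right_diff_distrib mult.assoc)
    show "T (\<lambda>v. r * f v) = r * T f" if "0 \<le> r" for r f using homT[OF that] .
    show "\<not> N (lf (X f) (T f))" if "f \<in> weight_cone K" for f using img[OF that] NX by simp
    show "\<exists>f\<in>weight_cone K. X f = x \<and> T f = t"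
      if x: "x \<in> {x. \<forall>i\<ge>n. x i = 0}" and nN: "\<not> N (lf x t)" for x t
    proof -
      obtain f c where f: "f \<in> weight_cone K" and
        c: "\<And>i. i \<in> V \<Longrightarrow> lf x t i = H f i + (\<Sum>k\<in>Z. c k * e k i)" using surj[OF nN] by metis
      have exZ: "ex x k = 0" if "k \<in> Z" for k using that by (simp add: ex_def W_def)
      have PH: "P (H f) i = ex x i + t * P u i" if "i \<in> V" for i
      proof -
        have ck: "H f k = t * u k - c k" if "k \<in> Z" for k
          using c[of k] that V(2) exZ[OF that] LZ[OF that, of c] by (auto simp: lf_def L_def)
        have "L (H f) i = t * L u i - L c i"
          unfolding L_def by (simp add: ck sum_subtractf sum_distrib_left algebra_simps)
        moreover have "L c i = (\<Sum>k\<in>Z. c k * e k i)" by (simp add: L_def)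
        ultimately show ?thesis using c[OF that] unfolding P_def lf_def by (simp add: algebra_simps)
      qed
      have "ex x k0 = 0" by (simp add: ex_def W_def)
      then have Tf: "T f = t" using PH[OF V(3)] Pu by (simp add: T_def)
      have "X f = x"
      proof
        fix j show "X f j = x j"
        proof (cases "j < n")
          case True
          have "\<beta> j \<in> V" using \<beta> True by (auto simp: bij_betw_def W_def)
          then show ?thesis using PH ex\<beta>[OF True] Tf True by (simp add: X_def)
        next
          case False then show ?thesis using x by (simp add: X_def)
        qed
      qed
      then show ?thesis using f Tf by blast
    qed
    show "f = g" if "f \<in> weight_cone K" "g \<in> weight_cone K" "X f = X g" "T f = T g" for f g
    proof (rule inj[OF that(1,2)])
      fix i assume i: "i \<in> V"
      have "(\<Sum>k\<in>Z. (H f k - H g k) * e k i) =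
          (\<Sum>k\<in>Z. (H f k - T f * u k) * e k i) - (\<Sum>k\<in>Z. (H g k - T g * u k) * e k i)"
        unfolding sum_subtractf[symmetric] that(4) by (intro sum.cong) (auto simp: algebra_simps)
      then show "H f i = H g i + (\<Sum>k\<in>Z. (H f k - H g k) * e k i)"
        using lfX[OF i, of f] lfX[OF i, of g] that(3,4) by simp
    qed
    show "\<exists>\<delta>>0. \<forall>y\<in>{x. \<forall>i\<ge>n. x i = 0}. \<forall>s. (\<forall>i<n. \<bar>y i - x i\<bar> < \<delta>) \<and> \<bar>s - t'\<bar> < \<delta> \<longrightarrow> \<not> N (lf y s)"
      if "\<not> N (lf x t)" "t < t'" for x t t'
    proof -
      have "0 < t' - t" using that by simp
      from strict[OF that(1) this] obtain \<delta> where \<delta>: "\<delta> > 0"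
        "\<And>h'. (\<forall>i\<in>V. \<bar>h' i - (lf x t i + (t' - t) * u i)\<bar> < \<delta>) \<Longrightarrow> \<not> N h'" by metis
      have "lf x t i + (t' - t) * u i = lf x t' i" for i by (simp add: lf_def algebra_simps)
      then have \<delta>2: "\<not> N h'" if "\<forall>i\<in>V. \<bar>h' i - lf x t' i\<bar> < \<delta>" for h' using \<delta>(2) that by simp
      show ?thesis
        using lf_near[OF _ _ \<delta>(1)] \<delta>2 \<delta>(1) den
        by (intro exI[of _ "\<delta> / (1 + (\<Sum>i\<in>V. \<bar>u i\<bar>))"]) force
    qed
    show "\<exists>\<delta>>0. \<forall>y\<in>{x. \<forall>i\<ge>n. x i = 0}. \<forall>s. (\<forall>i<n. \<bar>y i - x i\<bar> < \<delta>) \<and> \<bar>s - t\<bar> < \<delta> \<longrightarrow> \<not> \<not> N (lf y s)"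
      if "\<not> \<not> N (lf x t)" for x t
    proof -
      have "N (lf x t)" using that by simp
      from Nopen[OF this] obtain \<delta> where \<delta>: "\<delta> > 0"
        "\<And>h'. (\<forall>i\<in>V. \<bar>h' i - lf x t i\<bar> < \<delta>) \<Longrightarrow> N h'" by metis
      show ?thesis
        using lf_near[OF _ _ \<delta>(1)] \<delta>(2) \<delta>(1) den
        by (intro exI[of _ "\<delta> / (1 + (\<Sum>i\<in>V. \<bar>u i\<bar>))"]) force
    qed
    have "lf (\<lambda>_. 0) (-1) = (\<lambda>i. - u i)" by (auto simp: lf_def ex_def)
    then show "\<not> \<not> N (lf (\<lambda>_. 0) (-1))" using neg by simp
  qed
qed

lemma exposed_add_quad:
  assumes "quadratic q"
  shows "exposed I (\<lambda>i. h i + q i) a b \<longleftrightarrow> exposed I h a b"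
proof -
  have imp: "exposed I (\<lambda>i. h i + q i) a b" if ex: "exposed I h a b" and q: "quadratic q" for h q
  proof -
    obtain l where l: "quadratic l" "\<And>i. i \<in> I \<Longrightarrow> i \<noteq> a \<Longrightarrow> i \<noteq> b \<Longrightarrow> l i < h i" "l a = h a" "l b = h b" "a \<in> I" "b \<in> I" "a < b"
      using exposedD[OF ex] by metis
    show ?thesis by (rule exposedI[OF quad_add[OF l(1) q]]) (use l in auto)
  qed
  show ?thesis
    using imp[of h q] imp[of "\<lambda>i. h i + q i" "\<lambda>i. - 1 * q i"] assms quad_scale[OF assms, of "-1"] by auto
qed

lemma quad_linear: "quadratic (\<lambda>i. p * real_of_int (b - i) + q * real_of_int (i - a))"
  by (rule quadI[of _ "p * b - q * a" "q - p" 0]) (simp add: algebra_simps)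

lemma exposed_cong: "(\<And>i. i \<in> I \<Longrightarrow> h i = h' i) \<Longrightarrow> exposed I h a b \<longleftrightarrow> exposed I h' a b"
  unfolding exposed_def by (auto cong: conj_cong)

lemma exposed_subset:
  assumes "exposed I h a b" "J \<subseteq> I" "a \<in> J" "b \<in> J"
  shows "exposed J h a b"
  using assms unfolding exposed_def by (meson subsetD)

text \<open>
  Adding a small multiple of \<open>cap c e\<close> to a supporting function, where \<open>c\<close> and
  \<open>e\<close> are consecutive contact points, removes all other contacts.
\<close>

lemma exposed_gap:
  assumes l: "quadratic l" "\<And>i. i \<in> I \<Longrightarrow> l i \<le> h i" and I: "{x..y} \<subseteq> I"
    and xjy: "x < j" "j < y" "l x = h x" "l y = h y" "l j < h j"
  obtains c e where "c < j" "j < e" "l c = h c" "l e = h e" "c \<in> I" "e \<in> I"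
    "\<And>i. c < i \<Longrightarrow> i < e \<Longrightarrow> l i < h i" "exposed I h c e"
proof -
  have "j \<in> {x..y}" "h j - l j \<noteq> 0" using xjy by auto
  then obtain c e where ce: "x \<le> c" "c < j" "j < e" "e \<le> y" "h c - l c = 0" "h e - l e = 0"
    "\<And>i. c < i \<Longrightarrow> i < e \<Longrightarrow> h i - l i \<noteq> 0"
    using gap_exists[of "\<lambda>i. h i - l i" x y j] xjy by auto
  have inI: "i \<in> I" if "c \<le> i" "i \<le> e" for i using that ce I by auto
  have g: "0 < h i - l i" if "i \<in> {c<..<e}" for i
    using that ce(7)[of i] l(2)[of i] inI[of i] by force
  have "finite {c<..<e}" by simp
  from small_multiples[where g = "\<lambda>i. h i - l i" and f = "cap c e", OF this g]
  obtain \<epsilon> where "\<epsilon> > 0" "\<forall>s. 0 \<le> s \<and> s \<le> \<epsilon> \<longrightarrow> (\<forall>i\<in>{c<..<e}. s * cap c e i < h i - l i)" by blast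
  then have \<epsilon>: "\<epsilon> > 0" "\<And>i. i \<in> {c<..<e} \<Longrightarrow> \<epsilon> * cap c e i < h i - l i" by auto
  have "exposed I h c e"
  proof (rule exposedI[of "\<lambda>i. l i + \<epsilon> * cap c e i"])
    show "quadratic (\<lambda>i. l i + \<epsilon> * cap c e i)" by (intro quad_add l quad_scale quad_cap)
    show "l i + \<epsilon> * cap c e i < h i" if i: "i \<in> I" "i \<noteq> c" "i \<noteq> e" for i
    proof (cases "i \<in> {c<..<e}")
      case True then show ?thesis using \<epsilon>(2)[OF True] by simp
    next
      case False
      then have "cap c e i < 0" using i ce by (intro cap_neg) auto
      then have "\<epsilon> * cap c e i < 0" using \<epsilon>(1) by (simp add: mult_pos_neg)
      then show ?thesis using l(2)[OF i(1)] by linarith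
    qed
  qed (use ce inI in auto)
  then show thesis using that ce inI g by fastforce
qed

text \<open>
  Likewise for the outermost contact points, subtracting a small multiple of \<open>cap c e\<close>: this lifts
  the function outside of \<open>[c, e]\<close>, where it is strictly below \<open>h\<close>, and lowers it inside.
\<close>

lemma exposed_outer:
  assumes l: "quadratic l" "\<And>i. i \<in> I \<Longrightarrow> l i \<le> h i" and I: "finite I"
    and xy: "x \<in> I" "y \<in> I" "x < y" "l x = h x" "l y = h y"
  obtains c e where "c \<le> x" "y \<le> e" "l c = h c" "l e = h e" "c \<in> I" "e \<in> I" "exposed I h c e"
proof -
  define E where "E = {i\<in>I. l i = h i}"
  have E: "finite E" "x \<in> E" "y \<in> E" using I xy by (auto simp: E_def)
  define c e where "c = Min E" and "e = Max E"
  have "E \<noteq> {}" using E by auto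
  then have ce: "c \<in> E" "e \<in> E" using E(1) by (auto simp: c_def e_def)
  have b: "c \<le> i" "i \<le> e" if "i \<in> E" for i using that E(1) by (auto simp: c_def e_def)
  have lt: "c < e" using b[OF E(2)] b[OF E(3)] xy by linarith
  let ?O = "{i\<in>I. i < c \<or> e < i}"
  have g: "0 < h i - l i" if "i \<in> ?O" for i
    using that l(2)[of i] b[of i] by (force simp: E_def)
  have "finite ?O" using I by simp
  from small_multiples[where g = "\<lambda>i. h i - l i" and f = "\<lambda>i. - cap c e i", OF this g]
  obtain \<epsilon> where "\<epsilon> > 0" "\<forall>s. 0 \<le> s \<and> s \<le> \<epsilon> \<longrightarrow> (\<forall>i\<in>?O. s * - cap c e i < h i - l i)" by blast
  then have \<epsilon>: "\<epsilon> > 0" "\<And>i. i \<in> ?O \<Longrightarrow> \<epsilon> * - cap c e i < h i - l i" by auto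
  have "exposed I h c e"
  proof (rule exposedI[of "\<lambda>i. l i + - \<epsilon> * cap c e i"])
    show "quadratic (\<lambda>i. l i + - \<epsilon> * cap c e i)" by (intro quad_add l quad_scale quad_cap)
    show "l i + - \<epsilon> * cap c e i < h i" if i: "i \<in> I" "i \<noteq> c" "i \<noteq> e" for i
    proof (cases "i \<in> ?O")
      case True then show ?thesis using \<epsilon>(2)[OF True] by simp
    next
      case False
      then have "0 < cap c e i" using i by (intro cap_pos) auto
      then have "0 < \<epsilon> * cap c e i" using \<epsilon>(1) by simp
      then show ?thesis using l(2)[OF i(1)] by simp
    qed
  qed (use ce lt in \<open>auto simp: E_def\<close>)
  then show thesis using that b[OF E(2)] b[OF E(3)] ce by (auto simp: E_def)
qed

lemma exposed_open:
  assumes I: "finite I" and ex: "exposed I h a b"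
  shows "\<exists>\<delta>>0. \<forall>h'. (\<forall>i\<in>I. \<bar>h' i - h i\<bar> < \<delta>) \<longrightarrow> exposed I h' a b"
proof -
  obtain l where l: "quadratic l" "\<And>i. i \<in> I \<Longrightarrow> i \<noteq> a \<Longrightarrow> i \<noteq> b \<Longrightarrow> l i < h i" "l a = h a" "l b = h b" "a \<in> I" "b \<in> I" "a < b"
    using exposedD[OF ex] by metis
  define \<kappa> where "\<kappa> = (\<lambda>i. 1 + real_of_int (\<bar>b - i\<bar> + \<bar>i - a\<bar>))"
  have g: "0 < h i - l i" if "i \<in> I - {a, b}" for i using l(2)[of i] that by auto
  have "finite (I - {a, b})" using I by simp
  from small_multiples[where g = "\<lambda>i. h i - l i" and f = \<kappa>, OF this g]
  obtain \<epsilon> where "\<epsilon> > 0" "\<forall>s. 0 \<le> s \<and> s \<le> \<epsilon> \<longrightarrow> (\<forall>i\<in>I - {a, b}. s * \<kappa> i < h i - l i)" by blast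
  then have \<epsilon>: "\<epsilon> > 0" "\<And>i. i \<in> I - {a, b} \<Longrightarrow> \<epsilon> * \<kappa> i < h i - l i" by auto
  show ?thesis
  proof (intro exI[of _ \<epsilon>] conjI allI impI)
    fix h' assume near: "\<forall>i\<in>I. \<bar>h' i - h i\<bar> < \<epsilon>"
    let ?A = "(h' a - h a) / (b - a)" and ?B = "(h' b - h b) / (b - a)"
    let ?l = "\<lambda>i. l i + (?A * real_of_int (b - i) + ?B * real_of_int (i - a))"
    have lin: "quadratic (\<lambda>i. ?A * real_of_int (b - i) + ?B * real_of_int (i - a))"
      by (rule quad_linear)
    have ba: "1 \<le> real_of_int (b - a)" using l(7) by linarith
    have AB: "\<bar>?A\<bar> \<le> \<epsilon>" "\<bar>?B\<bar> \<le> \<epsilon>"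
    proof -
      have "\<bar>z / (b - a)\<bar> \<le> \<epsilon>" if "\<bar>z\<bar> < \<epsilon>" for z :: real
      proof -
        have "\<bar>z / (b - a)\<bar> \<le> \<bar>z\<bar>"
          using ba mult_left_mono[OF ba, of "\<bar>z\<bar>"] by (simp add: abs_divide divide_le_eq)
        then show ?thesis using that by linarith
      qed
      then show "\<bar>?A\<bar> \<le> \<epsilon>" "\<bar>?B\<bar> \<le> \<epsilon>" using near l(5,6) by auto
    qed
    show "exposed I h' a b"
    proof (rule exposedI[of ?l])
      show "quadratic ?l" by (rule quad_add[OF l(1) lin])
      show "?l i < h' i" if i: "i \<in> I" "i \<noteq> a" "i \<noteq> b" for i
      proof -
        have bound: "x * y \<le> \<epsilon> * \<bar>y\<bar>" if "\<bar>x\<bar> \<le> \<epsilon>" for x y :: real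
          using mult_right_mono[OF that, of "\<bar>y\<bar>"] abs_ge_self[of "x * y"] by (simp add: abs_mult)
        have "?A * real_of_int (b - i) \<le> \<epsilon> * \<bar>real_of_int (b - i)\<bar>"
          by (rule bound[OF AB(1)])
        moreover have "?B * real_of_int (i - a) \<le> \<epsilon> * \<bar>real_of_int (i - a)\<bar>"
          by (rule bound[OF AB(2)])
        moreover have "\<epsilon> * \<kappa> i = \<epsilon> + \<epsilon> * \<bar>real_of_int (b - i)\<bar> + \<epsilon> * \<bar>real_of_int (i - a)\<bar>"
          by (simp add: \<kappa>_def algebra_simps)
        moreover have "\<epsilon> * \<kappa> i < h i - l i" using \<epsilon>(2)[of i] i by auto
        moreover have "\<bar>h' i - h i\<bar> < \<epsilon>" using near i by auto
        ultimately show ?thesis by linarith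
      qed
      have "real_of_int (b - a) \<noteq> 0" using ba by linarith
      then show "?l a = h' a" "?l b = h' b" using l by auto
    qed (use l in auto)
  qed (rule \<epsilon>(1))
qed

text \<open>
  The closed condition to which exposedness degenerates in a limit: further contacts are allowed.
\<close>

definition touches :: "int set \<Rightarrow> (int \<Rightarrow> real) \<Rightarrow> int \<Rightarrow> int \<Rightarrow> bool" where
  "touches I h a b \<longleftrightarrow> (\<exists>l. quadratic l \<and> (\<forall>i\<in>I. l i \<le> h i) \<and> l a = h a \<and> l b = h b)"

text \<open>
  The second divided difference at \<open>a\<close>, \<open>b\<close> and \<open>i\<close>, that is, the leading coefficient of
  the quadratic function through the three points of the graph of \<open>h\<close>. Hence an arc touches iff the values inside of
  \<open>[a, b]\<close> do not exceed those outside, and is exposed iff a number separates them strictly.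
\<close>

definition ddiff :: "int \<Rightarrow> int \<Rightarrow> (int \<Rightarrow> real) \<Rightarrow> int \<Rightarrow> real" where
  "ddiff a b h i = ((h a * real_of_int (b - i) + h b * real_of_int (i - a)) / real_of_int (b - a) - h i) / cap a b i"

lemma separate_finite:
  fixes A B :: "real set"
  assumes "finite A" "finite B" "\<And>x y. x \<in> A \<Longrightarrow> y \<in> B \<Longrightarrow> x \<le> y"
  shows "\<exists>c. (\<forall>x\<in>A. x \<le> c) \<and> (\<forall>y\<in>B. c \<le> y)"
proof (cases "A = {}")
  case True
  show ?thesis
  proof (cases "B = {}")
    case True with \<open>A = {}\<close> show ?thesis by simp
  next
    case False with \<open>A = {}\<close> assms(2) show ?thesis by (intro exI[of _ "Min B"]) auto
  qed
next
  case False
  then show ?thesis using assms by (intro exI[of _ "Max A"]) auto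
qed

lemma ddiff_separates:
  assumes ab: "a < b" and l: "quadratic l" "l a = h a" "l b = h b"
  obtains C where "\<And>i. i \<noteq> a \<Longrightarrow> i \<noteq> b \<Longrightarrow> h i - l i = (C - ddiff a b h i) * cap a b i"
proof -
  obtain A B C where L: "\<And>i. l i = A + B * real_of_int i + C * (real_of_int i)\<^sup>2"
    using l(1) unfolding quadratic_def by blast
  show thesis
  proof (rule that[of C])
    fix i assume i: "i \<noteq> a" "i \<noteq> b"
    have p: "cap a b i \<noteq> 0" using i by (simp add: cap_def)
    have ba: "real_of_int (b - a) \<noteq> 0" using ab by simp
    have "(real_of_int b - a) * l i = (b - i) * h a + (i - a) * h b - C * ((i - a) * (b - i) * (b - a))"
      using quad_chord[OF L, of b a i] l by simp
    then have "l i = (h a * real_of_int (b - i) + h b * real_of_int (i - a)) / real_of_int (b - a) - C * cap a b i"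
      using ba by (simp add: field_simps cap_def)
    moreover have "ddiff a b h i * cap a b i = (h a * real_of_int (b - i) + h b * real_of_int (i - a)) / real_of_int (b - a) - h i"
      unfolding ddiff_def using p by simp
    ultimately show "h i - l i = (C - ddiff a b h i) * cap a b i"
      by (simp add: left_diff_distrib)
  qed
qed

lemma not_touches_open:
  assumes I: "finite I" and ab: "a < b" and nt: "\<not> touches I h a b"
  shows "\<exists>\<delta>>0. \<forall>h'. (\<forall>i\<in>I. \<bar>h' i - h i\<bar> < \<delta>) \<longrightarrow> \<not> exposed I h' a b"
proof (cases "a \<in> I \<and> b \<in> I")
  case False
  then show ?thesis by (intro exI[of _ 1]) (auto simp: exposed_def)
next
  case abI: True
  let ?D = "ddiff a b"
  have ba: "1 \<le> real_of_int (b - a)" using ab by linarith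
  have "\<exists>i\<in>I. \<exists>j\<in>I. a < i \<and> i < b \<and> (j < a \<or> b < j) \<and> ?D h j < ?D h i"
  proof (rule ccontr)
    assume neg: "\<not> ?thesis"
    have "\<exists>c. (\<forall>x\<in>?D h ` {i\<in>I. a < i \<and> i < b}. x \<le> c) \<and> (\<forall>y\<in>?D h ` {j\<in>I. j < a \<or> b < j}. c \<le> y)"
    proof (rule separate_finite)
      fix x y assume "x \<in> ?D h ` {i\<in>I. a < i \<and> i < b}" "y \<in> ?D h ` {j\<in>I. j < a \<or> b < j}"
      then obtain i j where "x = ?D h i" "i \<in> I" "a < i" "i < b" "y = ?D h j" "j \<in> I" "j < a \<or> b < j" by blast
      then show "x \<le> y" using neg by (meson not_less)
    qed (use I in auto)
    then obtain C where C: "\<And>i. i \<in> I \<Longrightarrow> a < i \<Longrightarrow> i < b \<Longrightarrow> ?D h i \<le> C"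
      "\<And>j. j \<in> I \<Longrightarrow> j < a \<or> b < j \<Longrightarrow> C \<le> ?D h j" by auto
    \<comment> \<open>The chord bent by a separating number supports the heights from below.\<close>
    let ?ch = "\<lambda>i. (h a * real_of_int (b - i) + h b * real_of_int (i - a)) / real_of_int (b - a)"
    let ?l = "\<lambda>i. ?ch i + - C * cap a b i"
    have "quadratic ?ch"
      using quad_linear[of "h a / (b - a)" b "h b / (b - a)" a] by (simp add: add_divide_distrib)
    then have q: "quadratic ?l" by (intro quad_add quad_scale quad_cap)
    have at: "?l a = h a" "?l b = h b" using ba by auto
    have "?l i \<le> h i" if i: "i \<in> I" for i
    proof (cases "i = a \<or> i = b")
      case True then show ?thesis using at by auto
    next
      case False
      then have p: "cap a b i \<noteq> 0" by (simp add: cap_def)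
      have D: "?D h i * cap a b i = ?ch i - h i" unfolding ddiff_def using p by simp
      have "0 \<le> (C - ?D h i) * cap a b i"
      proof (cases "a < i \<and> i < b")
        case True then show ?thesis using C(1)[OF i] cap_pos[of a i b] by simp
      next
        case F: False
        then have "cap a b i < 0" "C \<le> ?D h i" using False ab C(2)[OF i] by (auto intro!: cap_neg)
        then show ?thesis by (simp add: mult_nonpos_nonpos)
      qed
      then show ?thesis using D by (simp add: left_diff_distrib)
    qed
    then show False using nt q at unfolding touches_def by blast
  qed
  then obtain i j where ij: "i \<in> I" "j \<in> I" "a < i" "i < b" "j < a \<or> b < j" "?D h j < ?D h i" by blast
  define \<kappa> where "\<kappa> = (\<lambda>i. 1 + real_of_int (\<bar>b - i\<bar> + \<bar>i - a\<bar>))"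
  have \<kappa>: "0 < \<kappa> i" for i by (simp add: \<kappa>_def add_pos_nonneg)
  define \<delta> where "\<delta> = (?D h i - ?D h j) / (\<kappa> i + \<kappa> j)"
  have \<delta>: "\<delta> > 0" using ij(6) \<kappa>[of i] \<kappa>[of j] by (simp add: \<delta>_def)
  have Dn: "\<bar>?D h' k - ?D h k\<bar> \<le> \<delta> * \<kappa> k"
    if near: "\<forall>i\<in>I. \<bar>h' i - h i\<bar> < \<delta>" and k: "k \<in> I" "k \<noteq> a" "k \<noteq> b" for h' k
  proof -
    let ?x = "((h' a - h a) * real_of_int (b - k) + (h' b - h b) * real_of_int (k - a)) / real_of_int (b - a)"
    have p: "1 \<le> \<bar>cap a b k\<bar>"
    proof -
      have "1 \<le> \<bar>(b - k) * (k - a)\<bar>" using k by (smt (verit) mult_eq_0_iff zero_less_abs_iff)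
      then have "1 \<le> \<bar>real_of_int ((b - k) * (k - a))\<bar>" by linarith
      then show ?thesis by (simp add: cap_def)
    qed
    have shrink: "\<bar>x / y\<bar> \<le> \<bar>x\<bar>" if "1 \<le> \<bar>y\<bar>" for x y :: real
      using mult_left_mono[OF that, of "\<bar>x\<bar>"] that by (simp add: abs_divide divide_le_eq)
    have "?D h' k - ?D h k = (?x - (h' k - h k)) / cap a b k"
      unfolding ddiff_def diff_divide_distrib[symmetric]
      by (simp add: add_divide_distrib diff_divide_distrib left_diff_distrib)
    then have "\<bar>?D h' k - ?D h k\<bar> \<le> \<bar>?x - (h' k - h k)\<bar>" using shrink[OF p] by simp
    also have "\<dots> \<le> \<bar>?x\<bar> + \<bar>h' k - h k\<bar>" by (rule abs_triangle_ineq4)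
    also have "\<bar>?x\<bar> \<le> \<bar>(h' a - h a) * real_of_int (b - k) + (h' b - h b) * real_of_int (k - a)\<bar>"
      using ba by (intro shrink) simp
    also have "\<dots> \<le> \<bar>(h' a - h a) * real_of_int (b - k)\<bar> + \<bar>(h' b - h b) * real_of_int (k - a)\<bar>" by simp
    also have "\<dots> \<le> \<delta> * \<bar>real_of_int (b - k)\<bar> + \<delta> * \<bar>real_of_int (k - a)\<bar>"
      unfolding abs_mult using near abI by (intro add_mono mult_right_mono) (auto intro: less_imp_le)
    finally have "\<bar>?D h' k - ?D h k\<bar> \<le> \<delta> * \<bar>real_of_int (b - k)\<bar> + \<delta> * \<bar>real_of_int (k - a)\<bar> + \<bar>h' k - h k\<bar>"
      by simp
    also have "\<dots> \<le> \<delta> * \<bar>real_of_int (b - k)\<bar> + \<delta> * \<bar>real_of_int (k - a)\<bar> + \<delta>" using near k by force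
    also have "\<dots> = \<delta> * \<kappa> k" by (simp add: \<kappa>_def algebra_simps)
    finally show ?thesis .
  qed
  show ?thesis
  proof (intro exI[of _ \<delta>] conjI allI impI notI)
    fix h' assume near: "\<forall>i\<in>I. \<bar>h' i - h i\<bar> < \<delta>" and ex: "exposed I h' a b"
    obtain l where l: "quadratic l" "\<And>i. i \<in> I \<Longrightarrow> i \<noteq> a \<Longrightarrow> i \<noteq> b \<Longrightarrow> l i < h' i" "l a = h' a" "l b = h' b"
      using exposedD[OF ex] by metis
    obtain C where C: "\<And>i. i \<noteq> a \<Longrightarrow> i \<noteq> b \<Longrightarrow> h' i - l i = (C - ?D h' i) * cap a b i"
      using ddiff_separates[OF ab l(1,3,4)] by blast
    have "0 < (C - ?D h' i) * cap a b i" using C[of i] l(2)[OF ij(1)] ij by force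
    then have 1: "?D h' i < C" using cap_pos[OF ij(3,4)] by (simp add: zero_less_mult_iff)
    have "0 < (C - ?D h' j) * cap a b j" using C[of j] l(2)[OF ij(2)] ij(5) ab by force
    then have 2: "C < ?D h' j" using cap_neg[OF ab ij(5)] by (simp add: zero_less_mult_iff)
    have "\<bar>?D h' i - ?D h i\<bar> \<le> \<delta> * \<kappa> i" "\<bar>?D h' j - ?D h j\<bar> \<le> \<delta> * \<kappa> j"
      using Dn[OF near] ij ab by auto
    moreover have "\<delta> * \<kappa> i + \<delta> * \<kappa> j = ?D h i - ?D h j"
      unfolding distrib_left[symmetric] using \<kappa>[of i] \<kappa>[of j] by (simp add: \<delta>_def)
    ultimately show False using 1 2 by linarith
  qed (rule \<delta>)
qed

lemma quad_zero3:
  assumes "quadratic q" "q x = 0" "q y = 0" "q z = 0" "x \<noteq> y" "y \<noteq> z" "x \<noteq> z"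
  shows "q i = 0"
proof -
  obtain A B C where L: "\<And>i. q i = A + B * real_of_int i + C * (real_of_int i)\<^sup>2"
    using assms(1) unfolding quadratic_def by blast
  have "C * ((y - x) * (z - y) * (z - x)) = 0" using quad_chord[OF L, of z x y] assms by simp
  then have "C = 0" using assms by simp
  then have "(z - x) * q i = 0" using quad_chord[OF L, of z x i] assms by simp
  then show ?thesis using assms by simp
qed

section \<open>Noncrossing diagonals on an interval\<close>

definition noncrossing_complex :: "int \<Rightarrow> int set \<Rightarrow> (int \<times> int) set set" where
  "noncrossing_complex n R = {S. S \<noteq> {} \<and> S \<subseteq> arcs_in 0 n - {(0, n)} \<and> noncrossing S \<and>
     (\<forall>(a, b)\<in>S. a \<notin> R \<or> b \<notin> R)}"

lemma finite_complex_noncrossing: "finite_complex (noncrossing_complex n R)"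
  unfolding finite_complex_def
proof (intro conjI ballI allI impI)
  have "noncrossing_complex n R \<subseteq> Pow (arcs_in 0 n)" by (auto simp: noncrossing_complex_def)
  then show "finite (noncrossing_complex n R)" using finite_arcs_in finite_subset by blast
  fix S assume S: "S \<in> noncrossing_complex n R"
  then show "S \<noteq> {}" by (simp add: noncrossing_complex_def)
  have "S \<subseteq> arcs_in 0 n" using S by (auto simp: noncrossing_complex_def)
  then show "finite S" using finite_arcs_in finite_subset by blast
  fix T assume "T \<noteq> {} \<and> T \<subseteq> S"
  then show "T \<in> noncrossing_complex n R"
    using S unfolding noncrossing_complex_def noncrossing_def by blast
qed

text \<open>
  The arc \<open>(0, n)\<close> is the side of the polygon joining the last vertex to the first.
\<close>

definition red_chord :: "int \<Rightarrow> int set \<Rightarrow> (int \<Rightarrow> real) \<Rightarrow> bool" where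
  "red_chord n R h \<longleftrightarrow> (\<exists>a b. (a, b) \<in> arcs_in 0 n \<and> (a, b) \<noteq> (0, n) \<and> a \<in> R \<and> b \<in> R \<and> exposed {0..n} h a b)"

lemma cone_noncrossingD:
  assumes "f \<in> weight_cone (noncrossing_complex n R)"
  shows "lamination 0 n f" "f (0, n) = 0" "f (a, b) \<noteq> 0 \<Longrightarrow> a \<notin> R \<or> b \<notin> R"
proof -
  have nn: "\<And>d. 0 \<le> f d" and
    S: "{d. f d \<noteq> 0} \<subseteq> arcs_in 0 n - {(0, n)}" "noncrossing {d. f d \<noteq> 0}" "\<forall>(a, b)\<in>{d. f d \<noteq> 0}. a \<notin> R \<or> b \<notin> R"
    using assms unfolding weight_cone_def noncrossing_complex_def noncrossing_def by auto
  then show "lamination 0 n f" unfolding lamination_def by blast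
  show "f (0, n) = 0" using S(1) by blast
  show "f (a, b) \<noteq> 0 \<Longrightarrow> a \<notin> R \<or> b \<notin> R" using S(3) by blast
qed

lemma cone_noncrossingI:
  assumes "lamination 0 n f" "f (0, n) = 0" "\<And>a b. f (a, b) \<noteq> 0 \<Longrightarrow> a \<notin> R \<or> b \<notin> R"
  shows "f \<in> weight_cone (noncrossing_complex n R)"
  using assms unfolding weight_cone_def noncrossing_complex_def lamination_def by blast

text \<open>
  The vertices at which a supporting function touches span a face of the lower convex hull, here a red one. It
  contains a diagonal of the polygon and is not the whole polygon, as there is a blue vertex, so one of its sides is a
  diagonal, and a side is exposed.
\<close>

lemma red_contact_imp_red_chord:
  assumes l: "quadratic l" "\<And>i. i \<in> {0..n} \<Longrightarrow> l i \<le> h i"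
    and red: "\<And>i. i \<in> {0..n} \<Longrightarrow> l i = h i \<Longrightarrow> i \<in> R"
    and ab: "(a, b) \<in> arcs_in 0 n" "(a, b) \<noteq> (0, n)" "l a = h a" "l b = h b"
    and blue: "j0 \<in> {0..n}" "j0 \<notin> R"
  shows "red_chord n R h"
proof (cases "\<exists>x y j. x \<in> {0..n} \<and> y \<in> {0..n} \<and> x < j \<and> j < y \<and> l x = h x \<and> l y = h y \<and> j \<notin> R")
  case True
  then obtain x y j where x: "x \<in> {0..n}" "y \<in> {0..n}" "x < j" "j < y" "l x = h x" "l y = h y" "j \<notin> R" by blast
  have j: "j \<in> {0..n}" using x by auto
  have "l j \<noteq> h j" using red[OF j] x(7) by blast
  then have "l j < h j" using l(2)[OF j] by linarith
  moreover have "{x..y} \<subseteq> {0..n}" using x by auto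
  ultimately obtain c e where ce: "c < j" "j < e" "l c = h c" "l e = h e" "c \<in> {0..n}" "e \<in> {0..n}"
    "\<And>i. c < i \<Longrightarrow> i < e \<Longrightarrow> l i < h i" "exposed {0..n} h c e"
    using exposed_gap[OF l _ x(3,4,5,6)] by metis
  have "(c, e) \<noteq> (0, n)"
  proof
    assume "(c, e) = (0, n)"
    then show False using ab ce(7)[of a] ce(7)[of b] by (auto simp: arcs_in_iff)
  qed
  moreover have "(c, e) \<in> arcs_in 0 n" using ce by (auto simp: arcs_in_iff)
  ultimately show ?thesis using ce red unfolding red_chord_def by blast
next
  case False
  have in_n: "a \<in> {0..n}" "b \<in> {0..n}" "a < b" using ab by (auto simp: arcs_in_iff)
  obtain c e where ce: "c \<le> a" "b \<le> e" "l c = h c" "l e = h e" "c \<in> {0..n}" "e \<in> {0..n}" "exposed {0..n} h c e"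
    by (rule exposed_outer[OF l finite_atLeastAtMost_int in_n ab(3,4)])
  have "(c, e) \<noteq> (0, n)"
  proof
    assume eq: "(c, e) = (0, n)"
    have "j0 \<noteq> c" "j0 \<noteq> e" using red ce blue by auto
    then have "c < j0" "j0 < e" using eq blue by auto
    then show False using False ce blue by blast
  qed
  moreover have "(c, e) \<in> arcs_in 0 n" using ce ab by (auto simp: arcs_in_iff)
  ultimately show ?thesis using ce red unfolding red_chord_def by blast
qed

lemma quad_vanishing_ends:
  assumes q: "quadratic q" "q 0 = 0" "q n = 0" and n: "2 \<le> n"
  obtains c where "\<And>i. q i = c * cap 0 n i"
proof -
  have p: "cap 0 n 1 \<noteq> 0" using n by (simp add: cap_def)
  have "quadratic (\<lambda>i. q i - q 1 / cap 0 n 1 * cap 0 n i)"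
    by (intro quad_diff q quad_scale quad_cap)
  then have "q i - q 1 / cap 0 n 1 * cap 0 n i = 0" for i
    by (rule quad_zero3[of _ 0 n 1]) (use q n p in simp_all)
  then have "q i = q 1 / cap 0 n 1 * cap 0 n i" for i by (metis eq_iff_diff_eq_0)
  then show thesis by (rule that)
qed

lemma top_arc_crosses_none:
  assumes "lamination 0 n f" "f d \<noteq> 0"
  shows "\<not> crosses (0, n) d"
  using laminationD(2)[OF assms] by (auto simp: crosses_def arcs_in_def)

text \<open>
  On \<open>[0, n]\<close> the bump of the arc \<open>(0, n)\<close> is a quadratic function, so this weight is free modulo
  trivial heights, and making it large makes the heights positive.
\<close>

lemma height_add_top:
  assumes f: "lamination 0 n f" and n: "2 \<le> n" and c: "0 \<le> f (0, n) + c"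
  shows "lamination 0 n (f((0, n) := f (0, n) + c))"
    "\<And>i. i \<in> {0..n} \<Longrightarrow> height 0 n (f((0, n) := f (0, n) + c)) i = height 0 n f i + c * cap 0 n i"
proof -
  have arc: "(0, n) \<in> arcs_in 0 n" using n by (simp add: arcs_in_iff)
  show "lamination 0 n (f((0, n) := f (0, n) + c))"
    by (rule lamination_add_arc[OF f arc c top_arc_crosses_none[OF f]])
  show "height 0 n (f((0, n) := f (0, n) + c)) i = height 0 n f i + c * cap 0 n i" if "i \<in> {0..n}" for i
    using height_update[OF arc, of f c i] bump_in[of 0 i n] that by simp
qed

lemma height_mod_quad_unique:
  assumes f: "lamination 0 n f" "f (0, n) = 0" and g: "lamination 0 n g" "g (0, n) = 0" and n: "2 \<le> n"
    and q: "quadratic q" and eq: "\<And>i. i \<in> {0..n} \<Longrightarrow> height 0 n f i = height 0 n g i + q i"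
  shows "f = g"
proof -
  have "q 0 = 0" "q n = 0"
    using eq[of 0] eq[of n] height_end[OF f(1)] height_end[OF g(1)] n by auto
  from quad_vanishing_ends[OF q this n] obtain c where c: "\<And>i. q i = c * cap 0 n i" by blast
  have main: "f = g" if f: "lamination 0 n f" "f (0, n) = 0" and g: "lamination 0 n g" "g (0, n) = 0"
      and c: "0 \<le> c" "\<And>i. i \<in> {0..n} \<Longrightarrow> height 0 n f i = height 0 n g i + c * cap 0 n i" for f g c
  proof -
    have c': "0 \<le> g (0, n) + c" using c g by simp
    have fg: "f = g((0, n) := g (0, n) + c)"
      by (rule lamination_unique[OF f(1) height_add_top(1)[OF g(1) n c']])
        (simp add: c(2) height_add_top(2)[OF g(1) n c'])
    then have "f (0, n) = g (0, n) + c" by simp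
    then show ?thesis using fg f(2) g(2) by (metis fun_upd_triv)
  qed
  show ?thesis
  proof (cases "0 \<le> c")
    case True then show ?thesis using main[OF f g True] eq c by simp
  next
    case False
    have "g = f" using main[OF g f, of "- c"] eq c False by simp
    then show ?thesis by simp
  qed
qed

lemma height_mod_quad_exists:
  assumes n: "2 \<le> n"
  obtains f q where "lamination 0 n f" "f (0, n) = 0" "quadratic q" "\<And>i. i \<in> {0..n} \<Longrightarrow> h i = height 0 n f i + q i"
proof -
  let ?ch = "\<lambda>i. h 0 / n * real_of_int (n - i) + h n / n * real_of_int (i - 0)"
  let ?g = "\<lambda>i. h i - ?ch i"
  have "finite {0<..<n}" by simp
  from small_multiples[where g = "cap 0 n" and f = "\<lambda>i. - ?g i", OF this cap_pos]
  obtain \<epsilon> where "\<epsilon> > 0" "\<forall>s. 0 \<le> s \<and> s \<le> \<epsilon> \<longrightarrow> (\<forall>i\<in>{0<..<n}. s * - ?g i < cap 0 n i)" by auto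
  then have \<epsilon>: "\<epsilon> > 0" "\<And>i. i \<in> {0<..<n} \<Longrightarrow> \<epsilon> * - ?g i < cap 0 n i" by auto
  \<comment> \<open>Subtract the chord and add a parabola steep enough to make the function nonnegative.\<close>
  let ?h = "\<lambda>i. ?g i + 1 / \<epsilon> * cap 0 n i"
  have e0: "?h 0 = 0" "?h n = 0" using n by auto
  have nn: "0 \<le> ?h i" if "i \<in> {0..n}" for i
  proof (cases "i \<in> {0<..<n}")
    case True
    have "\<epsilon> * - ?g i < cap 0 n i" by (rule \<epsilon>(2)[OF True])
    moreover have "\<epsilon> * (g + 1 / \<epsilon> * p) = p - \<epsilon> * - g" for g p
      using \<epsilon>(1) by (simp add: distrib_left)
    then have "\<epsilon> * ?h i = cap 0 n i - \<epsilon> * - ?g i" .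
    ultimately have "0 < \<epsilon> * ?h i" by simp
    then show ?thesis using \<epsilon>(1) by (simp add: zero_less_mult_iff)
  next
    case False
    then have "i = 0 \<or> i = n" using that by auto
    then show ?thesis using e0 by auto
  qed
  from lamination_exists[of ?h, OF e0 nn] obtain w where
    w: "lamination 0 n w" "\<And>i. i \<in> {0..n} \<Longrightarrow> ?h i = height 0 n w i" by auto
  let ?f = "w((0, n) := w (0, n) + - w (0, n))"
  have c: "0 \<le> w (0, n) + - w (0, n)" by simp
  show thesis
  proof (rule that[of ?f "\<lambda>i. ?ch i + (w (0, n) - 1 / \<epsilon>) * cap 0 n i"])
    show "lamination 0 n ?f" by (rule height_add_top(1)[OF w(1) n c])
    show "?f (0, n) = 0" by simp
    show "quadratic (\<lambda>i. ?ch i + (w (0, n) - 1 / \<epsilon>) * cap 0 n i)"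
      by (intro quad_add[OF quad_linear] quad_scale quad_cap)
    show "h i = height 0 n ?f i + (?ch i + (w (0, n) - 1 / \<epsilon>) * cap 0 n i)" if "i \<in> {0..n}" for i
      using height_add_top(2)[OF w(1) n c that] w(2)[OF that] by (simp add: left_diff_distrib)
  qed
qed

text \<open>
  Trivial heights are the quadratic functions, with interpolation points \<open>r\<close>, \<open>s\<close> and
  \<open>y\<close>. The colours at \<open>x\<close> and \<open>y\<close>, on either side of the red diagonal
  \<open>(r, s)\<close>, ensure that the indicator function of the red vertices is not quadratic on these four points.
\<close>

theorem noncrossing_complex_ball:
  assumes m: "4 \<le> m" and n: "n = int m - 1"
    and rr: "(r, s) \<in> arcs_in 0 n" "(r, s) \<noteq> (0, n)" "r \<in> R" "s \<in> R"
    and blue: "j0 \<in> {0..n}" "j0 \<notin> R"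
  shows "is_closed_ball (noncrossing_complex n R) (m - 4)"
proof -
  let ?K = "noncrossing_complex n R"
  define u where "u = (\<lambda>i. if i \<in> R then 1 else 0 :: real)"
  have n2: "2 \<le> n" using m n by auto
  have rs: "0 \<le> r" "r + 2 \<le> s" "s \<le> n" using rr by (auto simp: arcs_in_iff)
  \<comment> \<open>Two more vertices, on either side of the red diagonal and not both red.\<close>
  obtain x y where xy: "r < x" "x < s" "y \<in> {0..n}" "y < r \<or> s < y" "x \<notin> R \<or> y \<notin> R"
  proof (cases "r < j0 \<and> j0 < s")
    case True
    have "0 < r \<or> s < n" using rr(2) rs by auto
    then obtain y where "y \<in> {0..n}" "y < r \<or> s < y"
      using rs by (cases "0 < r") (auto intro: that[of 0] that[of n])
    then show thesis using True blue that by blast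
  next
    case False
    then have "j0 < r \<or> s < j0" using blue rr by (cases "j0 = r"; cases "j0 = s") auto
    then show thesis using that[of "r + 1" j0] rs blue by auto
  qed
  have dist: "r \<noteq> s" "r \<noteq> y" "s \<noteq> y" "x \<noteq> r" "x \<noteq> s" "x \<noteq> y" using xy rs by auto
  define Z where "Z = {r, s, y}"
  define nod where "nod = (\<lambda>k. if k = r then cap s y else if k = s then cap r y else cap r s)"
  define e where "e = (\<lambda>k i. nod k i / nod k k)"
  have nodk: "nod k k \<noteq> 0" if "k \<in> Z" for k using that dist by (auto simp: Z_def nod_def cap_def)
  have nod0: "nod k j = 0" if "k \<in> Z" "j \<in> Z" "j \<noteq> k" for k j
    using that dist by (auto simp: Z_def nod_def)
  have e: "e k j = (if j = k then 1 else 0)" if "k \<in> Z" "j \<in> Z" for k j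
    using nodk[OF that(1)] nod0[OF that] by (auto simp: e_def)
  have quade: "quadratic (e k)" for k
  proof -
    have "quadratic (nod k)" unfolding nod_def by (auto intro: quad_cap)
    from quad_scale[OF this, of "1 / nod k k"] show ?thesis by (simp add: e_def)
  qed
  have quadL: "quadratic (\<lambda>i. \<Sum>k\<in>Z. c k * e k i)" for c by (intro quad_sum quad_scale quade)
  have interp: "q i = (\<Sum>k\<in>Z. q k * e k i)" if q: "quadratic q" for q i
  proof -
    have z: "q j - (\<Sum>k\<in>Z. q k * e k j) = 0" if "j \<in> Z" for j
    proof -
      have "(\<Sum>k\<in>Z. q k * e k j) = (\<Sum>k\<in>Z. if k = j then q k else 0)"
        using e that by (intro sum.cong) auto
      also have "\<dots> = q j" using that by (simp add: Z_def)
      finally show ?thesis by simp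
    qed
    have "r \<in> Z" "s \<in> Z" "y \<in> Z" by (simp_all add: Z_def)
    then have "q i - (\<Sum>k\<in>Z. q k * e k i) = 0"
      by (intro quad_zero3[OF quad_diff[OF q quadL] z z z dist(1) dist(3) dist(2)])
    then show ?thesis by simp
  qed
  show ?thesis
  proof (rule ball_from_heights[where V = "{0..n}" and Z = Z and ?k0.0 = x and u = u and e = e
        and H = "height 0 n" and N = "red_chord n R", OF finite_complex_noncrossing])
    show "finite {0..n}" "Z \<subseteq> {0..n}" "x \<in> {0..n}" "x \<notin> Z" using xy rs dist by (auto simp: Z_def)
    have "{0..n} - Z - {x} = {0..n} - {r, s, y, x}" by (auto simp: Z_def)
    moreover have "card ({0..n} - {r, s, y, x}) = card {0..n} - card {r, s, y, x}"
      using xy rs by (intro card_Diff_subset) auto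
    moreover have "card {r, s, y, x} = 4" using dist by auto
    ultimately show "card ({0..n} - Z - {x}) = m - 4" using n by simp
    show "continuous_on UNIV (\<lambda>f. height 0 n f i)" for i
      unfolding height_def
      by (intro continuous_on_sum continuous_on_mult continuous_on_coordinate continuous_on_const)
    show "height 0 n (\<lambda>v. c * f v) i = c * height 0 n f i" for c f i
      by (simp add: height_def sum_distrib_left mult.assoc)
    show "e k j = (if j = k then 1 else 0)" if "k \<in> Z" "j \<in> Z" for k j using e[OF that] .
    show "u x \<noteq> (\<Sum>k\<in>Z. u k * e k x)"
    proof -
      \<comment> \<open>The quadratic function that agrees with \<open>u\<close> at \<open>r\<close>, \<open>s\<close> and \<open>y\<close>.\<close>
      define q where "q = (\<lambda>i. 1 + (u y - 1) / cap r s y * cap r s i)"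
      have yn: "cap r s y < 0" using rs xy by (intro cap_neg) auto
      have xp: "0 < cap r s x" using xy by (intro cap_pos) auto
      have q: "quadratic q" unfolding q_def by (intro quad_add quad_const quad_scale quad_cap)
      have "q k = u k" if "k \<in> Z" for k using that rr yn by (auto simp: Z_def q_def u_def)
      then have "(\<Sum>k\<in>Z. u k * e k x) = q x" unfolding interp[OF q, of x] by (intro sum.cong) auto
      moreover have "u x \<noteq> q x"
      proof (cases "y \<in> R")
        case True
        then show ?thesis using xy(5) by (simp add: q_def u_def)
      next
        case False
        have "1 < q x" using False yn xp by (simp add: q_def u_def divide_pos_neg)
        moreover have "u x \<le> 1" by (simp add: u_def)
        ultimately show ?thesis by linarith
      qed
      ultimately show ?thesis by simp
    qed
    show "red_chord n R h \<longleftrightarrow> red_chord n R h'" if "\<And>i. i \<in> {0..n} \<Longrightarrow> h i = h' i" for h h'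
      unfolding red_chord_def using exposed_cong[of "{0..n}" h h'] that by simp
    show "red_chord n R (\<lambda>i. h i + (\<Sum>k\<in>Z. c k * e k i)) \<longleftrightarrow> red_chord n R h" for h c
      unfolding red_chord_def exposed_add_quad[OF quadL] ..
    show "\<not> red_chord n R (height 0 n f)" if f: "f \<in> weight_cone ?K" for f
    proof
      note fD = cone_noncrossingD[OF f]
      assume "red_chord n R (height 0 n f)"
      then obtain a b where ab: "(a, b) \<in> arcs_in 0 n" "(a, b) \<noteq> (0, n)" "a \<in> R" "b \<in> R"
        "exposed {0..n} (height 0 n f) a b" unfolding red_chord_def by blast
      \<comment> \<open>A parabola is added to make the heights positive between \<open>0\<close> and \<open>n\<close>.\<close>
      let ?f = "f((0, n) := f (0, n) + 1)"
      have 1: "0 \<le> f (0, n) + 1" using fD by simp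
      note F = height_add_top[OF fD(1) n2 1]
      have "exposed {0..n} (\<lambda>i. height 0 n f i + 1 * cap 0 n i) a b"
        by (rule iffD2[OF exposed_add_quad[OF quad_scale[OF quad_cap]] ab(5)])
      then have "exposed {0..n} (height 0 n ?f) a b"
        by (subst exposed_cong[where h' = "\<lambda>i. height 0 n f i + 1 * cap 0 n i", OF F(2)])
      moreover have "0 < height 0 n ?f j" if "a < j" "j < b" for j
      proof -
        have "?f (0, n) \<noteq> 0 \<and> 0 < j \<and> j < n" using that ab(1) fD(2) by (auto simp: arcs_in_iff)
        then show ?thesis unfolding height_pos_iff[OF F(1)] by blast
      qed
      ultimately have "?f (a, b) \<noteq> 0" by (rule exposed_lamination[OF F(1) ab(1)])
      then have "f (a, b) \<noteq> 0" using ab(2) by auto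
      then show False using fD(3) ab by blast
    qed
    show "\<exists>f\<in>weight_cone ?K. \<exists>c. \<forall>i\<in>{0..n}. h i = height 0 n f i + (\<Sum>k\<in>Z. c k * e k i)"
      if h: "\<not> red_chord n R h" for h
    proof -
      obtain f q where f: "lamination 0 n f" "f (0, n) = 0" "quadratic q" "\<And>i. i \<in> {0..n} \<Longrightarrow> h i = height 0 n f i + q i"
        using height_mod_quad_exists[OF n2, of h] by metis
      have "a \<notin> R \<or> b \<notin> R" if ab: "f (a, b) \<noteq> 0" for a b
      proof (rule ccontr)
        assume R: "\<not> ?thesis"
        have "exposed {0..n} (\<lambda>i. height 0 n f i + q i) a b"
          by (rule iffD2[OF exposed_add_quad[OF f(3)] lamination_exposed_in[OF f(1) ab]])
        then have "exposed {0..n} h a b"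
          by (subst exposed_cong[where h' = "\<lambda>i. height 0 n f i + q i", OF f(4)])
        moreover have "(a, b) \<in> arcs_in 0 n" "(a, b) \<noteq> (0, n)" using laminationD(2)[OF f(1) ab] ab f(2) by auto
        ultimately show False using h R unfolding red_chord_def by blast
      qed
      then have "f \<in> weight_cone ?K" by (rule cone_noncrossingI[OF f(1,2)])
      moreover have "\<forall>i\<in>{0..n}. h i = height 0 n f i + (\<Sum>k\<in>Z. q k * e k i)"
      proof
        fix i assume "i \<in> {0..n}"
        then show "h i = height 0 n f i + (\<Sum>k\<in>Z. q k * e k i)"
          using f(4)[of i] interp[OF f(3), of i] by linarith
      qed
      ultimately show ?thesis by blast
    qed
    show "f = g" if "f \<in> weight_cone ?K" "g \<in> weight_cone ?K"
      "\<And>i. i \<in> {0..n} \<Longrightarrow> height 0 n f i = height 0 n g i + (\<Sum>k\<in>Z. c k * e k i)" for f g c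
      by (rule height_mod_quad_unique[OF cone_noncrossingD(1,2)[OF that(1)] cone_noncrossingD(1,2)[OF that(2)] n2 quadL that(3)])
    show "\<exists>\<delta>>0. \<forall>h'. (\<forall>i\<in>{0..n}. \<bar>h' i - h i\<bar> < \<delta>) \<longrightarrow> red_chord n R h'" if h: "red_chord n R h" for h
    proof -
      obtain a b where ab: "(a, b) \<in> arcs_in 0 n" "(a, b) \<noteq> (0, n)" "a \<in> R" "b \<in> R"
        "exposed {0..n} h a b" using h unfolding red_chord_def by blast
      have "finite {0..n}" by simp
      from exposed_open[OF this ab(5)] show ?thesis using ab unfolding red_chord_def by meson
    qed
    show "\<exists>\<delta>>0. \<forall>h'. (\<forall>i\<in>{0..n}. \<bar>h' i - (h i + t * u i)\<bar> < \<delta>) \<longrightarrow> \<not> red_chord n R h'"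
      if h: "\<not> red_chord n R h" and t: "0 < t" for h t
    proof -
      define A where "A = {d \<in> arcs_in 0 n. d \<noteq> (0, n) \<and> fst d \<in> R \<and> snd d \<in> R}"
      have finA: "finite A" unfolding A_def using finite_arcs_in by simp
      have "\<forall>d\<in>A. \<exists>\<delta>>0. \<forall>h'. (\<forall>i\<in>{0..n}. \<bar>h' i - (h i + t * u i)\<bar> < \<delta>) \<longrightarrow> \<not> exposed {0..n} h' (fst d) (snd d)"
      proof
        fix d assume d: "d \<in> A"
        obtain a b where dab: "d = (a, b)" by force
        have ab: "(a, b) \<in> arcs_in 0 n" "(a, b) \<noteq> (0, n)" "a \<in> R" "b \<in> R" using d by (auto simp: A_def dab)
        have "\<not> touches {0..n} (\<lambda>i. h i + t * u i) a b"
        proof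
          assume "touches {0..n} (\<lambda>i. h i + t * u i) a b"
          then obtain l where l: "quadratic l" "\<And>i. i \<in> {0..n} \<Longrightarrow> l i \<le> h i + t * u i"
            "l a = h a + t * u a" "l b = h b + t * u b" unfolding touches_def by blast
          have "red_chord n R h"
          proof (rule red_contact_imp_red_chord[OF _ _ _ ab(1,2) _ _ blue])
            show "quadratic (\<lambda>i. l i - t)" by (intro quad_diff l quad_const)
            have "t * u i \<le> t" "i \<notin> R \<Longrightarrow> t * u i < t" for i using t by (auto simp: u_def)
            then show "l i - t \<le> h i" "l i - t = h i \<Longrightarrow> i \<in> R" if "i \<in> {0..n}" for i
              using l(2)[OF that] by (smt (verit))+
            show "l a - t = h a" "l b - t = h b" using l ab by (auto simp: u_def)
          qed
          then show False using h by blast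
        qed
        moreover have "a < b" using ab by (auto simp: arcs_in_iff)
        ultimately show "\<exists>\<delta>>0. \<forall>h'. (\<forall>i\<in>{0..n}. \<bar>h' i - (h i + t * u i)\<bar> < \<delta>) \<longrightarrow> \<not> exposed {0..n} h' (fst d) (snd d)"
          using not_touches_open[of "{0..n}" a b "\<lambda>i. h i + t * u i"] by (simp add: dab)
      qed
      then obtain \<delta> where \<delta>: "\<And>d. d \<in> A \<Longrightarrow> 0 < \<delta> d" "\<And>d h'. d \<in> A \<Longrightarrow>
          (\<forall>i\<in>{0..n}. \<bar>h' i - (h i + t * u i)\<bar> < \<delta> d) \<Longrightarrow> \<not> exposed {0..n} h' (fst d) (snd d)"
        by metis
      define \<epsilon> where "\<epsilon> = Min (insert 1 (\<delta> ` A))"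
      have \<epsilon>: "\<epsilon> > 0" "\<And>d. d \<in> A \<Longrightarrow> \<epsilon> \<le> \<delta> d" using \<delta>(1) finA by (auto simp: \<epsilon>_def)
      show ?thesis
      proof (intro exI[of _ \<epsilon>] conjI allI impI notI)
        fix h' assume near: "\<forall>i\<in>{0..n}. \<bar>h' i - (h i + t * u i)\<bar> < \<epsilon>" and "red_chord n R h'"
        then obtain a b where "(a, b) \<in> A" "exposed {0..n} h' a b" unfolding red_chord_def A_def by force
        then show False using \<delta>(2)[of "(a, b)" h'] near \<epsilon>(2)[of "(a, b)"] by force
      qed (rule \<epsilon>(1))
    qed
    show "red_chord n R (\<lambda>i. - u i)"
      by (rule red_contact_imp_red_chord[of "\<lambda>_. -1", OF quad_const _ _ rr(1,2) _ _ blue])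
        (use rr in \<open>auto simp: u_def split: if_splits\<close>)
  qed
qed

section \<open>Noncrossing periodic arcs\<close>

text \<open>
  The deck transformations of the universal covering of the punctured polygon.
\<close>

definition shift_arc :: "int \<Rightarrow> int \<Rightarrow> int \<times> int \<Rightarrow> int \<times> int" where
  "shift_arc M k d = (fst d + k * M, snd d + k * M)"

text \<open>
  Representatives of the arcs modulo translation. An arc of length \<open>M\<close> is the lift of a loop around
  the puncture; a longer arc would cross its translates.
\<close>

definition periodic_arcs :: "int \<Rightarrow> (int \<times> int) set" where
  "periodic_arcs M = {(a, b). 0 \<le> a \<and> a < M \<and> a + 2 \<le> b \<and> b \<le> a + M}"

definition periodic_complex :: "int \<Rightarrow> int set \<Rightarrow> (int \<times> int) set set" where
  "periodic_complex M R = {S. S \<noteq> {} \<and> S \<subseteq> periodic_arcs M \<and>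
     (\<forall>d\<in>S. \<forall>e\<in>S. \<forall>k. \<not> crosses d (shift_arc M k e)) \<and> (\<forall>(a, b)\<in>S. a \<notin> R \<or> b \<notin> R)}"

lemma finite_periodic_arcs: "finite (periodic_arcs M)"
  by (rule finite_subset[of _ "{0..2 * M} \<times> {0..2 * M}"]) (auto simp: periodic_arcs_def)

lemma finite_complex_periodic: "finite_complex (periodic_complex M R)"
  unfolding finite_complex_def
proof (intro conjI ballI allI impI)
  have "periodic_complex M R \<subseteq> Pow (periodic_arcs M)" by (auto simp: periodic_complex_def)
  then show "finite (periodic_complex M R)" using finite_periodic_arcs finite_subset by blast
  fix S assume S: "S \<in> periodic_complex M R"
  then show "S \<noteq> {}" by (simp add: periodic_complex_def)
  have "S \<subseteq> periodic_arcs M" using S by (auto simp: periodic_complex_def)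
  then show "finite S" using finite_periodic_arcs finite_subset by blast
  fix T assume "T \<noteq> {} \<and> T \<subseteq> S"
  then show "T \<in> periodic_complex M R" using S unfolding periodic_complex_def by blast
qed

lemma crosses_shift: "crosses (shift_arc M k d) (shift_arc M k e) = crosses d e"
  by (simp add: crosses_def shift_arc_def)

lemma shift_shift: "shift_arc M k (shift_arc M j d) = shift_arc M (k + j) d"
  by (simp add: shift_arc_def algebra_simps)

lemma shift_zero [simp]: "shift_arc M 0 d = d" by (simp add: shift_arc_def)

lemma bump_shift: "bump (a + t) (b + t) (i + t) = bump a b i"
  by (simp add: bump_def cap_def)

definition reduce :: "int \<Rightarrow> int \<times> int \<Rightarrow> int \<times> int" where
  "reduce M d = shift_arc M (- (fst d div M)) d"

lemma reduce_eq: "reduce M (a, b) = (a mod M, b - M * (a div M))"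
  by (simp add: reduce_def shift_arc_def minus_div_mult_eq_mod[symmetric] mult.commute)

lemma reduce_rep: "d \<in> periodic_arcs M \<Longrightarrow> reduce M d = d"
  by (auto simp: periodic_arcs_def reduce_eq)

lemma reduce_shift: "0 < M \<Longrightarrow> reduce M (shift_arc M k d) = reduce M d"
  by (cases d) (simp add: reduce_eq shift_arc_def algebra_simps)

lemma shift_reduce: "shift_arc M (fst d div M) (reduce M d) = d"
  by (simp add: reduce_def shift_shift)

lemma reduce_in: "0 < M \<Longrightarrow> d \<in> arcs_in z (z + M) \<Longrightarrow> reduce M d \<in> periodic_arcs M"
proof -
  assume M: "0 < M" and d: "d \<in> arcs_in z (z + M)"
  obtain a b where dab: "d = (a, b)" by force
  have "0 \<le> a mod M" "a mod M < M" using M by simp_all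
  moreover have "b - M * (a div M) = a mod M + (b - a)" by (simp add: minus_mult_div_eq_mod[symmetric])
  ultimately show "reduce M d \<in> periodic_arcs M"
    using d unfolding dab reduce_eq by (auto simp: arcs_in_iff periodic_arcs_def)
qed

lemma inj_on_reduce: "0 < M \<Longrightarrow> inj_on (reduce M) (arcs_in z (z + M))"
proof (rule inj_onI)
  fix d e assume M: "0 < M" and d: "d \<in> arcs_in z (z + M)" and e: "e \<in> arcs_in z (z + M)" and eq: "reduce M d = reduce M e"
  let ?k = "fst d div M - fst e div M"
  have "d = shift_arc M ?k e"
  proof -
    have "d = shift_arc M (fst d div M) (reduce M e)" using shift_reduce[of M d] eq by simp
    then show ?thesis by (simp add: reduce_def shift_shift)
  qed
  then have de: "fst d = fst e + ?k * M" unfolding shift_arc_def by (metis fst_conv)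
  have "\<bar>fst d - fst e\<bar> < M" using d e by (auto simp: arcs_in_def)
  moreover have "fst d - fst e = ?k * M" using de by linarith
  ultimately have "\<bar>?k\<bar> * M < 1 * M" using M by (simp only: abs_mult)
  then have "\<bar>?k\<bar> < 1" using M by (simp only: mult_less_cancel_right)
  then have "?k = 0" by linarith
  then show "d = e" using \<open>d = shift_arc M ?k e\<close> by simp
qed

text \<open>
  The sum of the bumps over all translates of an arc. Since the arc has length at most \<open>M\<close>, at most one
  translate passes over \<open>i\<close>; instead of that translate the index is shifted.
\<close>

definition periodic_bump :: "int \<Rightarrow> int \<times> int \<Rightarrow> int \<Rightarrow> real" where
  "periodic_bump M d i = bump (fst d) (snd d) (fst d + (i - fst d) mod M)"

definition periodic_height :: "int \<Rightarrow> (int \<times> int \<Rightarrow> real) \<Rightarrow> int \<Rightarrow> real" where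
  "periodic_height M f i = (\<Sum>d\<in>periodic_arcs M. f d * periodic_bump M d i)"

lemma periodic_height_cong: "i mod M = j mod M \<Longrightarrow> periodic_height M f i = periodic_height M f j"
  unfolding periodic_height_def periodic_bump_def by (metis mod_diff_left_eq)

definition periodic_lamination :: "int \<Rightarrow> (int \<times> int \<Rightarrow> real) \<Rightarrow> bool" where
  "periodic_lamination M f \<longleftrightarrow> (\<forall>d. 0 \<le> f d) \<and> {d. f d \<noteq> 0} \<subseteq> periodic_arcs M \<and>
     (\<forall>d e k. f d \<noteq> 0 \<longrightarrow> f e \<noteq> 0 \<longrightarrow> \<not> crosses d (shift_arc M k e))"

lemma periodic_laminationD:
  assumes "periodic_lamination M f"
  shows "0 \<le> f d" "f d \<noteq> 0 \<Longrightarrow> d \<in> periodic_arcs M" "f d \<noteq> 0 \<Longrightarrow> f e \<noteq> 0 \<Longrightarrow> \<not> crosses d (shift_arc M k e)"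
  using assms unfolding periodic_lamination_def by blast+

lemma periodic_height_nonneg: "periodic_lamination M f \<Longrightarrow> 0 \<le> periodic_height M f i"
  unfolding periodic_height_def periodic_bump_def
  using periodic_laminationD(1) bump_nonneg by (intro sum_nonneg mult_nonneg_nonneg) auto

lemma periodic_height_zero_iff:
  assumes f: "periodic_lamination M f"
  shows "periodic_height M f i = 0 \<longleftrightarrow> (\<forall>d. f d \<noteq> 0 \<longrightarrow> periodic_bump M d i = 0)"
proof -
  have "periodic_height M f i = 0 \<longleftrightarrow> (\<forall>d\<in>periodic_arcs M. f d * periodic_bump M d i = 0)"
    unfolding periodic_height_def using periodic_laminationD(1)[OF f] bump_nonneg finite_periodic_arcs
    by (intro sum_nonneg_eq_0_iff) (auto simp: periodic_bump_def)
  also have "\<dots> \<longleftrightarrow> (\<forall>d. f d \<noteq> 0 \<longrightarrow> periodic_bump M d i = 0)"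
    using periodic_laminationD(2)[OF f] by (metis mult_eq_0_iff)
  finally show ?thesis .
qed

text \<open>
  Cuts the periodic picture open at \<open>z\<close>. If no arc passes over \<open>z\<close>, every arc has exactly one
  translate in the window \<open>[z, z + M]\<close>.
\<close>

definition unroll :: "int \<Rightarrow> int \<Rightarrow> (int \<times> int \<Rightarrow> real) \<Rightarrow> int \<times> int \<Rightarrow> real" where
  "unroll M z f d = (if d \<in> arcs_in z (z + M) then f (reduce M d) else 0)"

lemma crosses_reduce:
  obtains j where "crosses d (shift_arc M k e) = crosses (reduce M d) (shift_arc M j (reduce M e))"
proof -
  have "crosses d (shift_arc M k e) =
      crosses (shift_arc M (- (fst d div M)) d) (shift_arc M (- (fst d div M)) (shift_arc M k (shift_arc M (fst e div M) (reduce M e))))"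
    unfolding crosses_shift shift_reduce ..
  then show thesis using that unfolding shift_shift reduce_def[of M d, symmetric] by blast
qed

lemma lamination_unroll:
  assumes f: "periodic_lamination M f"
  shows "lamination z (z + M) (unroll M z f)"
proof (rule laminationI)
  show "0 \<le> unroll M z f d" for d using periodic_laminationD(1)[OF f] by (simp add: unroll_def)
  show "d \<in> arcs_in z (z + M)" if "unroll M z f d \<noteq> 0" for d using that by (auto simp: unroll_def split: if_splits)
  show "\<not> crosses d e" if "unroll M z f d \<noteq> 0" "unroll M z f e \<noteq> 0" for d e
  proof -
    have "f (reduce M d) \<noteq> 0" "f (reduce M e) \<noteq> 0" using that by (auto simp: unroll_def split: if_splits)
    then show ?thesis using periodic_laminationD(3)[OF f] crosses_reduce[of d M 0 e] by (metis shift_zero)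
  qed
qed

lemma periodic_bump_reduce:
  assumes M: "0 < M" and d: "d \<in> arcs_in z (z + M)" and i: "i \<in> {z..z + M}"
  shows "periodic_bump M (reduce M d) i = bump (fst d) (snd d) i"
proof -
  obtain a b where dab: "d = (a, b)" by force
  have ab: "z \<le> a" "a + 2 \<le> b" "b \<le> z + M" using d by (auto simp: dab arcs_in_iff)
  let ?t = "M * (a div M)"
  have at: "a mod M = a - ?t" by (simp add: minus_mult_div_eq_mod)
  have "periodic_bump M (reduce M d) i = bump (a - ?t) (b - ?t) (a - ?t + (i - (a - ?t)) mod M)"
    by (simp add: periodic_bump_def dab reduce_eq at)
  also have "(i - (a - ?t)) mod M = (i - a) mod M"
    using mod_mult_self2[of "i - a" M "a div M"] by (simp add: algebra_simps)
  also have "bump (a - ?t) (b - ?t) (a - ?t + (i - a) mod M) = bump a b (a + (i - a) mod M)"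
    using bump_shift[of a "- ?t" b "a + (i - a) mod M"] by (simp add: algebra_simps)
  also have "\<dots> = bump a b i"
  proof -
    consider "i < a" | "a \<le> i" "i < a + M" | "a + M \<le> i" by linarith
    then show ?thesis
    proof cases
      case 1
      have "(i - a) mod M = (i - a + M) mod M" by simp
      also have "\<dots> = i - a + M" using 1 i ab by (intro mod_pos_pos_trivial) auto
      finally have "bump a b (a + (i - a) mod M) = 0" using ab i by (intro bump_out) auto
      moreover have "bump a b i = 0" using 1 ab by (intro bump_out) auto
      ultimately show ?thesis by simp
    next
      case 2
      then show ?thesis by (simp add: mod_pos_pos_trivial)
    next
      case 3
      then have "i - a = M" using i ab by auto
      then have "bump a b (a + (i - a) mod M) = bump a b a" by simp
      then show ?thesis using 3 ab i bump_out[of a b i] bump_out[of a b a] by auto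
    qed
  qed
  finally show ?thesis by (simp add: dab)
qed

lemma periodic_height_unroll:
  assumes M: "0 < M" and supp: "\<And>d. f d \<noteq> 0 \<Longrightarrow> d \<in> reduce M ` arcs_in z (z + M)" and i: "i \<in> {z..z + M}"
  shows "periodic_height M f i = height z (z + M) (unroll M z f) i"
proof -
  have "periodic_height M f i = (\<Sum>d\<in>reduce M ` arcs_in z (z + M). f d * periodic_bump M d i)"
    unfolding periodic_height_def
  proof (intro sum.mono_neutral_right finite_periodic_arcs ballI)
    show "reduce M ` arcs_in z (z + M) \<subseteq> periodic_arcs M" using reduce_in[OF M] by blast
    fix d assume "d \<in> periodic_arcs M - reduce M ` arcs_in z (z + M)"
    then have "f d = 0" using supp[of d] by blast
    then show "f d * periodic_bump M d i = 0" by simp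
  qed
  also have "\<dots> = (\<Sum>d\<in>arcs_in z (z + M). f (reduce M d) * periodic_bump M (reduce M d) i)"
    by (rule sum.reindex[OF inj_on_reduce[OF M], unfolded o_def])
  also have "\<dots> = height z (z + M) (unroll M z f) i"
    unfolding height_def by (intro sum.cong) (auto simp: unroll_def periodic_bump_reduce[OF M _ i])
  finally show ?thesis .
qed

lemma supp_unroll:
  assumes M: "0 < M" and f: "periodic_lamination M f" and z: "periodic_height M f z = 0" and d: "f d \<noteq> 0"
  shows "d \<in> reduce M ` arcs_in z (z + M)"
proof -
  obtain a b where dab: "d = (a, b)" by force
  have rep: "d \<in> periodic_arcs M" using periodic_laminationD(2)[OF f d] .
  then have ab: "0 \<le> a" "a < M" "a + 2 \<le> b" "b \<le> a + M" by (auto simp: dab periodic_arcs_def)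
  define z' where "z' = a + (z - a) mod M"
  have z': "a \<le> z'" "z' < a + M" using M by (auto simp: z'_def)
  define k where "k = (z - a) div M"
  have k: "z = z' + k * M" unfolding z'_def k_def by (simp add: algebra_simps)
  have "bump a b z' = 0" using z d unfolding periodic_height_zero_iff[OF f] periodic_bump_def z'_def dab by auto
  then have "z' = a \<or> b \<le> z'" using bump_pos_iff[of a b z'] ab z' by auto
  then obtain j where "shift_arc M j d \<in> arcs_in z (z + M)"
  proof
    assume "z' = a"
    then show thesis using k ab by (intro that[of k]) (auto simp: dab shift_arc_def arcs_in_iff)
  next
    assume "b \<le> z'"
    then show thesis using k ab z' by (intro that[of "k + 1"]) (auto simp: dab shift_arc_def arcs_in_iff algebra_simps)
  qed
  then show ?thesis using reduce_shift[OF M, of j d] reduce_rep[OF rep] by (metis imageI)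
qed

text \<open>
  No arc passes over an endpoint of a longest arc, since it would have to pass over the whole of it.
  Thus the heights of a lamination have minimum zero, which fixes the additive constant.
\<close>

lemma periodic_height_has_zero:
  assumes f: "periodic_lamination M f"
  obtains z where "periodic_height M f z = 0"
proof (cases "\<exists>d. f d \<noteq> 0")
  case False
  then show thesis using periodic_height_zero_iff[OF f] that by blast
next
  case True
  have fin: "finite {d. f d \<noteq> 0}"
    using periodic_laminationD(2)[OF f] finite_periodic_arcs by (metis (mono_tags) finite_subset mem_Collect_eq subsetI)
  define L where "L = (\<lambda>d::int\<times>int. snd d - fst d)"
  have ne: "L ` {d. f d \<noteq> 0} \<noteq> {}" using True by auto
  have "Max (L ` {d. f d \<noteq> 0}) \<in> L ` {d. f d \<noteq> 0}" using fin ne by (intro Max_in) auto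
  then obtain d where d: "f d \<noteq> 0" "L d = Max (L ` {d. f d \<noteq> 0})" by auto
  have max: "L e \<le> L d" if "f e \<noteq> 0" for e using fin that unfolding d(2) by (intro Max_ge) auto
  have "periodic_bump M e (fst d) = 0" if e: "f e \<noteq> 0" for e
  proof (rule ccontr)
    assume nz: "periodic_bump M e (fst d) \<noteq> 0"
    define a' where "a' = fst e + (fst d - fst e) mod M"
    have lt: "fst e < snd e" using periodic_laminationD(2)[OF f e] by (auto simp: periodic_arcs_def)
    have "bump (fst e) (snd e) a' \<noteq> 0" using nz by (simp add: periodic_bump_def a'_def)
    then have a': "fst e < a'" "a' < snd e"
      using bump_pos_iff[OF lt, of a'] bump_nonneg[of "fst e" "snd e" a'] by auto
    define k where "k = - ((fst d - fst e) div M)"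
    have k: "a' = fst d + k * M"
      using minus_div_mult_eq_mod[of "fst d - fst e" M] unfolding a'_def k_def by simp
    have "\<not> crosses e (shift_arc M k d)" using periodic_laminationD(3)[OF f e d(1)] .
    then have "snd d + k * M \<le> snd e" using a' k by (auto simp: crosses_def shift_arc_def)
    then show False using max[OF e] a' k by (simp add: L_def)
  qed
  then show thesis using periodic_height_zero_iff[OF f] that by blast
qed

lemma mod_window:
  fixes z i M :: int assumes "0 < M"
  shows "z + (i - z) mod M \<in> {z..<z + M}" "(z + (i - z) mod M) mod M = i mod M"
proof -
  show "z + (i - z) mod M \<in> {z..<z + M}" using assms by simp
  show "(z + (i - z) mod M) mod M = i mod M" by (simp add: mod_add_right_eq)
qed

text \<open>
  Cut open at a point where the heights are minimal.
\<close>

lemma periodic_lamination_exists: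
  assumes M: "0 < M" and h: "\<And>i j. i mod M = j mod M \<Longrightarrow> h i = h j"
  obtains f \<mu> where "periodic_lamination M f" "\<And>i. h i = periodic_height M f i + \<mu>"
proof -
  have win: "\<exists>j\<in>{0..<M}. h j = h i" for i using M h[of "i mod M" i] by (intro bexI[of _ "i mod M"]) auto
  have "Min (h ` {0..<M}) \<in> h ` {0..<M}" using M by (intro Min_in) auto
  then obtain z where z: "z \<in> {0..<M}" "h z = Min (h ` {0..<M})" by auto
  have min: "h z \<le> h i" for i using win[of i] unfolding z(2) by (metis Min_le finite_atLeastLessThan_int finite_imageI imageI)
  let ?g = "\<lambda>i. h i - h z"
  have "h (z + M) = h z" by (rule h) simp
  then have g: "?g z = 0" "?g (z + M) = 0" by auto
  have g0: "0 \<le> ?g i" for i using min[of i] by simp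
  obtain w where w: "lamination z (z + M) w" "\<And>i. i \<in> {z..z + M} \<Longrightarrow> ?g i = height z (z + M) w i"
    using lamination_exists[of ?g, OF g g0] by blast
  let ?A = "arcs_in z (z + M)"
  define f where "f = (\<lambda>d. if d \<in> reduce M ` ?A then w (inv_into ?A (reduce M) d) else 0)"
  have fr: "f (reduce M d) = w d" if "d \<in> ?A" for d
    using that inj_on_reduce[OF M] by (simp add: f_def)
  have supp: "d \<in> reduce M ` ?A" if "f d \<noteq> 0" for d using that by (auto simp: f_def split: if_splits)
  have unr: "unroll M z f = w"
  proof
    fix d show "unroll M z f d = w d"
      using fr laminationD(2)[OF w(1), of d] by (auto simp: unroll_def)
  qed
  have lam: "periodic_lamination M f"
    unfolding periodic_lamination_def
  proof (intro conjI allI impI)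
    show "0 \<le> f d" for d using laminationD(1)[OF w(1)] by (simp add: f_def)
    show "{d. f d \<noteq> 0} \<subseteq> periodic_arcs M" using supp reduce_in[OF M] by blast
    fix d e k assume nz: "f d \<noteq> 0" "f e \<noteq> 0"
    have lift: "\<exists>d'\<in>?A. d = reduce M d' \<and> w d' \<noteq> 0" if "f d \<noteq> 0" for d
    proof -
      obtain d' where d': "d = reduce M d'" "d' \<in> ?A" using supp[OF \<open>f d \<noteq> 0\<close>] by (rule imageE)
      then show ?thesis using fr[OF d'(2)] \<open>f d \<noteq> 0\<close> by auto
    qed
    obtain d' where d': "d' \<in> ?A" "d = reduce M d'" "w d' \<noteq> 0" using lift[OF nz(1)] by blast
    obtain e' where e': "e' \<in> ?A" "e = reduce M e'" "w e' \<noteq> 0" using lift[OF nz(2)] by blast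
    show "\<not> crosses d (shift_arc M k e)"
    proof
      assume "crosses d (shift_arc M k e)"
      then have "crosses (shift_arc M (fst d' div M) (reduce M d')) (shift_arc M (fst d' div M) (shift_arc M k (reduce M e')))"
        using d' e' by (simp add: crosses_shift)
      then have "crosses d' (shift_arc M (fst d' div M) (shift_arc M k (reduce M e')))" by (simp only: shift_reduce)
      moreover obtain j where "shift_arc M (fst d' div M) (shift_arc M k (reduce M e')) = shift_arc M j e'"
        unfolding reduce_def shift_shift by blast
      ultimately have cr: "crosses d' (shift_arc M j e')" by simp
      \<comment> \<open>A nontrivial translate of the window meets the window at most in an endpoint.\<close>
      consider "j = 0" | "1 \<le> j" | "j \<le> -1" by linarith
      then show False
      proof cases
        case 1
        then show False using cr laminationD(3)[OF w(1) d'(3) e'(3)] by simp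
      next
        case 2
        then have "M \<le> j * M" using M by simp
        moreover have "snd d' \<le> z + M" "z \<le> fst e'" using d'(1) e'(1) by (auto simp: arcs_in_def)
        ultimately have "snd d' \<le> fst e' + j * M" by linarith
        then show False using cr e'(1) unfolding crosses_def shift_arc_def fst_conv snd_conv
          by (auto simp: arcs_in_def)
      next
        case 3
        then have "j * M \<le> -1 * M" using M by (intro mult_right_mono) auto
        moreover have "snd e' \<le> z + M" "z \<le> fst d'" using d'(1) e'(1) by (auto simp: arcs_in_def)
        ultimately have "snd e' + j * M \<le> fst d'" by linarith
        then show False using cr e'(1) unfolding crosses_def shift_arc_def fst_conv snd_conv
          by (auto simp: arcs_in_def)
      qed
    qed
  qed
  have "h i = periodic_height M f i + h z" for i
  proof -
    let ?j = "z + (i - z) mod M"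
    have j: "?j \<in> {z..z + M}" "?j mod M = i mod M" using mod_window[OF M, of z i] by auto
    have "periodic_height M f ?j = ?g ?j"
      using periodic_height_unroll[OF M supp j(1)] w(2)[OF j(1)] by (simp add: unr)
    then show ?thesis using periodic_height_cong[OF j(2)] h[OF j(2)] by simp
  qed
  then show thesis using that lam by blast
qed

lemma periodic_lamination_unique:
  assumes M: "0 < M" and f: "periodic_lamination M f" and g: "periodic_lamination M g"
    and eq: "\<And>i. periodic_height M f i = periodic_height M g i + c"
  shows "f = g"
proof -
  obtain x where x: "periodic_height M f x = 0" using periodic_height_has_zero[OF f] .
  obtain y where y: "periodic_height M g y = 0" using periodic_height_has_zero[OF g] .
  have c: "c = 0" using eq[of x] eq[of y] x y periodic_height_nonneg[OF f, of y] periodic_height_nonneg[OF g, of x] by linarith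
  then have x': "periodic_height M g x = 0" using eq[of x] x by simp
  have un: "unroll M x f = unroll M x g"
  proof (rule lamination_unique[OF lamination_unroll[OF f] lamination_unroll[OF g]])
    fix i assume i: "i \<in> {x..x + M}"
    show "height x (x + M) (unroll M x f) i = height x (x + M) (unroll M x g) i"
      using periodic_height_unroll[OF M supp_unroll[OF M f x] i] periodic_height_unroll[OF M supp_unroll[OF M g x'] i] eq[of i] c by simp
  qed
  show ?thesis
  proof
    fix d
    show "f d = g d"
    proof (cases "d \<in> reduce M ` arcs_in x (x + M)")
      case True
      then obtain d' where d': "d' \<in> arcs_in x (x + M)" "d = reduce M d'" by blast
      show ?thesis using fun_cong[OF un, of d'] d' by (simp add: unroll_def)
    next
      case False
      then have "f d = 0" "g d = 0" using supp_unroll[OF M f x] supp_unroll[OF M g x'] by blast+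
      then show ?thesis by simp
    qed
  qed
qed

lemma periodic_lamination_exposed:
  assumes M: "0 < M" and f: "periodic_lamination M f" and d: "f (a, b) \<noteq> 0"
  obtains k where "exposed UNIV (periodic_height M f) (a + k * M) (b + k * M)"
proof -
  obtain z where z: "periodic_height M f z = 0" using periodic_height_has_zero[OF f] .
  obtain d' where d': "d' \<in> arcs_in z (z + M)" "(a, b) = reduce M d'" using supp_unroll[OF M f z d] by blast
  define k where "k = fst d' div M"
  have d'k: "d' = (a + k * M, b + k * M)"
    using shift_reduce[of M d'] unfolding d'(2)[symmetric] by (simp add: shift_arc_def k_def)
  let ?w = "unroll M z f"
  have w: "lamination z (z + M) ?w" by (rule lamination_unroll[OF f])
  have nz: "?w (a + k * M, b + k * M) \<noteq> 0" using d' d unfolding d'k[symmetric] by (simp add: unroll_def)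
  have hw: "periodic_height M f i = height z (z + M) ?w i" if "i \<in> {z..z + M}" for i
    by (rule periodic_height_unroll[OF M supp_unroll[OF M f z] that])
  obtain l where l: "quadratic l" "l (a + k * M) = height z (z + M) ?w (a + k * M)" "l (b + k * M) = height z (z + M) ?w (b + k * M)"
    "\<And>i. i \<in> {z..z + M} \<Longrightarrow> i \<noteq> a + k * M \<Longrightarrow> i \<noteq> b + k * M \<Longrightarrow> l i < height z (z + M) ?w i"
    "\<And>i. i \<notin> {z..z + M} \<Longrightarrow> l i < 0"
    using lamination_exposed[OF w nz] by metis
  have in_w: "a + k * M \<in> {z..z + M}" "b + k * M \<in> {z..z + M}" "a + k * M < b + k * M"
    using d'(1) by (auto simp: d'k arcs_in_iff)
  have "exposed UNIV (periodic_height M f) (a + k * M) (b + k * M)"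
  proof (rule exposedI[OF l(1)])
    fix i assume i: "i \<noteq> a + k * M" "i \<noteq> b + k * M"
    show "l i < periodic_height M f i"
    proof (cases "i \<in> {z..z + M}")
      case True then show ?thesis using l(4)[OF True i] hw by simp
    next
      case False then show ?thesis using l(5)[OF False] periodic_height_nonneg[OF f, of i] by linarith
    qed
  qed (use l hw in_w in auto)
  then show thesis by (rule that)
qed

lemma exposed_shift:
  assumes h: "\<And>i j. i mod M = j mod M \<Longrightarrow> h i = h j" and ex: "exposed UNIV h a b"
  shows "exposed UNIV h (a + k * M) (b + k * M)"
proof -
  obtain l where l: "quadratic l" "\<And>i. i \<in> UNIV \<Longrightarrow> i \<noteq> a \<Longrightarrow> i \<noteq> b \<Longrightarrow> l i < h i" "l a = h a" "l b = h b" "a < b"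
    using exposedD[OF ex] by metis
  have per: "h (i + k * M) = h i" for i by (rule h) simp
  show ?thesis
  proof (rule exposedI[OF quad_shift[OF l(1), of "- (k * M)"]])
    fix i assume "i \<noteq> a + k * M" "i \<noteq> b + k * M"
    then show "l (i + - (k * M)) < h i" using l(2)[of "i + - (k * M)"] per[of "i + - (k * M)"] by auto
  qed (use l per in auto)
qed

lemma quad_periodic_concave:
  assumes l: "\<And>i. l i = A + B * real_of_int i + C * (real_of_int i)\<^sup>2" and M: "0 < M"
    and "l (a - M) \<le> l a" "l (a + M) \<le> l a"
  shows "C \<le> 0"
proof -
  have "l (a - M) + l (a + M) - 2 * l a = 2 * C * (real_of_int M)\<^sup>2"
    unfolding l by (simp add: algebra_simps power2_eq_square)
  then have "C * (real_of_int M)\<^sup>2 \<le> 0" using assms(3,4) by linarith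
  moreover have "0 < (real_of_int M)\<^sup>2" using M by simp
  ultimately show ?thesis by (simp add: mult_le_0_iff)
qed

text \<open>
  A quadratic function below a periodic one is never strictly convex. Therefore the heights are positive over an
  exposed arc, the arc fits into a window between minimal points, and the result for
  intervals applies there.
\<close>

lemma exposed_periodic_lamination:
  assumes M: "0 < M" and f: "periodic_lamination M f" and ex: "exposed UNIV (periodic_height M f) a b" and ab: "a + 2 \<le> b"
  shows "f (reduce M (a, b)) \<noteq> 0"
proof -
  let ?h = "periodic_height M f"
  obtain z where z: "?h z = 0" using periodic_height_has_zero[OF f] .
  define k where "k = - ((a - z) div M)"
  define a' b' where "a' = a + k * M" and "b' = b + k * M"
  have a'z: "a' = z + (a - z) mod M"
    using minus_div_mult_eq_mod[of "a - z" M] unfolding a'_def k_def by simp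
  have a': "z \<le> a'" "a' < z + M" "a' + 2 \<le> b'" using pos_mod_sign[OF M, of "a - z"] pos_mod_bound[OF M, of "a - z"] a'z ab a'_def b'_def by linarith+
  have "exposed UNIV ?h a' b'" unfolding a'_def b'_def by (rule exposed_shift[OF periodic_height_cong ex])
  note ex' = this
  obtain l where l: "quadratic l" "\<And>i. i \<in> UNIV \<Longrightarrow> l i \<le> ?h i" "\<And>i. i \<in> UNIV \<Longrightarrow> i \<noteq> a' \<Longrightarrow> i \<noteq> b' \<Longrightarrow> l i < ?h i" "l a' = ?h a'" "l b' = ?h b'"
    using exposedD[OF ex'] by metis
  obtain A B C where L: "\<And>i. l i = A + B * real_of_int i + C * (real_of_int i)\<^sup>2"
    using l(1) unfolding quadratic_def by blast
  have per: "?h (i + M) = ?h i" "?h (i - M) = ?h i" for i by (rule periodic_height_cong, simp)+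
  have C: "C \<le> 0"
    by (rule quad_periodic_concave[OF L M, of a']) (use l(2)[of "a' - M"] l(2)[of "a' + M"] per l(4) in auto)
  have ends: "0 \<le> l a'" "0 \<le> l b'" using l periodic_height_nonneg[OF f] by auto
  have pos: "0 < ?h j" if "a' < j" "j < b'" for j
    using quad_concave[OF L C that] ends l(3)[of j] that by force
  have "b' \<le> z + M"
  proof (rule ccontr)
    assume "\<not> b' \<le> z + M"
    then have "0 < ?h (z + M)" using a' by (intro pos) auto
    then show False using per z by simp
  qed
  then have arc: "(a', b') \<in> arcs_in z (z + M)" using a' by (simp add: arcs_in_iff)
  have hw: "?h i = height z (z + M) (unroll M z f) i" if "i \<in> {z..z + M}" for i
    by (rule periodic_height_unroll[OF M supp_unroll[OF M f z] that])
  have in_w: "a' \<in> {z..z + M}" "b' \<in> {z..z + M}" using arc by (auto simp: arcs_in_iff)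
  have "exposed {z..z + M} ?h a' b'" by (rule exposed_subset[OF ex' subset_UNIV in_w])
  then have "exposed {z..z + M} (height z (z + M) (unroll M z f)) a' b'"
    by (subst exposed_cong[where h' = ?h]) (simp_all add: hw)
  moreover have "0 < height z (z + M) (unroll M z f) j" if "a' < j" "j < b'" for j
    using pos[OF that] hw[of j] that in_w by auto
  ultimately have "unroll M z f (a', b') \<noteq> 0"
    by (rule exposed_lamination[OF lamination_unroll[OF f] arc])
  then have "f (reduce M (a', b')) \<noteq> 0" using arc by (simp add: unroll_def)
  moreover have "reduce M (a', b') = reduce M (a, b)"
    using reduce_shift[OF M, of k "(a, b)"] by (simp add: shift_arc_def a'_def b'_def)
  ultimately show ?thesis by simp
qed

text \<open>
  Makes exposedness over all integers a condition at finitely many of them: the increments of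
  \<open>l\<close> over one period decrease, so \<open>l\<close> is largest within one period of the arc, where it is
  compared with the same values of \<open>h\<close>.
\<close>

lemma window_dominates:
  assumes M: "0 < M" and h: "\<And>i j. i mod M = j mod M \<Longrightarrow> h i = h j" and l: "quadratic l" and ab: "a < b"
    and le: "\<And>i. i \<in> {a - M..b + M} \<Longrightarrow> l i \<le> h i" and at: "l a = h a" "l b = h b" and i: "i \<notin> {a..b}"
  obtains j where "j \<in> {a - M..b + M}" "j \<notin> {a..b}" "h j = h i" "l i \<le> l j"
proof -
  obtain A B C where L: "\<And>i. l i = A + B * real_of_int i + C * (real_of_int i)\<^sup>2"
    using l unfolding quadratic_def by blast
  have per: "h (i + M) = h i" "h (i - M) = h i" for i by (rule h, simp)+
  have b: "l (b - M) \<le> l b" "l (b + M) \<le> l b" using le[of "b - M"] le[of "b + M"] per[of b] at ab M by auto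
  have a: "l (a - M) \<le> l a" using le[of "a - M"] per[of a] at ab M by auto
  have C: "C \<le> 0" by (rule quad_periodic_concave[OF L M b])
  have step: "(l (x + M) - l x) - (l (y + M) - l y) = 2 * C * real_of_int M * real_of_int (x - y)" for x y
    unfolding L by (simp add: algebra_simps power2_eq_square)
  have dec: "l (x + M) \<le> l x" if "b \<le> x" for x
  proof -
    have "2 * C * real_of_int M * real_of_int (x - b) \<le> 0"
      using C M that by (simp add: mult_le_0_iff)
    then show ?thesis using step[of x b] b(2) by linarith
  qed
  have inc: "l x \<le> l (x + M)" if "x \<le> a - M" for x
  proof -
    have "0 \<le> 2 * C * real_of_int M * real_of_int (x - (a - M))"
      using C M that by (intro mult_nonpos_nonpos) (auto simp: mult_le_0_iff)
    then show ?thesis using step[of x "a - M"] a by simp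
  qed
  have right: "l (x + int n * M) \<le> l x" if "b \<le> x" for x n
  proof (induction n)
    case (Suc n)
    have "b \<le> x + int n * M" using that M by (simp add: add_increasing2)
    from dec[OF this] Suc show ?case by (simp add: algebra_simps)
  qed simp
  have left: "l (x - int n * M) \<le> l x" if "x \<le> a" for x n
  proof (induction n)
    case (Suc n)
    have "x - int (Suc n) * M \<le> a - M" using that M by (simp add: algebra_simps add_increasing2)
    from inc[OF this] Suc show ?case by (simp add: algebra_simps)
  qed simp
  show thesis
  proof (cases "b < i")
    case True
    define j where "j = b + 1 + (i - (b + 1)) mod M"
    define n where "n = nat ((i - (b + 1)) div M)"
    have "0 \<le> (i - (b + 1)) div M" using True M by (simp add: pos_imp_zdiv_nonneg_iff)
    then have n: "i = j + int n * M" unfolding j_def n_def by (simp add: algebra_simps)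
    have j: "b < j" "j \<le> b + M" using pos_mod_sign[OF M, of "i - (b + 1)"] pos_mod_bound[OF M, of "i - (b + 1)"] unfolding j_def by linarith+
    have "h j = h i" unfolding n by (rule h) simp
    then show thesis using that[of j] j right[of j n] n ab M by auto
  next
    case False
    then have ia: "i < a" using i by auto
    define j where "j = a - 1 - (a - 1 - i) mod M"
    define n where "n = nat ((a - 1 - i) div M)"
    have "0 \<le> (a - 1 - i) div M" using ia M by (simp add: pos_imp_zdiv_nonneg_iff)
    then have n: "i = j - int n * M" unfolding j_def n_def
      using minus_div_mult_eq_mod[of "a - 1 - i" M] by simp
    have j: "j < a" "a - M \<le> j" using pos_mod_sign[OF M, of "a - 1 - i"] pos_mod_bound[OF M, of "a - 1 - i"] unfolding j_def by linarith+
    have "h (j - int n * M) = h j" by (rule h) (simp add: mod_diff_eq[symmetric])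
    then show thesis using that[of j] j left[of j n] n ab M by auto
  qed
qed

lemma exposed_window:
  assumes M: "0 < M" and h: "\<And>i j. i mod M = j mod M \<Longrightarrow> h i = h j" and ex: "exposed {a - M..b + M} h a b"
  shows "exposed UNIV h a b"
proof -
  obtain l where l: "quadratic l" "\<And>i. i \<in> {a - M..b + M} \<Longrightarrow> l i \<le> h i"
    "\<And>i. i \<in> {a - M..b + M} \<Longrightarrow> i \<noteq> a \<Longrightarrow> i \<noteq> b \<Longrightarrow> l i < h i" "l a = h a" "l b = h b" "a < b"
    using exposedD[OF ex] by metis
  show ?thesis
  proof (rule exposedI[OF l(1)])
    fix i assume i: "i \<noteq> a" "i \<noteq> b"
    show "l i < h i"
    proof (cases "i \<in> {a..b}")
      case True then show ?thesis using l(3)[of i] i M by auto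
    next
      case False
      obtain j where "j \<in> {a - M..b + M}" "j \<notin> {a..b}" "h j = h i" "l i \<le> l j"
        by (rule window_dominates[OF M h l(1,6,2,4,5) False])
      moreover from this have "j \<noteq> a" "j \<noteq> b" using l(6) by auto
      ultimately show ?thesis using l(3)[of j] by linarith
    qed
  qed (use l in auto)
qed

lemma touches_window:
  assumes M: "0 < M" and h: "\<And>i j. i mod M = j mod M \<Longrightarrow> h i = h j" and ab: "a < b" and t: "touches {a - M..b + M} h a b"
  shows "touches UNIV h a b"
proof -
  obtain l where l: "quadratic l" "\<And>i. i \<in> {a - M..b + M} \<Longrightarrow> l i \<le> h i" "l a = h a" "l b = h b"
    using t unfolding touches_def by blast
  have "l i \<le> h i" for i
  proof (cases "i \<in> {a..b}")
    case True then show ?thesis using l(2)[of i] M by auto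
  next
    case False
    obtain j where "j \<in> {a - M..b + M}" "j \<notin> {a..b}" "h j = h i" "l i \<le> l j"
      by (rule window_dominates[OF M h l(1) ab l(2,3,4) False])
    then show ?thesis using l(2)[of j] by linarith
  qed
  then show ?thesis using l unfolding touches_def by blast
qed

text \<open>
  The periodic analogue of \<open>red_contact_imp_red_chord\<close>. If a blue point separates two contacts, the gap around it is
  exposed. Otherwise the contacts are bounded, because blue points recur with the period.
\<close>

lemma red_contact_imp_exposed_periodic:
  assumes M: "0 < M" and h: "\<And>i j. i mod M = j mod M \<Longrightarrow> h i = h j" and l: "quadratic l" "\<And>i. l i \<le> h i"
    and red: "\<And>i. l i = h i \<Longrightarrow> i \<in> R" and ab: "a + 2 \<le> b" "l a = h a" "l b = h b"
    and per: "\<And>i j. i mod M = j mod M \<Longrightarrow> i \<in> R \<Longrightarrow> j \<in> R" and blue: "j0 \<notin> R"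
  shows "\<exists>c e. c + 2 \<le> e \<and> c \<in> R \<and> e \<in> R \<and> exposed UNIV h c e"
proof (cases "\<exists>x y j. x < j \<and> j < y \<and> l x = h x \<and> l y = h y \<and> j \<notin> R")
  case True
  then obtain x y j where x: "x < j" "j < y" "l x = h x" "l y = h y" "j \<notin> R" by blast
  have "l j \<noteq> h j" using red[of j] x(5) by blast
  then have lj: "l j < h j" using l(2)[of j] by linarith
  obtain c e where ce: "c < j" "j < e" "l c = h c" "l e = h e" "c \<in> UNIV" "e \<in> UNIV"
    "\<And>i. c < i \<Longrightarrow> i < e \<Longrightarrow> l i < h i" "exposed UNIV h c e"
    using exposed_gap[OF l subset_UNIV x(1,2,3,4) lj] by metis
  have "c + 2 \<le> e" "c \<in> R" "e \<in> R" using ce(1,2) red[OF ce(3)] red[OF ce(4)] by auto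
  then show ?thesis using ce(8) by blast
next
  case False
  \<comment> \<open>All contacts lie within one red run around \<open>a\<close> and \<open>b\<close>, so the outermost ones are exposed.\<close>
  define j1 where "j1 = a - 1 - (a - 1 - j0) mod M"
  define j2 where "j2 = b + 1 + (j0 - (b + 1)) mod M"
  have "j1 mod M = j0 mod M" unfolding j1_def by (simp add: mod_diff_right_eq)
  then have j1: "j1 < a" "j1 \<notin> R" using pos_mod_sign[OF M, of "a - 1 - j0"] per[of j1 j0] blue unfolding j1_def by auto
  have "j2 mod M = j0 mod M" unfolding j2_def by (simp add: mod_add_right_eq)
  then have j2: "b < j2" "j2 \<notin> R" using pos_mod_sign[OF M, of "j0 - (b + 1)"] per[of j2 j0] blue unfolding j2_def by auto
  have within: "j1 < i \<and> i < j2" if i: "l i = h i" for i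
  proof -
    have "i \<noteq> j1" "i \<noteq> j2" using red[OF i] j1 j2 by auto
    moreover have "\<not> i < j1" using False i j1 ab by force
    moreover have "\<not> j2 < i" using False i j2 ab by force
    ultimately show ?thesis by linarith
  qed
  let ?I = "{j1 - M..j2 + M}"
  have fI: "finite ?I" by simp
  have inI: "a \<in> ?I" "b \<in> ?I" "a < b" using j1 j2 M ab by auto
  have lI: "\<And>i. i \<in> ?I \<Longrightarrow> l i \<le> h i" using l(2) by blast
  obtain c e where ce: "c \<le> a" "b \<le> e" "l c = h c" "l e = h e" "c \<in> ?I" "e \<in> ?I" "exposed ?I h c e"
    by (rule exposed_outer[OF l(1) lI fI inI ab(2,3)])
  have "exposed {c - M..e + M} h c e"
    using ce within[OF ce(3)] within[OF ce(4)] M ab by (intro exposed_subset[OF ce(7)]) auto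
  then have "exposed UNIV h c e" by (rule exposed_window[OF M, rotated]) (rule h)
  moreover have "c + 2 \<le> e" "c \<in> R" "e \<in> R" using ce ab red by auto
  ultimately show ?thesis by blast
qed

text \<open>
  Heights are prescribed on one period and extended periodically.
\<close>

definition red_arc :: "int \<Rightarrow> int set \<Rightarrow> (int \<Rightarrow> real) \<Rightarrow> bool" where
  "red_arc M R h \<longleftrightarrow> (\<exists>a b. a + 2 \<le> b \<and> a \<in> R \<and> b \<in> R \<and> exposed UNIV (\<lambda>i. h (i mod M)) a b)"

lemma cone_periodicD:
  assumes "f \<in> weight_cone (periodic_complex M R)"
  shows "periodic_lamination M f" "f (a, b) \<noteq> 0 \<Longrightarrow> a \<notin> R \<or> b \<notin> R"
proof -
  have nn: "\<And>d. 0 \<le> f d" and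
    S: "{d. f d \<noteq> 0} \<subseteq> periodic_arcs M" "\<forall>d\<in>{d. f d \<noteq> 0}. \<forall>e\<in>{d. f d \<noteq> 0}. \<forall>k. \<not> crosses d (shift_arc M k e)"
      "\<forall>(a, b)\<in>{d. f d \<noteq> 0}. a \<notin> R \<or> b \<notin> R"
    using assms unfolding weight_cone_def periodic_complex_def by auto
  then show "periodic_lamination M f" unfolding periodic_lamination_def by blast
  show "f (a, b) \<noteq> 0 \<Longrightarrow> a \<notin> R \<or> b \<notin> R" using S(3) by blast
qed

lemma cone_periodicI:
  assumes "periodic_lamination M f" "\<And>a b. f (a, b) \<noteq> 0 \<Longrightarrow> a \<notin> R \<or> b \<notin> R"
  shows "f \<in> weight_cone (periodic_complex M R)"
  using assms unfolding weight_cone_def periodic_complex_def periodic_lamination_def by blast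

text \<open>
  Trivial heights are the constants, so one blue and one red point are normalized.
\<close>

theorem periodic_complex_ball:
  assumes m: "2 \<le> m" and M: "M = int m"
    and per: "\<And>i j. i mod M = j mod M \<Longrightarrow> i \<in> R \<Longrightarrow> j \<in> R"
    and r: "r \<in> R" and blue: "j0 \<notin> R"
  shows "is_closed_ball (periodic_complex M R) (m - 2)"
proof -
  let ?K = "periodic_complex M R"
  have M2: "2 \<le> M" and M0: "0 < M" using m M by auto
  define u where "u = (\<lambda>i. if i \<in> R then 1 else 0 :: real)"
  define k1 x where "k1 = j0 mod M" and "x = r mod M"
  have k1: "k1 \<in> {0..<M}" "k1 \<notin> R" using M0 per[of k1 j0] blue by (auto simp: k1_def)
  have x: "x \<in> {0..<M}" "x \<in> R" using M0 per[of r x] r by (auto simp: x_def)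
  have xk: "x \<noteq> k1" using x k1 by auto
  have umod: "u (i mod M) = u i" for i
    using per[of i "i mod M"] per[of "i mod M" i] by (auto simp: u_def)
  have Rmod: "(i + k * M \<in> R) = (i \<in> R)" for i k
    using per[of "i + k * M" i] per[of i "i + k * M"] by auto
  have extcong: "i mod M = j mod M \<Longrightarrow> h (i mod M) = h (j mod M)" for h :: "int \<Rightarrow> real" and i j by simp
  have inV: "i mod M \<in> {0..<M}" for i using M0 by simp
  have pmod: "(\<lambda>i. periodic_height M f (i mod M)) = periodic_height M f" for f by (rule ext) (rule periodic_height_cong, simp)
  show ?thesis
  proof (rule ball_from_heights[where V = "{0..<M}" and Z = "{k1}" and ?k0.0 = x and u = u and e = "\<lambda>_ _. 1"
        and H = "periodic_height M" and N = "red_arc M R", OF finite_complex_periodic])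
    show "finite {0..<M}" "{k1} \<subseteq> {0..<M}" "x \<in> {0..<M}" "x \<notin> {k1}" using k1 x xk by auto
    have "{0..<M} - {k1} - {x} = {0..<M} - {k1, x}" by auto
    moreover have "card ({0..<M} - {k1, x}) = card {0..<M} - card {k1, x}"
      using k1 x by (intro card_Diff_subset) auto
    ultimately show "card ({0..<M} - {k1} - {x}) = m - 2" using M xk by simp
    show "continuous_on UNIV (\<lambda>f. periodic_height M f i)" for i
      unfolding periodic_height_def
      by (intro continuous_on_sum continuous_on_mult continuous_on_coordinate continuous_on_const)
    show "periodic_height M (\<lambda>v. c * f v) i = c * periodic_height M f i" for c f i
      by (simp add: periodic_height_def sum_distrib_left mult.assoc)
    show "1 = (if j = k then 1 else 0 :: real)" if "k \<in> {k1}" "j \<in> {k1}" for k j using that by simp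
    show "u x \<noteq> (\<Sum>k\<in>{k1}. u k * 1)" using x k1 by (simp add: u_def)
    show "red_arc M R h \<longleftrightarrow> red_arc M R h'" if "\<And>i. i \<in> {0..<M} \<Longrightarrow> h i = h' i" for h h'
    proof -
      have "(\<lambda>i. h (i mod M)) = (\<lambda>i. h' (i mod M))" using that[OF inV] by (rule ext)
      then show ?thesis unfolding red_arc_def by simp
    qed
    show "red_arc M R (\<lambda>i. h i + (\<Sum>k\<in>{k1}. c k * 1)) \<longleftrightarrow> red_arc M R h" for h c
      unfolding red_arc_def exposed_add_quad[OF quad_const] ..
    show "\<not> red_arc M R (periodic_height M f)" if f: "f \<in> weight_cone ?K" for f
    proof
      assume "red_arc M R (periodic_height M f)"
      then obtain a b where ab: "a + 2 \<le> b" "a \<in> R" "b \<in> R" "exposed UNIV (periodic_height M f) a b"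
        unfolding red_arc_def pmod by blast
      have "f (reduce M (a, b)) \<noteq> 0" by (rule exposed_periodic_lamination[OF M0 cone_periodicD(1)[OF f] ab(4,1)])
      moreover have "reduce M (a, b) = (a + - (a div M) * M, b + - (a div M) * M)"
        by (simp add: reduce_def shift_arc_def)
      ultimately have "f (a + - (a div M) * M, b + - (a div M) * M) \<noteq> 0" by simp
      then show False using cone_periodicD(2)[OF f] Rmod ab by blast
    qed
    show "\<exists>f\<in>weight_cone ?K. \<exists>c. \<forall>i\<in>{0..<M}. h i = periodic_height M f i + (\<Sum>k\<in>{k1}. c k * 1)"
      if h: "\<not> red_arc M R h" for h
    proof -
      obtain f \<mu> where f: "periodic_lamination M f" "\<And>i. h (i mod M) = periodic_height M f i + \<mu>"
        using periodic_lamination_exists[of M "\<lambda>i. h (i mod M)", OF M0 extcong] by metis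
      have "a \<notin> R \<or> b \<notin> R" if ab: "f (a, b) \<noteq> 0" for a b
      proof (rule ccontr)
        assume R: "\<not> ?thesis"
        obtain k where k: "exposed UNIV (periodic_height M f) (a + k * M) (b + k * M)"
          by (rule periodic_lamination_exposed[OF M0 f(1) ab])
        have "exposed UNIV (\<lambda>i. h (i mod M)) (a + k * M) (b + k * M)"
          unfolding f(2) by (rule iffD2[OF exposed_add_quad[OF quad_const] k])
        moreover have "a + k * M + 2 \<le> b + k * M" using periodic_laminationD(2)[OF f(1) ab] by (auto simp: periodic_arcs_def)
        ultimately show False using h R Rmod unfolding red_arc_def by blast
      qed
      then have "f \<in> weight_cone ?K" by (rule cone_periodicI[OF f(1)])
      moreover have "\<forall>i\<in>{0..<M}. h i = periodic_height M f i + (\<Sum>k\<in>{k1}. \<mu> * 1)"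
      proof
        fix i assume "i \<in> {0..<M}"
        then show "h i = periodic_height M f i + (\<Sum>k\<in>{k1}. \<mu> * 1)" using f(2)[of i] by simp
      qed
      ultimately show ?thesis by (intro bexI[of _ f] exI[of _ "\<lambda>_. \<mu>"])
    qed
    show "f = g" if f: "f \<in> weight_cone ?K" and g: "g \<in> weight_cone ?K" and
      eq: "\<And>i. i \<in> {0..<M} \<Longrightarrow> periodic_height M f i = periodic_height M g i + (\<Sum>k\<in>{k1}. c k * 1)" for f g c
    proof (rule periodic_lamination_unique[OF M0 cone_periodicD(1)[OF f] cone_periodicD(1)[OF g]])
      fix i
      have "periodic_height M f (i mod M) = periodic_height M g (i mod M) + c k1" using eq[OF inV] by simp
      then show "periodic_height M f i = periodic_height M g i + c k1"
        using periodic_height_cong[of "i mod M" M i] by simp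
    qed
    show "\<exists>\<delta>>0. \<forall>h'. (\<forall>i\<in>{0..<M}. \<bar>h' i - h i\<bar> < \<delta>) \<longrightarrow> red_arc M R h'" if h: "red_arc M R h" for h
    proof -
      obtain a b where ab: "a + 2 \<le> b" "a \<in> R" "b \<in> R" "exposed UNIV (\<lambda>i. h (i mod M)) a b"
        using h unfolding red_arc_def by blast
      have "finite {a - M..b + M}" by simp
      moreover have "exposed {a - M..b + M} (\<lambda>i. h (i mod M)) a b"
        using ab M0 by (intro exposed_subset[OF ab(4)]) auto
      ultimately obtain \<delta> where \<delta>: "\<delta> > 0"
        "\<And>h'. (\<forall>i\<in>{a - M..b + M}. \<bar>h' i - h (i mod M)\<bar> < \<delta>) \<Longrightarrow> exposed {a - M..b + M} h' a b"
        using exposed_open by metis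
      show ?thesis
      proof (intro exI[of _ \<delta>] conjI allI impI)
        fix h' assume "\<forall>i\<in>{0..<M}. \<bar>h' i - h i\<bar> < \<delta>"
        then have "\<forall>i\<in>{a - M..b + M}. \<bar>h' (i mod M) - h (i mod M)\<bar> < \<delta>" using inV by blast
        then have "exposed {a - M..b + M} (\<lambda>i. h' (i mod M)) a b" by (rule \<delta>(2))
        then have "exposed UNIV (\<lambda>i. h' (i mod M)) a b" by (rule exposed_window[OF M0, rotated]) simp
        then show "red_arc M R h'" using ab unfolding red_arc_def by blast
      qed (rule \<delta>(1))
    qed
    show "\<exists>\<delta>>0. \<forall>h'. (\<forall>i\<in>{0..<M}. \<bar>h' i - (h i + t * u i)\<bar> < \<delta>) \<longrightarrow> \<not> red_arc M R h'"
      if h: "\<not> red_arc M R h" and t: "0 < t" for h t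
    proof -
      let ?h = "\<lambda>i. h (i mod M) + t * u (i mod M)"
      define A where "A = {d \<in> periodic_arcs M. fst d \<in> R \<and> snd d \<in> R}"
      have finA: "finite A" unfolding A_def using finite_periodic_arcs by simp
      have "\<forall>d\<in>A. \<exists>\<delta>>0. \<forall>h'. (\<forall>i\<in>{fst d - M..snd d + M}. \<bar>h' i - ?h i\<bar> < \<delta>)
          \<longrightarrow> \<not> exposed {fst d - M..snd d + M} h' (fst d) (snd d)"
      proof
        fix d assume d: "d \<in> A"
        obtain a b where dab: "d = (a, b)" by force
        have ab: "a + 2 \<le> b" "a \<in> R" "b \<in> R" using d by (auto simp: A_def dab periodic_arcs_def)
        then have lt: "a < b" by simp
        have "\<not> touches {a - M..b + M} ?h a b"
        proof
          assume "touches {a - M..b + M} ?h a b"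
          then have "touches UNIV ?h a b" by (rule touches_window[OF M0 _ lt, rotated]) simp
          then obtain l where l: "quadratic l" "\<And>i. l i \<le> ?h i" "l a = ?h a" "l b = ?h b"
            unfolding touches_def by blast
          have "\<exists>c e. c + 2 \<le> e \<and> c \<in> R \<and> e \<in> R \<and> exposed UNIV (\<lambda>i. h (i mod M)) c e"
          proof (rule red_contact_imp_exposed_periodic[OF M0 extcong _ _ _ ab(1) _ _ per blue])
            show "quadratic (\<lambda>i. l i - t)" by (intro quad_diff l quad_const)
            have ut: "t * u i \<le> t" "i \<notin> R \<Longrightarrow> t * u i < t" for i using t by (auto simp: u_def)
            show "l i - t \<le> h (i mod M)" for i using l(2)[of i] ut(1)[of i] unfolding umod by linarith
            show "i \<in> R" if "l i - t = h (i mod M)" for i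
              using l(2)[of i] ut(2)[of i] that unfolding umod by linarith
            have "u a = 1" "u b = 1" using ab by (auto simp: u_def)
            then show "l a - t = h (a mod M)" "l b - t = h (b mod M)" using l(3,4) umod by simp_all
          qed
          then show False using h unfolding red_arc_def by blast
        qed
        from not_touches_open[OF finite_atLeastAtMost_int lt this]
        show "\<exists>\<delta>>0. \<forall>h'. (\<forall>i\<in>{fst d - M..snd d + M}. \<bar>h' i - ?h i\<bar> < \<delta>)
          \<longrightarrow> \<not> exposed {fst d - M..snd d + M} h' (fst d) (snd d)" unfolding dab fst_conv snd_conv .
      qed
      then obtain \<delta> where \<delta>: "\<And>d. d \<in> A \<Longrightarrow> 0 < \<delta> d" "\<And>d h'. d \<in> A \<Longrightarrow>
          (\<forall>i\<in>{fst d - M..snd d + M}. \<bar>h' i - ?h i\<bar> < \<delta> d) \<Longrightarrow> \<not> exposed {fst d - M..snd d + M} h' (fst d) (snd d)"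
        by metis
      define \<epsilon> where "\<epsilon> = Min (insert 1 (\<delta> ` A))"
      have \<epsilon>: "\<epsilon> > 0" "\<And>d. d \<in> A \<Longrightarrow> \<epsilon> \<le> \<delta> d" using \<delta>(1) finA by (auto simp: \<epsilon>_def)
      show ?thesis
      proof (intro exI[of _ \<epsilon>] conjI allI impI notI)
        fix h' assume near: "\<forall>i\<in>{0..<M}. \<bar>h' i - (h i + t * u i)\<bar> < \<epsilon>" and "red_arc M R h'"
        then obtain a b where ab: "a + 2 \<le> b" "a \<in> R" "b \<in> R" "exposed UNIV (\<lambda>i. h' (i mod M)) a b"
          unfolding red_arc_def by blast
        define k where "k = - (a div M)"
        note sh = exposed_shift[where h = "\<lambda>i. h' (i mod M)", OF extcong ab(4)]
        have "\<not> crosses (a, b) (a + 1 * M, b + 1 * M)" by (rule exposed_not_crosses[OF ab(4) sh])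
        then have "b \<le> a + M" using M0 by (auto simp: crosses_def)
        moreover have "a + k * M = a mod M" using minus_div_mult_eq_mod[of a M] by (simp add: k_def)
        moreover have "0 \<le> a mod M" "a mod M < M" using M0 by simp_all
        moreover have "a + k * M \<in> R" "b + k * M \<in> R" using ab Rmod by blast+
        ultimately have dA: "(a + k * M, b + k * M) \<in> A"
          unfolding A_def periodic_arcs_def using ab(1) by simp
        have "\<bar>h' (i mod M) - ?h i\<bar> < \<delta> (a + k * M, b + k * M)" for i
          using near inV[of i] \<epsilon>(2)[OF dA] by force
        then have "\<not> exposed {a + k * M - M..b + k * M + M} (\<lambda>i. h' (i mod M)) (a + k * M) (b + k * M)"
          using \<delta>(2)[OF dA, of "\<lambda>i. h' (i mod M)"] by simp
        moreover have "exposed {a + k * M - M..b + k * M + M} (\<lambda>i. h' (i mod M)) (a + k * M) (b + k * M)"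
          using M0 ab by (intro exposed_subset[OF sh]) auto
        ultimately show False by blast
      qed (rule \<epsilon>(1))
    qed
    show "red_arc M R (\<lambda>i. - u i)"
      unfolding red_arc_def
    proof (rule red_contact_imp_exposed_periodic[OF M0 _ quad_const, of _ "-1" R r "r + M" j0])
      show "r + 2 \<le> r + M" using M2 by simp
      show "-1 \<le> - u (i mod M)" for i by (simp add: u_def)
      show "i \<in> R" if "-1 = - u (i mod M)" for i using that unfolding umod by (simp add: u_def split: if_splits)
      show "-1 = - u (r mod M)" unfolding umod using r by (simp add: u_def)
      show "-1 = - u ((r + M) mod M)" unfolding umod using r Rmod[of r 1] by (simp add: u_def)
      show "j \<in> R" if "i mod M = j mod M" "i \<in> R" for i j using per[OF that] .
    qed (use blue in auto)
  qed
qed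

section \<open>Convex polygons\<close>

lemma enumerate_strict_order:
  fixes lt :: "'a \<Rightarrow> 'a \<Rightarrow> bool"
  assumes W: "finite W"
    and trans: "\<And>a b c. a \<in> W \<Longrightarrow> b \<in> W \<Longrightarrow> c \<in> W \<Longrightarrow> lt a b \<Longrightarrow> lt b c \<Longrightarrow> lt a c"
    and irrefl: "\<And>a. a \<in> W \<Longrightarrow> \<not> lt a a"
    and total: "\<And>a b. a \<in> W \<Longrightarrow> b \<in> W \<Longrightarrow> a \<noteq> b \<Longrightarrow> lt a b \<or> lt b a"
  obtains w where "bij_betw w {0..<int (card W)} W"
    "\<And>i j. 0 \<le> i \<Longrightarrow> i < j \<Longrightarrow> j < int (card W) \<Longrightarrow> lt (w i) (w j)"
proof -
  define rk where "rk = (\<lambda>a. int (card {b\<in>W. lt b a}))"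
  have mono: "rk a < rk b" if "a \<in> W" "b \<in> W" "lt a b" for a b
  proof -
    have "{c\<in>W. lt c a} \<subset> {c\<in>W. lt c b}"
      using that trans irrefl by blast
    then show ?thesis using W by (simp add: rk_def psubset_card_mono)
  qed
  have inj: "inj_on rk W"
    by (rule inj_onI) (metis mono total less_irrefl)
  have "rk a < int (card W)" if "a \<in> W" for a
  proof -
    have "{b\<in>W. lt b a} \<subset> W" using that irrefl by blast
    then show ?thesis using W by (simp add: rk_def psubset_card_mono)
  qed
  then have sub: "rk ` W \<subseteq> {0..<int (card W)}" by (auto simp: rk_def)
  have "card (rk ` W) = card {0..<int (card W)}" using inj by (simp add: card_image)
  then have "rk ` W = {0..<int (card W)}" using sub by (intro card_subset_eq) auto
  then have bij: "bij_betw rk W {0..<int (card W)}" using inj by (simp add: bij_betw_def)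
  let ?w = "inv_into W rk"
  show thesis
  proof (rule that)
    show bw: "bij_betw ?w {0..<int (card W)} W" by (rule bij_betw_inv_into[OF bij])
    fix i j :: int assume ij: "0 \<le> i" "i < j" "j < int (card W)"
    have W': "?w i \<in> W" "?w j \<in> W" using bw ij by (auto simp: bij_betw_def)
    have rk: "rk (?w i) = i" "rk (?w j) = j" using bij ij by (auto intro!: bij_betw_inv_into_right)
    then have "\<not> lt (?w j) (?w i)" using mono[OF W'(2,1)] ij by auto
    moreover have "?w i \<noteq> ?w j" using rk ij by auto
    ultimately show "lt (?w i) (?w j)" using total W' by blast
  qed
qed

definition orient :: "complex \<Rightarrow> complex \<Rightarrow> complex \<Rightarrow> real" where
  "orient a b c = Re (b - a) * Im (c - a) - Im (b - a) * Re (c - a)"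

lemma orient_swap: "orient a c b = - orient a b c" by (simp add: orient_def algebra_simps)
lemma orient_rotate: "orient b c a = orient a b c" by (simp add: orient_def algebra_simps)
lemma orient_end [simp]: "orient a b a = 0" "orient a b b = 0" by (simp_all add: orient_def)

lemma orient_affine: "orient a b ((1 - t) *\<^sub>R c + t *\<^sub>R d) = (1 - t) * orient a b c + t * orient a b d"
  by (simp add: orient_def algebra_simps)

text \<open>
  Cramer's rule for three points and a fourth one in the plane.
\<close>

lemma orient_barycentric:
  "orient a b c *\<^sub>R x = orient x b c *\<^sub>R a + orient a x c *\<^sub>R b + orient a b x *\<^sub>R c"
  by (simp add: orient_def complex_eq_iff algebra_simps)

lemma orient_sum: "orient x b c + orient a x c + orient a b x = orient a b c"
  by (simp add: orient_def algebra_simps)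

lemma in_triangle:
  assumes "0 \<le> orient x b c" "0 \<le> orient a x c" "0 \<le> orient a b x" "0 < orient a b c"
  shows "x \<in> convex hull {a, b, c}"
proof -
  let ?D = "orient a b c"
  have "x = (orient x b c / ?D) *\<^sub>R a + (orient a x c / ?D) *\<^sub>R b + (orient a b x / ?D) *\<^sub>R c"
  proof -
    have "?D *\<^sub>R x = ?D *\<^sub>R ((orient x b c / ?D) *\<^sub>R a + (orient a x c / ?D) *\<^sub>R b + (orient a b x / ?D) *\<^sub>R c)"
      using assms(4) orient_barycentric[of a b c x] by (simp add: scaleR_add_right)
    then show ?thesis using assms(4) by simp
  qed
  moreover have "orient x b c / ?D + orient a x c / ?D + orient a b x / ?D = 1"
    using orient_sum[of x b c a] assms(4) by (simp add: add_divide_distrib[symmetric])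
  moreover have "0 \<le> orient x b c / ?D" "0 \<le> orient a x c / ?D" "0 \<le> orient a b x / ?D" using assms by auto
  ultimately show ?thesis unfolding convex_hull_3 by blast
qed

lemma orient_zero_segment:
  assumes "orient a b c = 0"
  shows "a \<in> closed_segment b c \<or> b \<in> closed_segment a c \<or> c \<in> closed_segment a b"
proof -
  have "collinear {a, b, c}"
  proof (cases "b = a")
    case True then show ?thesis by simp
  next
    case False
    let ?t = "((c - a) \<bullet> (b - a)) / ((b - a) \<bullet> (b - a))"
    have nz: "(Re (b - a))\<^sup>2 + (Im (b - a))\<^sup>2 \<noteq> 0"
      using False by (metis complex_eq_iff diff_eq_diff_eq diff_self minus_complex.simps sum_power2_eq_zero_iff zero_complex.sel)
    have z: "Re (b - a) * Im (c - a) = Im (b - a) * Re (c - a)" using assms by (simp add: orient_def)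
    have "c - a = ?t *\<^sub>R (b - a)"
    proof -
      let ?n = "(Re (b - a))\<^sup>2 + (Im (b - a))\<^sup>2"
      have ip: "(b - a) \<bullet> (b - a) = ?n" "(c - a) \<bullet> (b - a) = Re (c - a) * Re (b - a) + Im (c - a) * Im (b - a)"
        by (simp_all add: inner_complex_def power2_eq_square)
      have alg: "r * (p\<^sup>2 + q\<^sup>2) = (r * p + s * q) * p" "s * (p\<^sup>2 + q\<^sup>2) = (r * p + s * q) * q"
        if "p * s = q * r" for p q r s :: real using that by algebra+
      let ?i = "Re (c - a) * Re (b - a) + Im (c - a) * Im (b - a)"
      have "Re (c - a) = ?i / ?n * Re (b - a)"
        unfolding times_divide_eq_left nonzero_eq_divide_eq[OF nz] by (rule alg(1)[OF z])
      moreover have "Im (c - a) = ?i / ?n * Im (b - a)"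
        unfolding times_divide_eq_left nonzero_eq_divide_eq[OF nz] by (rule alg(2)[OF z])
      ultimately show ?thesis unfolding ip complex_eq_iff scaleR_complex.sel by blast
    qed
    then have "collinear {0, b - a, c - a}" unfolding collinear_lemma by (intro disjI2 exI)
    then have "collinear {b, a, c}" by (subst collinear_3) (simp_all add: NO_MATCH_def)
    then show ?thesis by (simp only: insert_commute)
  qed
  then show ?thesis using collinear_between_cases[of a b c] by (auto simp: between_mem_segment closed_segment_commute)
qed

lemma finite_vertices: "convex_polygon m P \<Longrightarrow> finite (vertices P)"
  unfolding convex_polygon_def vertices_def by (simp add: finite_polyhedron_extreme_points polytope_imp_polyhedron)

lemma polygon_hull: "convex_polygon m P \<Longrightarrow> P = convex hull (vertices P)"
  unfolding convex_polygon_def vertices_def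
  by (metis Krein_Milman_Minkowski polytope_imp_compact polytope_imp_convex)

lemma vertex_not_in_hull:
  assumes "convex_polygon m P" "x \<in> vertices P" "S \<subseteq> vertices P" "x \<notin> S"
  shows "x \<notin> convex hull S"
proof -
  have "convex P" using assms(1) by (simp add: convex_polygon_def polytope_imp_convex)
  then have "convex (P - {x})" using assms(2) by (simp add: vertices_def extreme_point_of_stillconvex)
  moreover have "S \<subseteq> P - {x}" using assms by (auto simp: vertices_def extreme_point_of_def)
  ultimately have "convex hull S \<subseteq> P - {x}" by (simp add: hull_minimal)
  then show ?thesis by blast
qed

text \<open>
  Around a fixed vertex \<open>z\<close> the others are linearly ordered by oriented area, because \<open>z\<close> is extreme
  and no three vertices are collinear. The other triples are positively oriented as well, for otherwise a vertex
  would lie in a triangle of three others.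
\<close>

lemma polygon_enumeration:
  assumes P: "convex_polygon m P" and m: "1 \<le> m" and n: "n = int m - 1"
  obtains w where "bij_betw w {0..n} (vertices P)"
    "\<And>i j k. 0 \<le> i \<Longrightarrow> i < j \<Longrightarrow> j < k \<Longrightarrow> k \<le> n \<Longrightarrow> 0 < orient (w i) (w j) (w k)"
proof -
  let ?V = "vertices P"
  note fin = finite_vertices[OF P]
  have card: "card ?V = m" using P by (simp add: convex_polygon_def)
  then obtain z where z: "z \<in> ?V" using m by fastforce
  have avoid: "x \<notin> convex hull S" if "x \<in> ?V" "S \<subseteq> ?V" "x \<notin> S" for x S
    by (rule vertex_not_in_hull[OF P that])
  have nz: "orient a b c \<noteq> 0" if "a \<in> ?V" "b \<in> ?V" "c \<in> ?V" "a \<noteq> b" "b \<noteq> c" "a \<noteq> c" for a b c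
  proof
    assume "orient a b c = 0"
    then show False
      using orient_zero_segment[of a b c] avoid[of a "{b, c}"] avoid[of b "{a, c}"] avoid[of c "{a, b}"] that
      by (auto simp: segment_convex_hull)
  qed
  define lt where "lt = (\<lambda>a b. 0 < orient z a b)"
  let ?W = "?V - {z}"
  have tr: "lt a c" if a: "a \<in> ?W" and b: "b \<in> ?W" and c: "c \<in> ?W" and ab: "lt a b" and bc: "lt b c" for a b c
  proof (rule ccontr)
    assume nac: "\<not> lt a c"
    have "a \<noteq> c"
    proof
      assume "a = c"
      then show False using ab bc orient_swap[of z a b] by (simp add: lt_def)
    qed
    then have "orient z a c < 0" using nac nz[of z a c] z a c by (auto simp: lt_def)
    then have ca: "0 < orient z c a" using orient_swap[of z a c] by simp
    \<comment> \<open>The vertex \<open>z\<close> would lie in the triangle \<open>a b c\<close>.\<close>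
    have rot: "orient a z c = orient z c a" "orient a b z = orient z a b"
      by (simp_all add: orient_def algebra_simps)
    have sgn: "0 < orient z b c" "0 < orient a z c" "0 < orient a b z" using ab bc ca rot by (auto simp: lt_def)
    then have "0 < orient a b c" using orient_sum[of z b c a] by linarith
    then have "z \<in> convex hull {a, b, c}" using sgn by (intro in_triangle) auto
    then show False using avoid[of z "{a, b, c}"] z a b c by auto
  qed
  have irr: "\<not> lt a a" for a by (simp add: lt_def orient_def)
  have tot: "lt a b \<or> lt b a" if "a \<in> ?W" "b \<in> ?W" "a \<noteq> b" for a b
    using nz[of z a b] orient_swap[of z a b] that z by (auto simp: lt_def)
  have finW: "finite ?W" using fin by simp
  have cW: "int (card ?W) = n" using card z fin n m by (simp add: card_Diff_singleton of_nat_diff)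
  obtain v where v: "bij_betw v {0..<n} ?W" "\<And>i j. 0 \<le> i \<Longrightarrow> i < j \<Longrightarrow> j < n \<Longrightarrow> lt (v i) (v j)"
  proof (rule enumerate_strict_order[of ?W lt, unfolded cW])
    show "finite ?W" by (rule finW)
    show "lt a c" if "a \<in> ?W" "b \<in> ?W" "c \<in> ?W" "lt a b" "lt b c" for a b c by (rule tr[OF that])
    show "\<not> lt a a" for a by (rule irr)
    show "lt a b \<or> lt b a" if "a \<in> ?W" "b \<in> ?W" "a \<noteq> b" for a b by (rule tot[OF that])
  qed (rule that)
  define w where "w = (\<lambda>i. if i = 0 then z else v (i - 1))"
  have n0: "0 \<le> n" using m n by simp
  have "bij_betw w ({0} \<union> {1..n}) ({z} \<union> ?W)"
  proof (rule bij_betw_combine)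
    show "bij_betw w {0} {z}" by (simp add: w_def bij_betw_def)
    have "bij_betw (\<lambda>i::int. i - 1) {1..n} {0..<n}"
      by (rule bij_betwI[of _ _ _ "\<lambda>i. i + 1"]) auto
    from bij_betw_trans[OF this v(1)] have "bij_betw (v \<circ> (\<lambda>i. i - 1)) {1..n} ?W" .
    then show "bij_betw w {1..n} ?W" by (rule bij_betw_cong[THEN iffD1, rotated]) (simp add: w_def)
  qed auto
  moreover have "{0} \<union> {1..n} = {0..n}" "{z} \<union> ?W = ?V" using n0 z by auto
  ultimately have bij: "bij_betw w {0..n} ?V" by simp
  have inV: "w i \<in> ?V" if "0 \<le> i" "i \<le> n" for i using bij that by (auto simp: bij_betw_def)
  have neq: "w i \<noteq> w j" if "0 \<le> i" "i < j" "j \<le> n" for i j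
    using inj_onD[OF bij_betw_imp_inj_on[OF bij], of i j] that by auto
  have o_pos: "0 < orient z (w i) (w j)" if "0 < i" "i < j" "j \<le> n" for i j
    using v(2)[of "i - 1" "j - 1"] that by (simp add: w_def lt_def)
  have "0 < orient (w i) (w j) (w k)" if ijk: "0 \<le> i" "i < j" "j < k" "k \<le> n" for i j k
  proof (cases "i = 0")
    case True then show ?thesis using o_pos[of j k] ijk by (simp add: w_def)
  next
    case False
    show ?thesis
    proof (rule ccontr)
      assume "\<not> ?thesis"
      then have neg: "0 < orient (w j) (w i) (w k)"
        using nz[of "w i" "w j" "w k"] inV neq ijk by (simp add: orient_def algebra_simps)
      have "w j \<in> convex hull {z, w i, w k}"
        using o_pos[of i j] o_pos[of j k] o_pos[of i k] neg ijk False
        by (intro in_triangle) (auto simp: orient_def)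
      moreover have "w j \<noteq> z" using neq[of 0 j] ijk False by (auto simp: w_def)
      ultimately show False
        using avoid[of "w j" "{z, w i, w k}"] z inV ijk neq[of i j] neq[of j k] by auto
    qed
  qed
  then show thesis using that bij by blast
qed

locale ordered_polygon =
  fixes P :: "complex set" and m :: nat and n :: int and w :: "int \<Rightarrow> complex"
  assumes P: "convex_polygon m P"
    and bij: "bij_betw w {0..n} (vertices P)"
    and pos: "\<And>i j k. 0 \<le> i \<Longrightarrow> i < j \<Longrightarrow> j < k \<Longrightarrow> k \<le> n \<Longrightarrow> 0 < orient (w i) (w j) (w k)"
begin

lemma w_vertex: "i \<in> {0..n} \<Longrightarrow> w i \<in> vertices P"
  using bij by (auto simp: bij_betw_def)

lemma vertex_index:
  assumes "v \<in> vertices P"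
  obtains k where "k \<in> {0..n}" "v = w k"
  using assms bij unfolding bij_betw_def by blast

lemma w_eq_iff: "i \<in> {0..n} \<Longrightarrow> j \<in> {0..n} \<Longrightarrow> w i = w j \<longleftrightarrow> i = j"
  using bij by (auto simp: bij_betw_def inj_on_def)

text \<open>
  The chord from \<open>w a\<close> to \<open>w b\<close> separates the vertices strictly between \<open>a\<close> and
  \<open>b\<close> from the remaining ones.
\<close>

lemma side:
  assumes "0 \<le> a" "a < b" "b \<le> n" "k \<in> {0..n}"
  shows "a < k \<Longrightarrow> k < b \<Longrightarrow> orient (w a) (w b) (w k) < 0"
    "k < a \<or> b < k \<Longrightarrow> 0 < orient (w a) (w b) (w k)"
  using assms pos[of a k b] pos[of k a b] pos[of a b k] orient_swap[of "w a" "w b" "w k"]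
    orient_rotate[of "w a" "w b" "w k"] orient_rotate[of "w k" "w a" "w b"] by auto

lemma side_zero:
  assumes "0 \<le> a" "a < b" "b \<le> n" "k \<in> {0..n}" "orient (w a) (w b) (w k) = 0"
  shows "k = a \<or> k = b"
  using side[OF assms(1-4)] assms(5) by fastforce

lemma orient_segment: "x \<in> closed_segment a b \<Longrightarrow> orient a b x = 0"
  unfolding in_segment by (auto simp: orient_affine)

lemma open_segment_not_vertex:
  assumes "a \<in> P" "b \<in> P" "x \<in> open_segment a b" shows "x \<notin> vertices P"
  using assms by (auto simp: vertices_def extreme_point_of_def)

lemma vertices_subset: "vertices P \<subseteq> P" by (auto simp: vertices_def extreme_point_of_def)

lemma noncrossing_segments:
  assumes ab: "0 \<le> a" "a < b" "b \<le> n" and cd: "0 \<le> c" "c < d" "d \<le> n" and neq: "(a, b) \<noteq> (c, d)"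
    and nc: "\<not> crosses (a, b) (c, d)"
  shows "closed_segment (w a) (w b) \<inter> closed_segment (w c) (w d) \<subseteq> vertices P"
proof
  fix x assume x: "x \<in> closed_segment (w a) (w b) \<inter> closed_segment (w c) (w d)"
  let ?s = "\<lambda>k. orient (w a) (w b) (w k)"
  obtain t where t: "0 \<le> t" "t \<le> 1" "x = (1 - t) *\<^sub>R w c + t *\<^sub>R w d" using x by (auto simp: in_segment)
  have inn: "c \<in> {0..n}" "d \<in> {0..n}" using cd by auto
  have sum: "(1 - t) * ?s c + t * ?s d = 0"
    using x orient_segment[of x "w a" "w b"] orient_affine[of "w a" "w b" t "w c" "w d"] t(3) by simp
  have s0: "?s a = 0" "?s b = 0" by simp_all
  have same: "(0 \<le> ?s c \<and> 0 \<le> ?s d) \<or> (?s c \<le> 0 \<and> ?s d \<le> 0)"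
  proof (cases "a \<le> c \<and> d \<le> b")
    case True
    then show ?thesis using side(1)[OF ab inn(1)] side(1)[OF ab inn(2)] cd s0
      by (cases "c = a"; cases "d = b") auto
  next
    case False
    then have "(c \<le> a \<or> b \<le> c) \<and> (d \<le> a \<or> b \<le> d)" using nc cd ab by (auto simp: crosses_def)
    then show ?thesis using side(2)[OF ab inn(1)] side(2)[OF ab inn(2)] s0
      by (cases "c = a"; cases "c = b"; cases "d = a"; cases "d = b") (auto simp: less_le)
  qed
  consider "t = 0" | "t = 1" | "0 < t" "t < 1" using t by linarith
  then show "x \<in> vertices P"
  proof cases
    case 1 then show ?thesis using t w_vertex inn by simp
  next
    case 2 then show ?thesis using t w_vertex inn by simp
  next
    case 3
    have "?s c = 0 \<and> ?s d = 0"
    proof -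
      have "(1 - t) * ?s c = 0 \<and> t * ?s d = 0"
        using same sum 3 mult_nonneg_nonneg[of "1 - t" "?s c"] mult_nonneg_nonneg[of t "?s d"]
          mult_nonneg_nonpos[of "1 - t" "?s c"] mult_nonneg_nonpos[of t "?s d"] by linarith
      then show ?thesis using 3 by simp
    qed
    then have "c = a \<or> c = b" "d = a \<or> d = b" using side_zero[OF ab] inn by auto
    then show ?thesis using neq cd ab by auto
  qed
qed

lemma crossing_segments:
  assumes ab: "0 \<le> a" "a < b" "b \<le> n" and cd: "c \<in> {0..n}" "d \<in> {0..n}"
    and sc: "a < c" "c < b" and sd: "d < a \<or> b < d"
  obtains x where "x \<in> closed_segment (w a) (w b)" "x \<in> open_segment (w c) (w d)"
proof -
  let ?s = "\<lambda>k. orient (w a) (w b) (w k)" and ?r = "\<lambda>k. orient (w c) (w d) (w k)"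
  have s: "?s c < 0" "0 < ?s d" using side[OF ab] cd sc sd by auto
  have r: "?r a * ?r b < 0"
  proof (cases "d < a")
    case True
    have "0 < orient (w d) (w a) (w c)" "0 < orient (w d) (w c) (w b)" using pos[of d a c] pos[of d c b] True cd ab sc by auto
    then have "0 < ?r a" "?r b < 0"
      by (simp_all add: orient_def algebra_simps)
    then show ?thesis by (simp add: mult_pos_neg)
  next
    case False
    then have bd: "b < d" using sd by auto
    have "0 < orient (w a) (w c) (w d)" "0 < orient (w c) (w b) (w d)" using pos[of a c d] pos[of c b d] bd cd ab sc by auto
    then have "0 < ?r a" "?r b < 0"
      by (simp_all add: orient_def algebra_simps)
    then show ?thesis by (simp add: mult_pos_neg)
  qed
  \<comment> \<open>The point where the line through \<open>w a\<close> and \<open>w b\<close> meets the line through \<open>w c\<close> and \<open>w d\<close>.\<close>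
  define t where "t = - ?s c / (?s d - ?s c)"
  define u where "u = - ?r a / (?r b - ?r a)"
  have t: "0 < t" "t < 1" using s by (auto simp: t_def field_simps)
  have u: "0 < u" "u < 1"
    using r by (auto simp: u_def mult_less_0_iff field_simps)
  have D: "?r b - ?r a = - (?s d - ?s c)" by (simp add: orient_def algebra_simps)
  have Dnz: "?s d - ?s c \<noteq> 0" using s by linarith
  let ?x = "(1 - t) *\<^sub>R w c + t *\<^sub>R w d" and ?y = "(1 - u) *\<^sub>R w a + u *\<^sub>R w b"
  have "(?s d - ?s c) *\<^sub>R ?x = ?s d *\<^sub>R w c - ?s c *\<^sub>R w d"
  proof -
    have "(?s d - ?s c) * t = - ?s c" using Dnz by (simp add: t_def)
    moreover from this have "(?s d - ?s c) * (1 - t) = ?s d" by (simp add: right_diff_distrib)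
    ultimately show ?thesis by (simp add: scaleR_add_right)
  qed
  moreover have "(?s d - ?s c) *\<^sub>R ?y = - ?r b *\<^sub>R w a + ?r a *\<^sub>R w b"
  proof -
    have "(?r b - ?r a) * u = - ?r a" using D Dnz by (simp add: u_def)
    then have "- (?s d - ?s c) * u = - ?r a" by (simp only: D)
    then have "(?s d - ?s c) * u = ?r a" by (simp only: mult_minus_left neg_equal_iff_equal)
    moreover from this have "(?s d - ?s c) * (1 - u) = - ?r b" using D by (simp add: right_diff_distrib)
    ultimately show ?thesis by (simp add: scaleR_add_right)
  qed
  moreover have "?s d *\<^sub>R w c - ?s c *\<^sub>R w d = - ?r b *\<^sub>R w a + ?r a *\<^sub>R w b"
    by (simp add: orient_def complex_eq_iff algebra_simps)
  ultimately have "(?s d - ?s c) *\<^sub>R ?x = (?s d - ?s c) *\<^sub>R ?y" by simp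
  then have xy: "?x = ?y" using Dnz by (metis scaleR_cancel_left)
  have "?y \<in> closed_segment (w a) (w b)" unfolding in_segment using u by (intro exI[of _ u]) auto
  moreover have "?x \<in> open_segment (w c) (w d)"
    unfolding in_segment using t w_eq_iff[OF cd] sc sd by (intro conjI exI[of _ t]) auto
  ultimately show thesis using that xy by simp
qed

text \<open>
  A nonadjacent chord is crossed by another one, which a face cannot be without containing its endpoints. For an
  adjacent pair all vertices are on one side of the chord, which is a face cut out by a supporting line.
\<close>

lemma edge_iff:
  assumes ab: "0 \<le> a" "a < b" "b \<le> n"
  shows "closed_segment (w a) (w b) edge_of P \<longleftrightarrow> b = a + 1 \<or> (a = 0 \<and> b = n)"
proof
  assume e: "closed_segment (w a) (w b) edge_of P"
  show "b = a + 1 \<or> (a = 0 \<and> b = n)"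
  proof (rule ccontr)
    assume neg: "\<not> ?thesis"
    then obtain d where d: "d \<in> {0..n}" "d < a \<or> b < d" using ab by (cases "a = 0") (auto intro: that[of 0] that[of n])
    have c: "a + 1 \<in> {0..n}" "a < a + 1" "a + 1 < b" using neg ab by auto
    obtain x where x: "x \<in> closed_segment (w a) (w b)" "x \<in> open_segment (w (a + 1)) (w d)"
      by (rule crossing_segments[OF ab c(1) d(1) c(2,3) d(2)])
    have "closed_segment (w a) (w b) face_of P" using e by (simp add: edge_of_def)
    then have "w (a + 1) \<in> closed_segment (w a) (w b)"
      using x w_vertex[OF c(1)] w_vertex[OF d(1)] vertices_subset by (meson face_ofD subsetD)
    then have "orient (w a) (w b) (w (a + 1)) = 0" by (rule orient_segment)
    then show False using side_zero[OF ab c(1)] c by auto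
  qed
next
  assume adj: "b = a + 1 \<or> (a = 0 \<and> b = n)"
  have inn: "a \<in> {0..n}" "b \<in> {0..n}" using ab by auto
  let ?V = "vertices P"
  obtain \<sigma> :: real where \<sigma>: "\<sigma> \<noteq> 0" "\<And>k. k \<in> {0..n} \<Longrightarrow> \<sigma> * orient (w a) (w b) (w k) \<le> 0"
  proof (cases "b = a + 1")
    case True
    have "-1 * orient (w a) (w b) (w k) \<le> 0" if "k \<in> {0..n}" for k
      using side(2)[OF ab that] True by (cases "k = a"; cases "k = b") force+
    then show thesis using that[of "-1"] by simp
  next
    case False
    then have "1 * orient (w a) (w b) (w k) \<le> 0" if "k \<in> {0..n}" for k
      using side(1)[OF ab that] adj that by (cases "k = a"; cases "k = b") force+
    then show thesis using that[of 1] by simp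
  qed
  define q where "q = \<sigma> *\<^sub>R Complex (- Im (w b - w a)) (Re (w b - w a))"
  have q: "q \<bullet> x - q \<bullet> w a = \<sigma> * orient (w a) (w b) x" for x
    by (simp add: q_def inner_complex_def orient_def algebra_simps)
  have "?V \<subseteq> {x. q \<bullet> x \<le> q \<bullet> w a}"
  proof
    fix v assume "v \<in> ?V"
    then obtain k where "k \<in> {0..n}" "v = w k" by (rule vertex_index)
    then show "v \<in> {x. q \<bullet> x \<le> q \<bullet> w a}" using \<sigma>(2)[of k] q[of v] by simp
  qed
  then have "convex hull ?V \<subseteq> {x. q \<bullet> x \<le> q \<bullet> w a}" by (simp add: hull_minimal convex_halfspace_le)
  then have le: "\<And>x. x \<in> P \<Longrightarrow> q \<bullet> x \<le> q \<bullet> w a" using polygon_hull[OF P] by blast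
  have cP: "convex P" using P by (simp add: convex_polygon_def polytope_imp_convex)
  let ?F = "P \<inter> {x. q \<bullet> x = q \<bullet> w a}"
  have face: "?F face_of P" by (rule face_of_Int_supporting_hyperplane_le[OF cP le])
  then have "?F face_of convex hull ?V" using polygon_hull[OF P] by simp
  then obtain S where S: "S \<subseteq> ?V" "?F = convex hull S"
    using face_of_convex_hull_subset[of ?V ?F] finite_imp_compact[OF finite_vertices[OF P]] by metis
  have F0: "orient (w a) (w b) x = 0" if "x \<in> ?F" for x using q[of x] that \<sigma>(1) by simp
  have "S \<subseteq> {w a, w b}"
  proof
    fix v assume v: "v \<in> S"
    then have "v \<in> ?V" using S(1) by blast
    then obtain k where k: "k \<in> {0..n}" "v = w k" by (rule vertex_index)
    have "v \<in> ?F" using v S(2) hull_subset[of S convex] by blast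
    then show "v \<in> {w a, w b}" using F0[of v] side_zero[OF ab k(1)] k by auto
  qed
  then have "?F \<subseteq> closed_segment (w a) (w b)" unfolding S(2) segment_convex_hull by (rule hull_mono)
  moreover have "w a \<in> ?F" "w b \<in> ?F"
    using w_vertex[OF inn(1)] w_vertex[OF inn(2)] vertices_subset q[of "w b"] by auto
  then have "closed_segment (w a) (w b) \<subseteq> ?F"
    by (intro closed_segment_subset face_of_imp_convex[OF face])
  ultimately have eq: "?F = closed_segment (w a) (w b)" by blast
  have "w a \<noteq> w b" using w_eq_iff[OF inn] ab by simp
  then have "aff_dim (closed_segment (w a) (w b)) = 1"
    by (simp add: segment_convex_hull aff_dim_convex_hull aff_dim_2)
  then show "closed_segment (w a) (w b) edge_of P" using face eq by (simp add: edge_of_def)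
qed

definition chord :: "int \<times> int \<Rightarrow> complex set" where
  "chord d = closed_segment (w (fst d)) (w (snd d))"

abbreviation "D \<equiv> arcs_in 0 n - {(0, n)}"

lemma D_iff: "(a, b) \<in> D \<longleftrightarrow> 0 \<le> a \<and> a + 2 \<le> b \<and> b \<le> n \<and> (a, b) \<noteq> (0, n)"
  by (auto simp: arcs_in_iff)

lemma chord_eq_iff:
  assumes "d \<in> D" "i \<in> {0..n}" "j \<in> {0..n}" "chord d = closed_segment (w i) (w j)"
  shows "d = (i, j) \<or> d = (j, i)"
proof -
  obtain a b where d: "d = (a, b)" by force
  have ab: "a \<in> {0..n}" "b \<in> {0..n}" using assms(1) unfolding d D_iff by auto
  have "{w a, w b} = {w i, w j}" using assms(4) by (simp add: chord_def d)
  then show ?thesis using w_eq_iff ab assms(2,3) unfolding d by (metis doubleton_eq_iff)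
qed

lemma inj_chord: "inj_on chord D"
proof (rule inj_onI)
  fix d e assume d: "d \<in> D" and e: "e \<in> D" and eq: "chord d = chord e"
  obtain a b where eab: "e = (a, b)" by force
  have "d = (a, b) \<or> d = (b, a)"
    using chord_eq_iff[OF d, of a b] e eq unfolding eab D_iff chord_def by auto
  then show "d = e" using d e unfolding eab by (auto simp: arcs_in_iff)
qed

lemma diagonals_eq: "diagonals P = chord ` D"
proof (intro equalityI subsetI)
  fix s assume "s \<in> diagonals P"
  then obtain a b where ab: "s = closed_segment a b" "a \<in> vertices P" "b \<in> vertices P" "a \<noteq> b" "\<not> closed_segment a b edge_of P"
    by (auto simp: diagonals_def)
  obtain i where i: "i \<in> {0..n}" "a = w i" using ab(2) by (rule vertex_index)
  obtain j where j: "j \<in> {0..n}" "b = w j" using ab(3) by (rule vertex_index)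
  note ij = i(1) j(1) i(2) j(2)
  have *: "closed_segment (w i) (w j) \<in> chord ` D"
    if "i \<in> {0..n}" "j \<in> {0..n}" "i < j" "\<not> closed_segment (w i) (w j) edge_of P" for i j
    using that edge_iff[of i j] by (intro image_eqI[of _ _ "(i, j)"]) (auto simp: chord_def arcs_in_iff)
  have "i \<noteq> j" using ab ij by auto
  then show "s \<in> chord ` D"
    using *[of i j] *[of j i] ab ij by (cases "i < j") (auto simp: closed_segment_commute)
next
  fix s assume "s \<in> chord ` D"
  then obtain a b where ab: "(a, b) \<in> D" "s = chord (a, b)" by auto
  then have i: "a \<in> {0..n}" "b \<in> {0..n}" "0 \<le> a" "a < b" "b \<le> n" unfolding D_iff by auto
  have "\<not> closed_segment (w a) (w b) edge_of P" using edge_iff[OF i(3-5)] ab(1) unfolding D_iff by auto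
  then show "s \<in> diagonals P"
    using ab(2) i w_vertex[OF i(1)] w_vertex[OF i(2)] w_eq_iff[OF i(1,2)]
    unfolding diagonals_def chord_def by auto
qed

lemma chords_disjoint_iff:
  assumes d: "d \<in> D" and e: "e \<in> D" and neq: "d \<noteq> e"
  shows "chord d \<inter> chord e \<subseteq> vertices P \<longleftrightarrow> \<not> crosses d e"
proof -
  have cr: "\<not> chord d \<inter> chord e \<subseteq> vertices P"
    if d: "d \<in> D" and e: "e \<in> D" and c: "fst d < fst e" "fst e < snd d" "snd d < snd e" for d e
  proof -
    obtain a b where d': "d = (a, b)" by force
    obtain i j where e': "e = (i, j)" by force
    have ab: "0 \<le> a" "a < b" "b \<le> n" using d unfolding d' D_iff by auto
    have ij: "i \<in> {0..n}" "j \<in> {0..n}" using e unfolding e' D_iff by auto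
    obtain x where x: "x \<in> closed_segment (w a) (w b)" "x \<in> open_segment (w i) (w j)"
      using crossing_segments[OF ab ij] c unfolding d' e' by auto
    then have "x \<notin> vertices P"
      using open_segment_not_vertex[OF _ _ x(2)] w_vertex[OF ij(1)] w_vertex[OF ij(2)] vertices_subset by blast
    moreover have "x \<in> chord d \<inter> chord e" using x open_closed_segment by (auto simp: chord_def d' e')
    ultimately show ?thesis by blast
  qed
  show ?thesis
  proof
    assume "chord d \<inter> chord e \<subseteq> vertices P"
    then show "\<not> crosses d e" using cr[OF d e] cr[OF e d] unfolding crosses_def by blast
  next
    assume nc: "\<not> crosses d e"
    obtain a b where d': "d = (a, b)" by force
    obtain i j where e': "e = (i, j)" by force
    have ab: "0 \<le> a" "a < b" "b \<le> n" using d unfolding d' D_iff by auto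
    have ij: "0 \<le> i" "i < j" "j \<le> n" using e unfolding e' D_iff by auto
    show "chord d \<inter> chord e \<subseteq> vertices P"
      using noncrossing_segments[OF ab ij] neq nc unfolding chord_def d' e' by auto
  qed
qed

lemma Y_complex_eq:
  assumes RB: "bicolouring (vertices P) R B"
  shows "Y_complex P B = (`) chord ` noncrossing_complex n {i \<in> {0..n}. w i \<in> R}"
proof -
  let ?R = "{i \<in> {0..n}. w i \<in> R}"
  have blue: "(\<exists>a b. chord d = closed_segment a b \<and> (a \<in> B \<or> b \<in> B)) \<longleftrightarrow> fst d \<notin> ?R \<or> snd d \<notin> ?R"
    if d: "d \<in> D" for d
  proof -
    obtain i j where d': "d = (i, j)" by force
    have ij: "i \<in> {0..n}" "j \<in> {0..n}" using d unfolding d' D_iff by auto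
    have "(\<exists>a b. chord d = closed_segment a b \<and> (a \<in> B \<or> b \<in> B)) \<longleftrightarrow> w i \<in> B \<or> w j \<in> B"
    proof
      assume "\<exists>a b. chord d = closed_segment a b \<and> (a \<in> B \<or> b \<in> B)"
      then obtain a b where "{w i, w j} = {a, b}" "a \<in> B \<or> b \<in> B" by (auto simp: chord_def d')
      then show "w i \<in> B \<or> w j \<in> B" by (metis doubleton_eq_iff)
    next
      assume "w i \<in> B \<or> w j \<in> B"
      then show "\<exists>a b. chord d = closed_segment a b \<and> (a \<in> B \<or> b \<in> B)" unfolding chord_def d' fst_conv snd_conv by blast
    qed
    moreover have "w k \<in> B \<longleftrightarrow> k \<notin> ?R" if "k \<in> {0..n}" for k
      using w_vertex[OF that] that RB unfolding bicolouring_def by blast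
    ultimately show ?thesis using ij unfolding d' by simp
  qed
  have pw: "pairwise (\<lambda>d e. d \<inter> e \<subseteq> vertices P) (chord ` S) \<longleftrightarrow> noncrossing S" if S: "S \<subseteq> D" for S
  proof
    assume p: "pairwise (\<lambda>d e. d \<inter> e \<subseteq> vertices P) (chord ` S)"
    show "noncrossing S" unfolding noncrossing_def
    proof (intro ballI)
      fix d e assume de: "d \<in> S" "e \<in> S"
      show "\<not> crosses d e"
      proof (cases "d = e")
        case True then show ?thesis by (simp add: not_crosses_self)
      next
        case False
        have D: "d \<in> D" "e \<in> D" using de S by blast+
        have "chord d \<noteq> chord e" using False inj_chord D by (auto simp: inj_on_def)
        then have "chord d \<inter> chord e \<subseteq> vertices P" using p de by (auto simp: pairwise_def)
        then show ?thesis using chords_disjoint_iff[OF D False] by simp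
      qed
    qed
  next
    assume nc: "noncrossing S"
    show "pairwise (\<lambda>d e. d \<inter> e \<subseteq> vertices P) (chord ` S)"
      unfolding pairwise_def
    proof (intro ballI impI)
      fix s t assume st: "s \<in> chord ` S" "t \<in> chord ` S" "s \<noteq> t"
      then obtain d e where de: "d \<in> S" "e \<in> S" "s = chord d" "t = chord e" by blast
      have D: "d \<in> D" "e \<in> D" "d \<noteq> e" using de S st(3) by auto
      show "s \<inter> t \<subseteq> vertices P"
        using chords_disjoint_iff[OF D] nc de unfolding noncrossing_def by blast
    qed
  qed
  have col: "(\<forall>(a, b)\<in>S. a \<notin> ?R \<or> b \<notin> ?R) \<longleftrightarrow> (\<forall>d\<in>chord ` S. \<exists>a b. d = closed_segment a b \<and> (a \<in> B \<or> b \<in> B))"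
    if S: "S \<subseteq> D" for S
  proof -
    have "(\<forall>(a, b)\<in>S. a \<notin> ?R \<or> b \<notin> ?R) \<longleftrightarrow> (\<forall>d\<in>S. fst d \<notin> ?R \<or> snd d \<notin> ?R)"
      by (simp only: case_prod_unfold)
    also have "\<dots> \<longleftrightarrow> (\<forall>d\<in>S. \<exists>a b. chord d = closed_segment a b \<and> (a \<in> B \<or> b \<in> B))"
      by (rule ball_cong[OF refl], rule blue[symmetric], rule subsetD[OF S])
    finally show ?thesis by simp
  qed
  have fin: "finite D" using finite_arcs_in by simp
  show ?thesis
  proof (intro equalityI subsetI)
    fix \<sigma> assume s: "\<sigma> \<in> Y_complex P B"
    then have "\<sigma> \<subseteq> chord ` D" by (simp add: Y_complex_def arc_complex_def diagonals_eq)
    then obtain S where S: "S \<subseteq> D" "\<sigma> = chord ` S" by (metis subset_imageE)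
    have "S \<in> noncrossing_complex n ?R"
      using s S(1) pw[OF S(1)] col[OF S(1)] unfolding Y_complex_def arc_complex_def noncrossing_complex_def S(2) by auto
    then show "\<sigma> \<in> (`) chord ` noncrossing_complex n ?R" using S(2) by blast
  next
    fix \<sigma> assume "\<sigma> \<in> (`) chord ` noncrossing_complex n ?R"
    then obtain S where S: "S \<in> noncrossing_complex n ?R" "\<sigma> = chord ` S" by blast
    then have SD: "S \<subseteq> D" "S \<noteq> {}" "noncrossing S" "\<forall>(a, b)\<in>S. a \<notin> ?R \<or> b \<notin> ?R" by (auto simp: noncrossing_complex_def)
    have "finite S" using SD(1) fin by (rule finite_subset)
    then show "\<sigma> \<in> Y_complex P B"
      using SD pw[OF SD(1)] col[OF SD(1)] unfolding Y_complex_def arc_complex_def S(2) diagonals_eq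
      by (simp add: image_mono)
  qed
qed

lemma Y_complex_ball:
  assumes m: "4 \<le> m" "n = int m - 1" and RB: "nontrivial_bicolouring P R B"
  shows "is_closed_ball (Y_complex P B) (m - 4)"
proof -
  let ?R = "{i \<in> {0..n}. w i \<in> R}"
  have bi: "bicolouring (vertices P) R B" using RB by (simp add: nontrivial_bicolouring_def)
  obtain a b where ab: "a \<in> R" "b \<in> R" "closed_segment a b \<in> diagonals P"
    using RB by (auto simp: nontrivial_bicolouring_def)
  then obtain d where d: "d \<in> D" "closed_segment a b = chord d" unfolding diagonals_eq by blast
  obtain i j where d': "d = (i, j)" by force
  have ij: "(i, j) \<in> arcs_in 0 n" "(i, j) \<noteq> (0, n)" "i \<in> {0..n}" "j \<in> {0..n}"
    using d(1) unfolding d' by (auto simp: arcs_in_iff)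
  have "{w i, w j} = {a, b}" using d(2) by (simp add: chord_def d')
  then have R: "i \<in> ?R" "j \<in> ?R" using ab ij by (auto simp: doubleton_eq_iff)
  obtain v where v: "v \<in> B" "v \<in> vertices P" "v \<notin> R" using bi by (auto simp: bicolouring_def)
  obtain k where k: "k \<in> {0..n}" "v = w k" using v(2) by (rule vertex_index)
  have "is_closed_ball (noncrossing_complex n ?R) (m - 4)"
    by (rule noncrossing_complex_ball[OF m ij(1,2) R k(1)]) (use v k in auto)
  moreover have "\<Union> (noncrossing_complex n ?R) \<subseteq> D" by (auto simp: noncrossing_complex_def)
  ultimately show ?thesis
    unfolding Y_complex_eq[OF bi] by (intro is_closed_ball_relabel[OF inj_chord finite_complex_noncrossing])
qed

end

theorem Y_complex_closed_ball:
  assumes "4 \<le> m" "convex_polygon m P" "nontrivial_bicolouring P R B"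
  shows "is_closed_ball (Y_complex P B) (m - 4)"
proof -
  have m1: "1 \<le> m" using assms(1) by simp
  obtain w where w: "bij_betw w {0..int m - 1} (vertices P)"
    "\<And>i j k. 0 \<le> i \<Longrightarrow> i < j \<Longrightarrow> j < k \<Longrightarrow> k \<le> int m - 1 \<Longrightarrow> 0 < orient (w i) (w j) (w k)"
    using polygon_enumeration[OF assms(2) m1 refl] by metis
  interpret ordered_polygon P m "int m - 1" w
    by unfold_locales (use assms(2) w in auto)
  show ?thesis by (rule Y_complex_ball[OF assms(1) refl assms(3)])
qed

section \<open>Once-punctured polygons\<close>

lemma in_path_image: "t \<in> {0..1} \<Longrightarrow> p t \<in> path_image p"
  by (simp add: path_image_def)

text \<open>
  The Fashoda meet theorem, transported from \<open>real^2\<close> to the complex numbers.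
\<close>

lemma upper_half_plane_paths_meet:
  fixes p q :: "real \<Rightarrow> complex"
  assumes p: "path p" "path_image p \<subseteq> {z. 0 \<le> Im z}" "Im (pathstart p) = 0" "Im (pathfinish p) = 0"
    and q: "path q" "path_image q \<subseteq> {z. 0 \<le> Im z}" "Im (pathstart q) = 0" "Im (pathfinish q) = 0"
    and ord: "Re (pathstart p) < Re (pathstart q)" "Re (pathstart q) < Re (pathfinish p)"
      "Re (pathfinish p) < Re (pathfinish q)"
  obtains z where "z \<in> path_image p" "z \<in> path_image q"
proof -
  define v where "v = (\<lambda>z. (\<chi> i. if i = 1 then Re z else Im z) :: real^2)"
  have v: "v z $ 1 = Re z" "v z $ 2 = Im z" for z by (simp_all add: v_def)
  have inj: "v y = v z \<Longrightarrow> y = z" for y z using v by (metis complex_eqI)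
  have cont: "continuous_on S v" for S
  proof -
    have "continuous_on S (\<lambda>z. if i = 1 then Re z else Im z)" for i :: 2
      by (cases "i = 1") (simp_all add: continuous_on_Re continuous_on_Im continuous_on_id)
    then show ?thesis unfolding v_def by (rule continuous_on_vec_lambda)
  qed
  have "bounded (path_image p \<union> path_image q)" using p(1) q(1) by (simp add: bounded_path_image)
  then obtain N where N: "\<And>z. z \<in> path_image p \<union> path_image q \<Longrightarrow> norm z \<le> N" by (auto simp: bounded_iff)
  define a b :: "real^2" where "a = (\<chi> i. if i = 1 then - N else 0)" and "b = (\<chi> i. N)"
  have box: "v z \<in> cbox a b" if "z \<in> path_image p \<union> path_image q" for z
  proof -
    have "\<bar>Re z\<bar> \<le> N" "\<bar>Im z\<bar> \<le> N" using N[OF that] abs_Re_le_cmod[of z] abs_Im_le_cmod[of z] by linarith+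
    moreover have "0 \<le> Im z" using that p(2) q(2) by blast
    ultimately show ?thesis by (auto simp: mem_box_cart forall_2 v a_def b_def abs_le_iff)
  qed
  have pv: "path (v \<circ> p)" "path (v \<circ> q)" using p(1) q(1) cont by (simp_all add: path_continuous_image)
  have sub: "path_image (v \<circ> p) \<subseteq> cbox a b" "path_image (v \<circ> q) \<subseteq> cbox a b"
    using box by (auto simp: path_image_compose)
  have ends: "pathstart (v \<circ> p) $ 2 = a $ 2" "pathfinish (v \<circ> p) $ 2 = a $ 2"
     "pathstart (v \<circ> q) $ 2 = a $ 2" "pathfinish (v \<circ> q) $ 2 = a $ 2"
    using p q by (simp_all add: pathstart_compose pathfinish_compose v a_def)
  have ords: "pathstart (v \<circ> p) $ 1 < pathstart (v \<circ> q) $ 1" "pathstart (v \<circ> q) $ 1 < pathfinish (v \<circ> p) $ 1"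
     "pathfinish (v \<circ> p) $ 1 < pathfinish (v \<circ> q) $ 1"
    using ord by (simp_all add: pathstart_compose pathfinish_compose v)
  obtain y where "y \<in> path_image (v \<circ> p)" "y \<in> path_image (v \<circ> q)"
    by (rule fashoda_interlace[OF pv sub ends ords])
  then obtain z z' where z: "z \<in> path_image p" "y = v z" "z' \<in> path_image q" "y = v z'"
    by (auto simp: path_image_compose)
  have "z = z'" using z(2,4) by (metis inj)
  then show thesis using that z by blast
qed

text \<open>
  A parametrization by the unit disc with the puncture at its centre.
\<close>

locale punctured_disc =
  fixes P V :: "complex set" and x :: complex and m :: nat and \<phi> \<psi> :: "complex \<Rightarrow> complex"
  assumes hom: "homeomorphism P (cball 0 1) \<phi> \<psi>" and xP: "x \<in> P" and \<phi>x: "\<phi> x = 0"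
    and V: "V \<subseteq> frontier P" "finite V" "card V = m" and m2: "2 \<le> m"
begin

abbreviation "H \<equiv> {z. 0 \<le> Im z}"
abbreviation "A \<equiv> P - {x}"
abbreviation "M \<equiv> int m"

text \<open>
  The universal covering of the punctured disc by the closed upper half plane. Its deck transformations
  are the translations by multiples of \<open>2 * pi\<close>.
\<close>

definition cov :: "complex \<Rightarrow> complex" where "cov z = \<psi> (exp (\<i> * z))"

lemma continuous_\<phi>: "continuous_on P \<phi>" using hom by (simp add: homeomorphism_def)

lemma closedP: "closed P"
proof -
  have "P homeomorphic cball (0::complex) 1" using hom unfolding homeomorphic_def by blast
  then have "compact P" using homeomorphic_compactness compact_cball by blast
  then show ?thesis by (rule compact_imp_closed)
qed

lemma \<phi>_in: "z \<in> P \<Longrightarrow> norm (\<phi> z) \<le> 1" using hom by (auto simp: homeomorphism_def)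
lemma \<psi>_in: "norm z \<le> 1 \<Longrightarrow> \<psi> z \<in> P" using hom by (auto simp: homeomorphism_def)
lemma \<psi>\<phi>: "z \<in> P \<Longrightarrow> \<psi> (\<phi> z) = z" using hom by (auto simp: homeomorphism_def)
lemma \<phi>\<psi>: "norm z \<le> 1 \<Longrightarrow> \<phi> (\<psi> z) = z" using hom by (auto simp: homeomorphism_def)

lemma \<phi>_zero_iff: "z \<in> P \<Longrightarrow> \<phi> z = 0 \<longleftrightarrow> z = x"
  using \<psi>\<phi> xP \<phi>x by metis

lemma interior_iff:
  assumes "z \<in> P" shows "z \<in> interior P \<longleftrightarrow> norm (\<phi> z) < 1"
proof
  have inj: "inj_on \<phi> P" "inj_on \<psi> (cball 0 1)" using hom by (auto simp: homeomorphism_def intro!: inj_on_inverseI)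
  have cont: "continuous_on P \<phi>" "continuous_on (cball 0 1) \<psi>" and im: "\<phi> ` P = cball 0 1" "\<psi> ` cball 0 1 = P"
    using hom by (auto simp: homeomorphism_def)
  have 1: "\<phi> ` interior P \<subseteq> ball 0 1"
    using continuous_image_subset_interior[OF cont(1) inj(1)] im by (auto simp: Pi_iff)
  have 2: "\<psi> ` ball 0 1 \<subseteq> interior P"
    using continuous_image_subset_interior[OF cont(2) inj(2)] im by (auto simp: Pi_iff)
  show "norm (\<phi> z) < 1" if "z \<in> interior P" using 1 that by (auto simp: image_subset_iff)
  show "z \<in> interior P" if "norm (\<phi> z) < 1"
  proof -
    have "\<psi> (\<phi> z) \<in> interior P" using 2 that by (auto simp: image_subset_iff)
    then show ?thesis using \<psi>\<phi>[OF assms] by simp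
  qed
qed

lemma frontier_iff: "z \<in> frontier P \<longleftrightarrow> z \<in> P \<and> norm (\<phi> z) = 1"
  using interior_iff[of z] \<phi>_in[of z] closedP frontier_subset_closed[OF closedP]
  by (auto simp: frontier_def)

lemma interior_A: "interior A = interior P - {x}"
  by (metis Diff_eq interior_Int closed_singleton interior_open open_Compl)

lemma \<phi>_cov: "z \<in> H \<Longrightarrow> \<phi> (cov z) = exp (\<i> * z)"
  unfolding cov_def by (rule \<phi>\<psi>) simp

lemma cov_in: assumes "z \<in> H" shows "cov z \<in> A"
proof -
  have "cov z \<in> P" unfolding cov_def using assms by (intro \<psi>_in) simp
  moreover have "\<phi> (cov z) \<noteq> 0" using \<phi>_cov[OF assms] by simp
  ultimately show ?thesis using \<phi>x by auto
qed

lemma cov_frontier: "z \<in> H \<Longrightarrow> cov z \<in> frontier P \<longleftrightarrow> Im z = 0"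
  unfolding frontier_iff using cov_in[of z] \<phi>_cov[of z] by simp

lemma cov_interior: "z \<in> H \<Longrightarrow> cov z \<in> interior A \<longleftrightarrow> 0 < Im z"
  unfolding interior_A using cov_in[of z] \<phi>_cov[of z] interior_iff[of "cov z"] by simp

lemma cov_eq_iff:
  assumes "z \<in> H" "y \<in> H"
  shows "cov z = cov y \<longleftrightarrow> (\<exists>k::int. y = z + of_real (2 * pi * k))"
proof -
  have "cov z = cov y \<longleftrightarrow> \<phi> (cov z) = \<phi> (cov y)"
    using \<psi>\<phi> cov_in assms by (metis Diff_iff)
  also have "\<dots> \<longleftrightarrow> exp (\<i> * y) = exp (\<i> * z)" using \<phi>_cov assms by auto
  also have "\<dots> \<longleftrightarrow> (\<exists>k::int. \<i> * y = \<i> * z + of_int (2 * k) * pi * \<i>)" by (simp add: exp_eq)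
  also have "\<dots> \<longleftrightarrow> (\<exists>k::int. y = z + of_real (2 * pi * k))"
  proof (intro ex_cong1)
    fix k :: int
    have "\<i> * z + of_int (2 * k) * pi * \<i> = \<i> * (z + of_real (2 * pi * k))" by (simp add: algebra_simps)
    then show "\<i> * y = \<i> * z + of_int (2 * k) * pi * \<i> \<longleftrightarrow> y = z + of_real (2 * pi * k)" by simp
  qed
  finally show ?thesis .
qed

lemma continuous_cov: "continuous_on H cov"
proof -
  have "continuous_on (cball 0 1) \<psi>" using hom by (simp add: homeomorphism_def)
  moreover have "continuous_on H (\<lambda>z. exp (\<i> * z))" by (intro continuous_intros)
  moreover have "(\<lambda>z. exp (\<i> * z)) ` H \<subseteq> cball 0 1" by auto
  ultimately have "continuous_on H (\<psi> \<circ> (\<lambda>z. exp (\<i> * z)))"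
    using continuous_on_compose[OF _ continuous_on_subset] by blast
  then show ?thesis by (simp add: o_def cov_def[abs_def])
qed

definition lifts :: "(real \<Rightarrow> complex) \<Rightarrow> (real \<Rightarrow> complex) \<Rightarrow> bool" where
  "lifts p q \<longleftrightarrow> path q \<and> path_image q \<subseteq> H \<and> (\<forall>t\<in>{0..1}. p t = cov (q t))"

lemma liftsD:
  assumes "lifts p q"
  shows "path q" "path_image q \<subseteq> H" "t \<in> {0..1} \<Longrightarrow> p t = cov (q t)" "t \<in> {0..1} \<Longrightarrow> q t \<in> H"
proof -
  show "path q" "path_image q \<subseteq> H" "t \<in> {0..1} \<Longrightarrow> p t = cov (q t)" using assms unfolding lifts_def by blast+
  then show "t \<in> {0..1} \<Longrightarrow> q t \<in> H" unfolding path_image_def by blast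
qed

lemma lifts_cov: "path q \<Longrightarrow> path_image q \<subseteq> H \<Longrightarrow> lifts (cov \<circ> q) q"
  by (simp add: lifts_def)

lemma lifts_path_image: "lifts p q \<Longrightarrow> path_image p = cov ` path_image q"
  unfolding lifts_def path_image_def by force

lemma path_cov: "path q \<Longrightarrow> path_image q \<subseteq> H \<Longrightarrow> path (cov \<circ> q)"
  by (rule path_continuous_image[OF _ continuous_on_subset[OF continuous_cov]])

lemma lifts_path:
  assumes "lifts p q" shows "path p" "path_image p \<subseteq> A"
proof -
  have "path (cov \<circ> q)" using path_cov liftsD(1,2)[OF assms] by blast
  moreover have "(cov \<circ> q) t = p t" if "t \<in> {0..1}" for t using liftsD(3)[OF assms that] by simp
  ultimately show "path p" unfolding path_def by (metis (no_types, lifting) continuous_on_cong)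
  show "path_image p \<subseteq> A"
    unfolding lifts_path_image[OF assms] using cov_in liftsD(2)[OF assms] by blast
qed

lemma lifts_reverse:
  assumes "lifts p q" shows "lifts (reversepath p) (reversepath q)"
  unfolding lifts_def
proof (intro conjI ballI)
  show "path (reversepath q)" using liftsD(1)[OF assms] by simp
  show "path_image (reversepath q) \<subseteq> H" using liftsD(2)[OF assms] by simp
  fix t :: real assume "t \<in> {0..1}"
  then show "reversepath p t = cov (reversepath q t)"
    using liftsD(3)[OF assms, of "1 - t"] by (simp add: reversepath_def)
qed

lemma lifts_shift:
  assumes q: "lifts p q" shows "lifts p (\<lambda>t. q t + of_real (2 * pi * of_int k))"
  unfolding lifts_def
proof (intro conjI ballI)
  show "path (\<lambda>t. q t + of_real (2 * pi * of_int k))"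
    using liftsD(1)[OF q] unfolding path_def by (intro continuous_intros)
  show "path_image (\<lambda>t. q t + of_real (2 * pi * of_int k)) \<subseteq> H"
    using liftsD(4)[OF q] by (auto simp: path_image_def)
  fix t :: real assume t: "t \<in> {0..1}"
  have "cov (q t) = cov (q t + of_real (2 * pi * of_int k))"
    using liftsD(4)[OF q t] by (subst cov_eq_iff) auto
  then show "p t = cov (q t + of_real (2 * pi * of_int k))" using liftsD(3)[OF q t] by simp
qed

lemma lift_exists:
  assumes p: "path p" "path_image p \<subseteq> A"
  obtains q where "lifts p q"
proof -
  have sub: "p ` {0..1} \<subseteq> P" using p(2) by (auto simp: path_image_def)
  have c: "continuous_on {0..1} (\<phi> \<circ> p)"
    by (rule continuous_on_compose[OF p(1)[unfolded path_def] continuous_on_subset[OF continuous_\<phi> sub]])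
  have nz: "(\<phi> \<circ> p) t \<noteq> 0" if "t \<in> {0..1}" for t
  proof -
    have "p t \<in> A" using in_path_image[OF that, of p] p(2) by blast
    then show ?thesis using \<phi>_zero_iff[of "p t"] by simp
  qed
  have "contractible {0..1::real}" by (simp add: convex_imp_contractible)
  then obtain g where g: "continuous_on {0..1} g" "\<And>t. t \<in> {0..1} \<Longrightarrow> (\<phi> \<circ> p) t = exp (g t)"
    using continuous_logarithm_on_contractible[OF c _ nz] by metis
  define q where "q = (\<lambda>t. - \<i> * g t)"
  have iq: "\<i> * q t = g t" for t by (simp add: q_def)
  have pt: "p t \<in> P" if "t \<in> {0..1}" for t using sub that by blast
  have Imq: "0 \<le> Im (q t)" if "t \<in> {0..1}" for t
  proof -
    have "norm (exp (g t)) \<le> 1" using \<phi>_in[OF pt[OF that]] g(2)[OF that] by simp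
    then have "Re (g t) \<le> 0" by simp
    then show ?thesis by (simp add: q_def)
  qed
  have "lifts p q"
    unfolding lifts_def
  proof (intro conjI ballI)
    show "path q" using g(1) unfolding path_def q_def by (intro continuous_intros)
    show "path_image q \<subseteq> H" using Imq by (auto simp: path_image_def)
    fix t :: real assume t: "t \<in> {0..1}"
    have "cov (q t) = \<psi> (\<phi> (p t))" unfolding cov_def iq using g(2)[OF t] by simp
    then show "p t = cov (q t)" using \<psi>\<phi>[OF pt[OF t]] by simp
  qed
  then show thesis by (rule that)
qed

text \<open>
  Monodromy for the exponential function: \<open>\<phi>\<close> maps the punctured polygon into the punctured plane.
\<close>

lemma homotopic_imp_lift_ends:
  assumes h: "homotopic_paths A p p'" and q: "lifts p q" and q': "lifts p' q'" and s: "q 0 = q' 0"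
  shows "q 1 = q' 1"
proof -
  have "continuous_on A \<phi>" by (rule continuous_on_subset[OF continuous_\<phi> Diff_subset])
  moreover have "\<phi> \<in> A \<rightarrow> - {0}" using \<phi>_zero_iff by auto
  ultimately have hp: "homotopic_paths (- {0}) (\<phi> \<circ> p) (\<phi> \<circ> p')"
    using h by (rule_tac homotopic_paths_continuous_image) auto
  have ip: "\<And>q. path q \<Longrightarrow> path (\<lambda>t. \<i> * q t)" unfolding path_def by (intro continuous_intros)
  have e: "exp (\<i> * q t) = (\<phi> \<circ> p) t" if "lifts p q" "t \<in> {0..1}" for p q t
    using liftsD(3,4)[OF that] \<phi>_cov by auto
  have "pathfinish (\<lambda>t. \<i> * q t) = pathfinish (\<lambda>t. \<i> * q' t)"
    by (rule covering_space_monodromy[OF covering_space_exp_punctured_plane _ _ _ _ hp])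
      (use hp homotopic_paths_imp_path[OF hp] homotopic_paths_imp_subset[OF hp] ip liftsD(1)[OF q] liftsD(1)[OF q'] e[OF q] e[OF q'] s in
        \<open>auto simp: pathstart_def\<close>)
  then show ?thesis by (simp add: pathfinish_def)
qed

lemma lift_ends_imp_homotopic:
  assumes q: "lifts p q" and q': "lifts p' q'" and s: "q 0 = q' 0" "q 1 = q' 1"
  shows "homotopic_paths A p p'"
proof -
  have cH: "convex H" by (simp add: convex_halfspace_Im_ge)
  have "homotopic_paths H q q'"
  proof (rule homotopic_paths_linear)
    show "closed_segment (q t) (q' t) \<subseteq> H" if "t \<in> {0..1}" for t
      using liftsD(4)[OF q that] liftsD(4)[OF q' that] cH by (rule closed_segment_subset)
  qed (use liftsD(1)[OF q] liftsD(1)[OF q'] s in \<open>auto simp: pathstart_def pathfinish_def\<close>)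
  then have c: "homotopic_paths A (cov \<circ> q) (cov \<circ> q')"
    using continuous_cov cov_in by (rule_tac homotopic_paths_continuous_image) auto
  have eq: "homotopic_paths A p (cov \<circ> q)" if "lifts p q" for p q
    using lifts_path[OF that] liftsD(3)[OF that] by (intro homotopic_paths_eq) auto
  show ?thesis
    using eq[OF q] c homotopic_paths_sym[OF eq[OF q']] by (blast intro: homotopic_paths_trans)
qed

text \<open>
  The marked points seen in the universal covering: the real numbers above them form an increasing
  sequence which advances by \<open>2 * pi\<close> after \<open>m\<close> steps.
\<close>

lemma angles_exist:
  obtains \<theta> :: "int \<Rightarrow> real" where "strict_mono \<theta>" "\<And>k j. \<theta> (k + j * M) = \<theta> k + 2 * pi * j"
    "\<And>t. cov (of_real t) \<in> V \<longleftrightarrow> t \<in> range \<theta>"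
proof -
  define T where "T = {t. 0 \<le> t \<and> t < 2 * pi \<and> cov (of_real t) \<in> V}"
  have H: "complex_of_real t \<in> H" for t by simp
  have inj: "inj_on (\<lambda>t. cov (of_real t)) T"
  proof (rule inj_onI)
    fix s t assume st: "s \<in> T" "t \<in> T" "cov (complex_of_real s) = cov (complex_of_real t)"
    then obtain k :: int where "complex_of_real t = complex_of_real s + of_real (2 * pi * k)"
      using cov_eq_iff[OF H H] by blast
    then have k: "t = s + 2 * pi * k" by (metis of_real_add of_real_eq_iff)
    have "\<bar>2 * pi * k\<bar> < 2 * pi" using k st by (auto simp: T_def)
    then have "\<bar>real_of_int k\<bar> < 1" using pi_gt_zero by (simp add: abs_mult)
    then show "s = t" using k by simp
  qed
  have surj: "(\<lambda>t. cov (of_real t)) ` T = V"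
  proof
    show "(\<lambda>t. cov (of_real t)) ` T \<subseteq> V" by (auto simp: T_def)
    show "V \<subseteq> (\<lambda>t. cov (of_real t)) ` T"
    proof
      fix v assume v: "v \<in> V"
      then have vP: "v \<in> P" "norm (\<phi> v) = 1" using V(1) frontier_iff by auto
      let ?t = "Arg2pi (\<phi> v)"
      have "\<phi> v = exp (\<i> * of_real ?t)" using complex_norm_eq_1_exp[of "\<phi> v"] vP(2) by simp
      then have "cov (of_real ?t) = v" unfolding cov_def using \<psi>\<phi>[OF vP(1)] by simp
      moreover have "0 \<le> ?t" "?t < 2 * pi" using Arg2pi[of "\<phi> v"] by auto
      ultimately show "v \<in> (\<lambda>t. cov (of_real t)) ` T" using v by (intro image_eqI[of _ _ ?t]) (auto simp: T_def)
    qed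
  qed
  have bT: "bij_betw (\<lambda>t. cov (of_real t)) T V" using inj surj by (simp add: bij_betw_def)
  have finT: "finite T" using bT V(2) bij_betw_finite by blast
  have cT: "card T = m" using bij_betw_same_card[OF bT] V(3) by simp
  obtain w where w: "bij_betw w {0..<M} T" "\<And>i j. 0 \<le> i \<Longrightarrow> i < j \<Longrightarrow> j < M \<Longrightarrow> w i < w j"
  proof (rule enumerate_strict_order[of T "(<)", unfolded cT])
    show "finite T" by (rule finT)
  qed (auto intro: that)
  have M0: "0 < M" using m2 by simp
  define \<theta> where "\<theta> = (\<lambda>k. w (k mod M) + 2 * pi * of_int (k div M))"
  have wT: "w (k mod M) \<in> T" for k using w(1) M0 by (auto simp: bij_betw_def)
  have wb: "0 \<le> w (k mod M)" "w (k mod M) < 2 * pi" for k using wT[of k] by (auto simp: T_def)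
  have "\<theta> j < \<theta> k" if "j < k" for j k
  proof (cases "j div M = k div M")
    case True
    have "j mod M < k mod M"
      using that mult_div_mod_eq[of M j] mult_div_mod_eq[of M k, folded True] by linarith
    then show ?thesis using w(2)[of "j mod M" "k mod M"] M0 True by (simp add: \<theta>_def)
  next
    case False
    have "j div M \<le> k div M" using that M0 by (intro zdiv_mono1) auto
    then have "1 \<le> real_of_int (k div M) - real_of_int (j div M)" using False by linarith
    then have "2 * pi * 1 \<le> 2 * pi * (real_of_int (k div M) - real_of_int (j div M))"
      using pi_gt_zero by (intro mult_left_mono) auto
    then show ?thesis using wb[of j] wb[of k] by (simp add: \<theta>_def right_diff_distrib)
  qed
  then have 1: "strict_mono \<theta>" by (simp add: strict_mono_def)
  have 2: "\<theta> (k + j * M) = \<theta> k + 2 * pi * j" for k j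
    using M0 by (simp add: \<theta>_def algebra_simps)
  have 3: "cov (of_real t) \<in> V \<longleftrightarrow> t \<in> range \<theta>" for t
  proof -
    have per: "cov (of_real (s + 2 * pi * of_int k)) = cov (of_real s)" for s and k :: int
    proof -
      have "cov (of_real s) = cov (of_real (s + 2 * pi * of_int k))"
        by (subst cov_eq_iff[OF H H]) (intro exI[of _ k], simp)
      then show ?thesis by simp
    qed
    show ?thesis
    proof
      assume t: "cov (of_real t) \<in> V"
      define k where "k = \<lfloor>t / (2 * pi)\<rfloor>"
      define s where "s = t - 2 * pi * k"
      have "of_int k \<le> t / (2 * pi)" "t / (2 * pi) < of_int k + 1" by (auto simp: k_def)
      then have s: "0 \<le> s" "s < 2 * pi" using pi_gt_zero by (auto simp: s_def field_simps)
      have ts: "t = s + 2 * pi * k" by (simp add: s_def)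
      have "s \<in> T" using t s per[of s k] by (auto simp: T_def ts)
      then obtain i where i: "i \<in> {0..<M}" "w i = s" using w(1) by (auto simp: bij_betw_def)
      have "\<theta> i = s" using i by (simp add: \<theta>_def)
      then have "\<theta> (i + k * M) = t" using 2[of i k] ts by simp
      then show "t \<in> range \<theta>" by blast
    next
      assume "t \<in> range \<theta>"
      then obtain k where k: "t = \<theta> k" by blast
      have "cov (of_real t) = cov (of_real (w (k mod M)))" unfolding k \<theta>_def by (rule per)
      then show "cov (of_real t) \<in> V" using wT[of k] by (simp add: T_def)
    qed
  qed
  show thesis by (rule that[OF 1 2 3])
qed

end

locale punctured_polygon_angles = punctured_disc +
  fixes \<theta> :: "int \<Rightarrow> real"
  assumes mono: "strict_mono \<theta>" and period: "\<And>k j. \<theta> (k + j * M) = \<theta> k + 2 * pi * j"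
    and range_\<theta>: "\<And>t. cov (of_real t) \<in> V \<longleftrightarrow> t \<in> range \<theta>"
begin

lemma \<theta>_less: "\<theta> i < \<theta> j \<longleftrightarrow> i < j" using mono by (simp add: strict_mono_less)
lemma \<theta>_eq: "\<theta> i = \<theta> j \<longleftrightarrow> i = j" using mono by (simp add: strict_mono_eq)
lemma \<theta>_le: "\<theta> i \<le> \<theta> j \<longleftrightarrow> i \<le> j" using mono by (simp add: strict_mono_less_eq)

lemma M0: "0 < M" using m2 by simp

abbreviation vtx :: "int \<Rightarrow> complex" where "vtx k \<equiv> complex_of_real (\<theta> k)"

lemma vtx_H: "vtx k \<in> H" by simp

lemma cov_vtx: "cov (vtx k) \<in> V" using range_\<theta> by blast

lemma vtx_shift: "vtx (k + j * M) = vtx k + of_real (2 * pi * of_int j)" by (simp add: period)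

lemma cov_vtx_shift: "cov (vtx (k + j * M)) = cov (vtx k)"
proof -
  have "cov (vtx k) = cov (vtx (k + j * M))"
    unfolding cov_eq_iff[OF vtx_H vtx_H] using vtx_shift by blast
  then show ?thesis by simp
qed

lemma cov_in_V:
  assumes "z \<in> H" "cov z \<in> V" obtains k where "z = vtx k"
proof -
  have "Im z = 0" using assms cov_frontier V(1) by blast
  then have z: "z = complex_of_real (Re z)" by (simp add: complex_eq_iff)
  then have "Re z \<in> range \<theta>" using range_\<theta> assms(2) by metis
  then show thesis using that z by auto
qed

text \<open>
  The pair \<open>(i, j)\<close> is determined by the path up to a common multiple of \<open>M\<close>, and it determines the homotopy
  class.
\<close>

definition lifts_join :: "(real \<Rightarrow> complex) \<Rightarrow> int \<Rightarrow> int \<Rightarrow> bool" where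
  "lifts_join p i j \<longleftrightarrow> (\<exists>q. lifts p q \<and> q 0 = vtx i \<and> q 1 = vtx j)"

lemma joinsE:
  assumes "lifts_join p i j" obtains q where "lifts p q" "q 0 = vtx i" "q 1 = vtx j"
  using assms unfolding lifts_join_def by blast

lemma joins_shift: "lifts_join p i j \<Longrightarrow> lifts_join p (i + k * M) (j + k * M)"
  unfolding lifts_join_def vtx_shift using lifts_shift by (metis (no_types, lifting))

lemma joins_reverse: "lifts_join p i j \<Longrightarrow> lifts_join (reversepath p) j i"
  unfolding lifts_join_def using lifts_reverse by (metis cancel_comm_monoid_add_class.diff_cancel diff_zero reversepath_def)

lemma homotopic_iff:
  assumes p: "lifts_join p i j" and p': "lifts_join p' k l"
  shows "homotopic_paths A p p' \<longleftrightarrow> (\<exists>t. k = i + t * M \<and> l = j + t * M)"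
proof -
  obtain q where q: "lifts p q" "q 0 = vtx i" "q 1 = vtx j" using p by (rule joinsE)
  obtain q' where q': "lifts p' q'" "q' 0 = vtx k" "q' 1 = vtx l" using p' by (rule joinsE)
  show ?thesis
  proof
    assume h: "homotopic_paths A p p'"
    have "p 0 = p' 0" using homotopic_paths_imp_pathstart[OF h] by (simp add: pathstart_def)
    then have "cov (vtx i) = cov (vtx k)" using liftsD(3)[OF q(1), of 0] liftsD(3)[OF q'(1), of 0] q q' by simp
    then obtain t :: int where "vtx k = vtx i + of_real (2 * pi * t)" unfolding cov_eq_iff[OF vtx_H vtx_H] by blast
    then have "vtx k = vtx (i + t * M)" by (simp add: vtx_shift)
    then have k: "k = i + t * M" using \<theta>_eq by simp
    let ?q = "\<lambda>s. q s + of_real (2 * pi * of_int t)"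
    have "?q 1 = q' 1"
      by (rule homotopic_imp_lift_ends[OF h lifts_shift[OF q(1)] q'(1)]) (simp add: q q' k vtx_shift)
    then have "vtx (j + t * M) = vtx l" using q q' by (simp add: vtx_shift)
    then show "\<exists>t. k = i + t * M \<and> l = j + t * M" using k \<theta>_eq by auto
  next
    assume "\<exists>t. k = i + t * M \<and> l = j + t * M"
    then obtain t where t: "k = i + t * M" "l = j + t * M" by blast
    show "homotopic_paths A p p'"
      by (rule lift_ends_imp_homotopic[OF lifts_shift[OF q(1), of t] q'(1)]) (simp_all add: q q' t vtx_shift)
  qed
qed

abbreviation "emb \<equiv> embedded_arc P V x"

lemma emb_path:
  assumes "emb p" shows "path p" "path_image p \<subseteq> A"
proof -
  show "path p" using assms by (simp add: embedded_arc_def simple_path_imp_path)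
  show "path_image p \<subseteq> A"
  proof
    fix z assume "z \<in> path_image p"
    then obtain t where t: "t \<in> {0..1}" "z = p t" by (auto simp: path_image_def)
    have VA: "V \<subseteq> A" using V(1) frontier_iff \<phi>x by auto
    consider "t = 0" | "t = 1" | "t \<in> {0<..<1}" using t(1) by force
    then show "z \<in> A"
      using assms t VA interior_subset[of A] unfolding embedded_arc_def pathstart_def pathfinish_def
      by cases (auto simp: image_subset_iff)
  qed
qed

lemma emb_joins:
  assumes "emb p" obtains i j where "lifts_join p i j"
proof -
  obtain q where q: "lifts p q" using lift_exists[OF emb_path[OF assms]] .
  have "cov (q 0) \<in> V" "cov (q 1) \<in> V"
    using assms liftsD(3)[OF q, of 0] liftsD(3)[OF q, of 1] by (auto simp: embedded_arc_def pathstart_def pathfinish_def)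
  then obtain i j where "q 0 = vtx i" "q 1 = vtx j"
    using cov_in_V liftsD(4)[OF q, of 0] liftsD(4)[OF q, of 1] by (metis atLeastAtMost_iff order_refl zero_le_one)
  then show thesis using that q unfolding lifts_join_def by blast
qed

lemma emb_reverse:
  assumes "emb p" shows "emb (reversepath p)"
proof -
  have "reversepath p ` {0<..<1} \<subseteq> p ` {0<..<1}" by (auto simp: reversepath_def)
  then show ?thesis using assms unfolding embedded_arc_def by (auto simp: simple_path_reversepath)
qed

lemma emb_lift_Im:
  assumes "emb p" "lifts p q" "t \<in> {0<..<1}" shows "0 < Im (q t)"
proof -
  have "p t \<in> interior A" using assms by (auto simp: embedded_arc_def)
  moreover have "t \<in> {0..1}" using assms(3) by auto
  ultimately show ?thesis using cov_interior liftsD(3,4)[OF assms(2)] by metis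
qed

lemma emb_lift_ends:
  assumes "emb p" "lifts p q" "z \<in> path_image q" "Im z = 0" shows "z = q 0 \<or> z = q 1"
proof -
  obtain t where t: "t \<in> {0..1}" "z = q t" using assms(3) by (auto simp: path_image_def)
  then have "t \<notin> {0<..<1}" using emb_lift_Im[OF assms(1,2), of t] assms(4) by auto
  then have "t = 0 \<or> t = 1" using t(1) by auto
  then show ?thesis using t by blast
qed

lemma interlaced_lifts_meet:
  assumes q: "lifts p q" "q 0 = vtx i" "q 1 = vtx j" and q': "lifts p' q'" "q' 0 = vtx k" "q' 1 = vtx l"
    and ord: "i < k" "k < j" "j < l"
  obtains z where "z \<in> path_image q" "z \<in> path_image q'"
  by (rule upper_half_plane_paths_meet[of q q'])
    (use liftsD(1,2)[OF q(1)] liftsD(1,2)[OF q'(1)] q q' ord \<theta>_less in \<open>auto simp: pathstart_def pathfinish_def\<close>)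

lemma interlaced_arcs_meet:
  assumes p: "emb p" "lifts_join p i j" and p': "emb p'" "lifts_join p' k l" and ord: "i < k" "k < j" "j < l"
  shows "\<not> path_image p \<inter> path_image p' \<subseteq> V"
proof -
  obtain q where q: "lifts p q" "q 0 = vtx i" "q 1 = vtx j" using p(2) by (rule joinsE)
  obtain q' where q': "lifts p' q'" "q' 0 = vtx k" "q' 1 = vtx l" using p'(2) by (rule joinsE)
  obtain z where z: "z \<in> path_image q" "z \<in> path_image q'" by (rule interlaced_lifts_meet[OF q q' ord])
  have zH: "z \<in> H" using z liftsD(2)[OF q(1)] by blast
  have "Im z \<noteq> 0"
  proof
    assume "Im z = 0"
    then have "z = vtx i \<or> z = vtx j" "z = vtx k \<or> z = vtx l"
      using emb_lift_ends[OF p(1) q(1) z(1)] emb_lift_ends[OF p'(1) q'(1) z(2)] q q' by auto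
    then have "i = k \<or> i = l \<or> j = k \<or> j = l" using \<theta>_eq by auto
    then show False using ord by auto
  qed
  then have "cov z \<notin> V" using cov_frontier[OF zH] V(1) by blast
  moreover have "cov z \<in> path_image p" "cov z \<in> path_image p'"
    using z by (auto simp: lifts_path_image[OF q(1)] lifts_path_image[OF q'(1)])
  ultimately show ?thesis by blast
qed

text \<open>An arc that winds further than once around the puncture meets its own translate.\<close>

lemma emb_span:
  assumes p: "emb p" "lifts_join p i j" shows "j \<le> i + M"
proof (rule ccontr)
  assume neg: "\<not> j \<le> i + M"
  obtain q where q: "lifts p q" "q 0 = vtx i" "q 1 = vtx j" using p(2) by (rule joinsE)
  let ?q = "\<lambda>t. q t + of_real (2 * pi * of_int 1)"
  have q': "lifts p ?q" "?q 0 = vtx (i + 1 * M)" "?q 1 = vtx (j + 1 * M)"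
    using lifts_shift[OF q(1), of 1] q unfolding vtx_shift by auto
  obtain z where "z \<in> path_image q" "z \<in> path_image ?q"
    by (rule interlaced_lifts_meet[OF q q']) (use neg M0 in auto)
  then obtain s t where st: "s \<in> {0..1}" "t \<in> {0..1}" "q s = ?q t" by (auto simp: path_image_def)
  have "p s = p t" using st liftsD(3)[OF q(1) st(1)] liftsD(3)[OF q'(1) st(2)] by simp
  then have "s = t \<or> s = 0 \<and> t = 1 \<or> s = 1 \<and> t = 0"
    using p(1) st unfolding embedded_arc_def simple_path_def loop_free_def by blast
  moreover have "s \<noteq> t" using st(3) by auto
  moreover have "\<not> (s = 0 \<and> t = 1)"
  proof
    assume "s = 0 \<and> t = 1"
    then have "vtx i = vtx (j + 1 * M)" using st(3) q q' by metis
    then show False using \<theta>_eq neg M0 by auto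
  qed
  moreover have "\<not> (s = 1 \<and> t = 0)"
  proof
    assume "s = 1 \<and> t = 0"
    then have "vtx j = vtx (i + 1 * M)" using st(3) q q' by metis
    then show False using \<theta>_eq neg by auto
  qed
  ultimately show False by blast
qed

lemma edge_exists:
  assumes "j = i + 1 \<or> i = j + 1"
  obtains e where "polygon_edge P V e" "lifts_join e i j"
proof -
  define q where "q = linepath (vtx i) (vtx j)"
  have img: "path_image q = closed_segment (vtx i) (vtx j)" by (simp add: q_def)
  have pq: "path q" by (simp add: q_def)
  have qt: "q t = of_real ((1 - t) * \<theta> i + t * \<theta> j)" for t by (simp add: q_def linepath_def scaleR_conv_of_real)
  have Im0: "Im (q t) = 0" for t by (simp add: qt)
  then have H: "path_image q \<subseteq> H" by (auto simp: path_image_def)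
  have ne: "\<theta> i \<noteq> \<theta> j" using assms \<theta>_eq by auto
  have lt: "\<bar>\<theta> j - \<theta> i\<bar> < 2 * pi"
  proof -
    have "j < i + 1 * M" "i < j + 1 * M" using assms m2 by auto
    then have "\<theta> j < \<theta> (i + 1 * M)" "\<theta> i < \<theta> (j + 1 * M)" using \<theta>_less by blast+
    then show ?thesis unfolding period by auto
  qed
  have l: "lifts (cov \<circ> q) q" by (rule lifts_cov[OF pq H])
  have j: "lifts_join (cov \<circ> q) i j" unfolding lifts_join_def using l by (intro exI[of _ q]) (simp add: qt)
  have arc: "arc (cov \<circ> q)"
    unfolding arc_def
  proof
    show "path (cov \<circ> q)" by (rule path_cov[OF pq H])
    show "inj_on (cov \<circ> q) {0..1}"
    proof (rule inj_onI)
      fix s t :: real assume st: "s \<in> {0..1}" "t \<in> {0..1}" "(cov \<circ> q) s = (cov \<circ> q) t"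
      then obtain k :: int where "q t = q s + of_real (2 * pi * k)"
        using cov_eq_iff[of "q s" "q t"] Im0 by auto
      then have "(1 - t) * \<theta> i + t * \<theta> j = (1 - s) * \<theta> i + s * \<theta> j + 2 * pi * k"
        unfolding qt by (metis of_real_add of_real_eq_iff)
      then have k: "(t - s) * (\<theta> j - \<theta> i) = 2 * pi * k" by (simp add: algebra_simps)
      have "\<bar>t - s\<bar> * \<bar>\<theta> j - \<theta> i\<bar> \<le> 1 * \<bar>\<theta> j - \<theta> i\<bar>" using st by (intro mult_right_mono) auto
      then have "\<bar>2 * pi * k\<bar> < 2 * pi" using lt unfolding k[symmetric] abs_mult by simp
      then have "\<bar>real_of_int k\<bar> < 1" using pi_gt_zero by (simp add: abs_mult)
      then have "k = 0" by linarith
      then show "s = t" using k ne by simp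
    qed
  qed
  have fr: "path_image (cov \<circ> q) \<subseteq> frontier P"
    using cov_frontier Im0 by (auto simp: path_image_def)
  have "path_image (cov \<circ> q) \<inter> V = {pathstart (cov \<circ> q), pathfinish (cov \<circ> q)}"
  proof
    have "pathstart (cov \<circ> q) \<in> V" "pathfinish (cov \<circ> q) \<in> V"
      using cov_vtx by (simp_all add: pathstart_def pathfinish_def qt)
    then show "{pathstart (cov \<circ> q), pathfinish (cov \<circ> q)} \<subseteq> path_image (cov \<circ> q) \<inter> V"
      by blast
    show "path_image (cov \<circ> q) \<inter> V \<subseteq> {pathstart (cov \<circ> q), pathfinish (cov \<circ> q)}"
    proof
      fix z assume "z \<in> path_image (cov \<circ> q) \<inter> V"
      then obtain t where t: "t \<in> {0..1}" "z = cov (q t)" "cov (q t) \<in> V" by (auto simp: path_image_def)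
      then obtain k where "q t = vtx k" using cov_in_V Im0 by (metis mem_Collect_eq order_refl)
      then have k: "(1 - t) * \<theta> i + t * \<theta> j = \<theta> k" unfolding qt of_real_eq_iff .
      have "min (\<theta> i) (\<theta> j) \<le> \<theta> k" "\<theta> k \<le> max (\<theta> i) (\<theta> j)"
        unfolding k[symmetric] using t(1) convex_bound_le[of "\<theta> i" "max (\<theta> i) (\<theta> j)" "\<theta> j" "1 - t" t]
          convex_bound_le[of "- \<theta> i" "- min (\<theta> i) (\<theta> j)" "- \<theta> j" "1 - t" t] by (auto simp: algebra_simps)
      then have "min i j \<le> k \<and> k \<le> max i j" using \<theta>_le by (auto simp: min_def max_def split: if_splits)
      then have "k = i \<or> k = j" using assms by auto
      then show "z \<in> {pathstart (cov \<circ> q), pathfinish (cov \<circ> q)}"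
        using t(2) \<open>q t = vtx k\<close> by (auto simp: pathstart_def pathfinish_def qt)
    qed
  qed
  then have "polygon_edge P V (cov \<circ> q)" using arc fr by (simp add: polygon_edge_def)
  then show thesis using j by (rule that)
qed

text \<open>
  A lift of an edge runs injectively along the real line from one marked point to the next one.
\<close>

lemma edge_span:
  assumes e: "polygon_edge P V e" "lifts_join e i j"
  shows "\<not> (\<exists>k. i < k \<and> k < j \<or> j < k \<and> k < i)"
proof
  assume "\<exists>k. i < k \<and> k < j \<or> j < k \<and> k < i"
  then obtain k where k: "i < k \<and> k < j \<or> j < k \<and> k < i" by blast
  obtain q where q: "lifts e q" "q 0 = vtx i" "q 1 = vtx j" using e(2) by (rule joinsE)
  have cont: "continuous_on {0..1} (\<lambda>t. Re (q t))"
    using liftsD(1)[OF q(1)] unfolding path_def by (intro continuous_intros)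
  have "\<exists>t. 0 \<le> t \<and> t \<le> 1 \<and> Re (q t) = \<theta> k"
  proof (cases "i < k")
    case True
    then have "Re (q 0) \<le> \<theta> k" "\<theta> k \<le> Re (q 1)" using k q \<theta>_le by auto
    then show ?thesis using IVT'[of "\<lambda>t. Re (q t)" 0 "\<theta> k" 1] cont by auto
  next
    case False
    then have "Re (q 1) \<le> \<theta> k" "\<theta> k \<le> Re (q 0)" using k q \<theta>_le by auto
    then show ?thesis using IVT2'[of "\<lambda>t. Re (q t)" 1 "\<theta> k" 0] cont by auto
  qed
  then obtain t where t: "t \<in> {0..1}" "Re (q t) = \<theta> k" by auto
  have "e t \<in> frontier P" using e(1) t(1) by (auto simp: polygon_edge_def path_image_def)
  then have "Im (q t) = 0" using cov_frontier liftsD(3,4)[OF q(1) t(1)] by simp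
  then have qt: "q t = vtx k" using t(2) by (simp add: complex_eq_iff)
  then have "e t \<in> path_image e \<inter> V" using liftsD(3)[OF q(1) t(1)] cov_vtx in_path_image[OF t(1), of e] by simp
  then have "e t = e 0 \<or> e t = e 1" using e(1) by (auto simp: polygon_edge_def pathstart_def pathfinish_def)
  moreover have "inj_on e {0..1}" using e(1) by (simp add: polygon_edge_def arc_def)
  ultimately have "t = 0 \<or> t = 1" using t(1) inj_onD[of e "{0..1}" t 0] inj_onD[of e "{0..1}" t 1] by auto
  then have "k = i \<or> k = j" using qt q \<theta>_eq by auto
  then show False using k by auto
qed

lemma edge_joins: assumes "polygon_edge P V e" obtains i j where "lifts_join e i j"
proof -
  have e: "path e" "path_image e \<subseteq> frontier P" "e 0 \<in> V" "e 1 \<in> V"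
    using assms by (auto simp: polygon_edge_def arc_def pathstart_def pathfinish_def)
  have "path_image e \<subseteq> A" using e(2) frontier_iff \<phi>x by auto
  from lift_exists[OF e(1) this] obtain q where q: "lifts e q" .
  then obtain i j where "q 0 = vtx i" "q 1 = vtx j"
    using cov_in_V e liftsD(3,4)[OF q, of 0] liftsD(3,4)[OF q, of 1] by (metis atLeastAtMost_iff order_refl zero_le_one)
  then show thesis using that q unfolding lifts_join_def by blast
qed

lemma essential_iff:
  assumes p: "emb p" "lifts_join p i j"
  shows "essential_arc P V x p \<longleftrightarrow> i + 2 \<le> j \<or> j + 2 \<le> i"
proof
  assume ess: "essential_arc P V x p"
  show "i + 2 \<le> j \<or> j + 2 \<le> i"
  proof (rule ccontr)
    assume "\<not> ?thesis"
    then consider "j = i" | "j = i + 1 \<or> i = j + 1" by linarith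
    then show False
    proof cases
      case 1
      obtain q where q: "lifts p q" "q 0 = vtx i" "q 1 = vtx j" using p(2) by (rule joinsE)
      have "pathstart p = cov (vtx i)" using liftsD(3)[OF q(1), of 0] q by (simp add: pathstart_def)
      moreover have "lifts (\<lambda>_. cov (vtx i)) (\<lambda>_. vtx i)" by (simp add: lifts_def path_def path_image_def)
      ultimately have "homotopic_paths A p (\<lambda>_. pathstart p)"
        using lift_ends_imp_homotopic[OF q(1)] q 1 by simp
      then show False using ess by (simp add: essential_arc_def)
    next
      case 2
      obtain e where e: "polygon_edge P V e" "lifts_join e i j" using edge_exists[OF 2] .
      have "homotopic_paths A p e" using homotopic_iff[OF p(2) e(2)] by (metis add.right_neutral mult_zero_left)
      then show False using ess e by (simp add: essential_arc_def)
    qed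
  qed
next
  assume ij: "i + 2 \<le> j \<or> j + 2 \<le> i"
  have "\<not> homotopic_paths A p (\<lambda>_. pathstart p)"
  proof
    assume h: "homotopic_paths A p (\<lambda>_. pathstart p)"
    obtain q where q: "lifts p q" "q 0 = vtx i" "q 1 = vtx j" using p(2) by (rule joinsE)
    have s: "pathstart p = cov (vtx i)" using liftsD(3)[OF q(1), of 0] q by (simp add: pathstart_def)
    have "lifts (\<lambda>_. pathstart p) (\<lambda>_. vtx i)" unfolding s by (simp add: lifts_def path_def path_image_def)
    then have "q 1 = vtx i" using homotopic_imp_lift_ends[OF h q(1)] q by simp
    then show False using q ij \<theta>_eq by auto
  qed
  moreover have "\<not> homotopic_paths A p e" if e: "polygon_edge P V e" for e
  proof
    assume h: "homotopic_paths A p e"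
    obtain k l where kl: "lifts_join e k l" using edge_joins[OF e] .
    obtain t where "k = i + t * M" "l = j + t * M" using homotopic_iff[OF p(2) kl] h by blast
    then have "k < k + 1 \<and> k + 1 < l \<or> l < l + 1 \<and> l + 1 < k" using ij by auto
    then show False using edge_span[OF e kl] by blast
  qed
  ultimately show "essential_arc P V x p" using p(1) by (simp add: essential_arc_def)
qed

lemma class_iff:
  assumes p: "lifts_join p i j" and p': "emb p'" "lifts_join p' k l"
  shows "p' \<in> arc_class P V x p \<longleftrightarrow> (\<exists>t. (k = i + t * M \<and> l = j + t * M) \<or> (k = j + t * M \<and> l = i + t * M))"
  using homotopic_iff[OF p p'(2)] homotopic_iff[OF joins_reverse[OF p] p'(2)] p'(1)
  unfolding arc_class_def by blast

lemma class_emb: "p' \<in> arc_class P V x p \<Longrightarrow> emb p'" by (simp add: arc_class_def)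

lemma class_eq:
  assumes p: "lifts_join p i j" and q: "lifts_join q k l"
    and kl: "(k = i + t * M \<and> l = j + t * M) \<or> (k = j + t * M \<and> l = i + t * M)"
  shows "arc_class P V x p = arc_class P V x q"
proof (rule set_eqI)
  fix r
  show "r \<in> arc_class P V x p \<longleftrightarrow> r \<in> arc_class P V x q"
  proof (cases "emb r")
    case False then show ?thesis using class_emb by blast
  next
    case True
    then obtain a b where r: "lifts_join r a b" by (rule emb_joins)
    have ex: "(\<exists>s. Q (s + t)) \<longleftrightarrow> (\<exists>s. Q s)" for Q :: "int \<Rightarrow> bool" by (metis diff_add_cancel)
    have "r \<in> arc_class P V x q \<longleftrightarrow> (\<exists>s. (a = i + (s + t) * M \<and> b = j + (s + t) * M) \<or> (a = j + (s + t) * M \<and> b = i + (s + t) * M))"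
      unfolding class_iff[OF q True r] using kl by (auto simp: algebra_simps)
    also have "\<dots> \<longleftrightarrow> r \<in> arc_class P V x p" unfolding class_iff[OF p True r] by (rule ex)
    finally show ?thesis by simp
  qed
qed

text \<open>
  Parabolas over the real line. As they all have the same leading coefficient, two of them whose
  endpoints do not interlace lie one strictly below the other inside the upper half plane, or
  side by side.
\<close>

definition parabola :: "int \<times> int \<Rightarrow> real \<Rightarrow> complex" where
  "parabola d t = Complex (\<theta> (fst d) + (\<theta> (snd d) - \<theta> (fst d)) * t) ((\<theta> (snd d) - \<theta> (fst d))\<^sup>2 * (t * (1 - t)))"

definition std_arc :: "int \<times> int \<Rightarrow> real \<Rightarrow> complex" where "std_arc d = cov \<circ> parabola d"

lemma path_parabola: "path (parabola d)"
proof -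
  have "parabola d = (\<lambda>t. of_real (\<theta> (fst d) + (\<theta> (snd d) - \<theta> (fst d)) * t) + \<i> * of_real ((\<theta> (snd d) - \<theta> (fst d))\<^sup>2 * (t * (1 - t))))"
    by (rule ext) (simp add: parabola_def complex_eq_iff)
  then show ?thesis unfolding path_def by (simp only:) (intro continuous_intros)
qed

lemma parabola_H: "path_image (parabola d) \<subseteq> H"
  by (auto simp: path_image_def parabola_def)

lemma parabola_ends: "parabola d 0 = vtx (fst d)" "parabola d 1 = vtx (snd d)"
  by (simp_all add: parabola_def complex_eq_iff)

lemma std_joins: "lifts_join (std_arc d) (fst d) (snd d)"
  unfolding lifts_join_def std_arc_def using lifts_cov[OF path_parabola parabola_H] parabola_ends by blast

lemma parabola_Im: "Im (parabola d t) = (Re (parabola d t) - \<theta> (fst d)) * (\<theta> (snd d) - Re (parabola d t))"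
  by (simp add: parabola_def algebra_simps power2_eq_square)

lemma emb_std:
  assumes d: "fst d < snd d" "snd d \<le> fst d + M"
  shows "emb (std_arc d)"
proof -
  let ?w = "\<theta> (snd d) - \<theta> (fst d)"
  have w: "0 < ?w" using d \<theta>_less by simp
  have w2: "?w \<le> 2 * pi"
  proof -
    have "\<theta> (snd d) \<le> \<theta> (fst d + 1 * M)" using d \<theta>_le by simp
    then show ?thesis unfolding period by simp
  qed
  have inH: "parabola d t \<in> H" if "t \<in> {0..1}" for t
    using parabola_H in_path_image[OF that] by blast
  have "simple_path (std_arc d)"
    unfolding simple_path_def loop_free_def
  proof (intro conjI ballI impI)
    show "path (std_arc d)" unfolding std_arc_def by (rule path_cov[OF path_parabola parabola_H])
    fix s t :: real assume st: "s \<in> {0..1}" "t \<in> {0..1}" "std_arc d s = std_arc d t"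
    then obtain k :: int where k: "parabola d t = parabola d s + of_real (2 * pi * k)"
      using cov_eq_iff[OF inH[OF st(1)] inH[OF st(2)]] by (auto simp: std_arc_def)
    then have "Re (parabola d t) = Re (parabola d s) + 2 * pi * k" by simp
    then have e: "?w * (t - s) = 2 * pi * k" by (simp add: parabola_def algebra_simps)
    show "s = t \<or> s = 0 \<and> t = 1 \<or> s = 1 \<and> t = 0"
    proof (cases "k = 0")
      case True then show ?thesis using e w by simp
    next
      case False
      then have "2 * pi * 1 \<le> 2 * pi * \<bar>real_of_int k\<bar>" using pi_gt_zero by (intro mult_left_mono) auto
      then have "2 * pi \<le> \<bar>?w * (t - s)\<bar>" unfolding e using pi_gt_zero by (simp add: abs_mult)
      also have "\<dots> = ?w * \<bar>t - s\<bar>" using w by (simp add: abs_mult)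
      also have "\<dots> \<le> 2 * pi * \<bar>t - s\<bar>" using w2 by (intro mult_right_mono) auto
      finally have "1 \<le> \<bar>t - s\<bar>" using pi_gt_zero by (simp add: mult_le_cancel_left1)
      then show ?thesis using st by auto
    qed
  qed
  moreover have "pathstart (std_arc d) \<in> V" "pathfinish (std_arc d) \<in> V"
    using cov_vtx by (simp_all add: pathstart_def pathfinish_def std_arc_def parabola_ends)
  moreover have "std_arc d ` {0<..<1} \<subseteq> interior A"
  proof
    fix z assume "z \<in> std_arc d ` {0<..<1}"
    then obtain t where t: "t \<in> {0<..<1}" "z = cov (parabola d t)" by (auto simp: std_arc_def)
    have "0 < Im (parabola d t)" using t w by (simp add: parabola_def)
    then show "z \<in> interior A" unfolding t(2) using cov_interior by simp
  qed
  ultimately show ?thesis by (simp add: embedded_arc_def)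
qed

lemma parabola_in: "t \<in> {0..1} \<Longrightarrow> fst d < snd d \<Longrightarrow> \<theta> (fst d) \<le> Re (parabola d t) \<and> Re (parabola d t) \<le> \<theta> (snd d)"
proof -
  assume t: "t \<in> {0..1}" and d: "fst d < snd d"
  have w: "0 \<le> \<theta> (snd d) - \<theta> (fst d)" using d \<theta>_less[of "fst d" "snd d"] by simp
  have "0 \<le> (\<theta> (snd d) - \<theta> (fst d)) * t" "(\<theta> (snd d) - \<theta> (fst d)) * t \<le> (\<theta> (snd d) - \<theta> (fst d)) * 1"
    using w t by (simp, intro mult_left_mono) auto
  then show ?thesis by (simp add: parabola_def)
qed

lemma std_disjoint:
  assumes d: "fst d < snd d" and e: "fst e < snd e"
    and nc: "\<And>k. \<not> crosses d (shift_arc M k e)" and neq: "\<And>k. d \<noteq> shift_arc M k e"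
  shows "path_image (std_arc d) \<inter> path_image (std_arc e) \<subseteq> V"
proof
  fix y assume "y \<in> path_image (std_arc d) \<inter> path_image (std_arc e)"
  then obtain s t where st: "s \<in> {0..1}" "t \<in> {0..1}" "y = cov (parabola d s)" "y = cov (parabola e t)"
    by (auto simp: path_image_def std_arc_def)
  have inH: "parabola d t \<in> H" if "t \<in> {0..1}" for d t
    using parabola_H in_path_image[OF that] by blast
  obtain k :: int where k: "parabola d s = parabola e t + of_real (2 * pi * k)"
    using cov_eq_iff[OF inH[OF st(2)] inH[OF st(1)], of e d] st by auto
  let ?e = "shift_arc M k e"
  have ef: "\<theta> (fst ?e) = \<theta> (fst e) + 2 * pi * k" "\<theta> (snd ?e) = \<theta> (snd e) + 2 * pi * k"
    by (simp_all add: shift_arc_def period)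
  have "parabola d s = parabola ?e t"
    unfolding k by (simp add: parabola_def ef complex_eq_iff algebra_simps)
  then have eq: "parabola d s = parabola ?e t" .
  define X where "X = Re (parabola d s)"
  define Y where "Y = Im (parabola d s)"
  have lte: "fst ?e < snd ?e" using e by (simp add: shift_arc_def)
  have Y1: "Y = (X - \<theta> (fst d)) * (\<theta> (snd d) - X)" unfolding X_def Y_def by (rule parabola_Im)
  have Y2: "Y = (X - \<theta> (fst ?e)) * (\<theta> (snd ?e) - X)" unfolding X_def Y_def eq by (rule parabola_Im)
  have X1: "\<theta> (fst d) \<le> X" "X \<le> \<theta> (snd d)" using parabola_in[OF st(1) d] by (auto simp: X_def)
  have X2: "\<theta> (fst ?e) \<le> X" "X \<le> \<theta> (snd ?e)" using parabola_in[OF st(2) lte] by (auto simp: X_def eq)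
  show "y \<in> V"
  proof (cases "Y = 0")
    case True
    then have "X = \<theta> (fst d) \<or> X = \<theta> (snd d)" using Y1 by auto
    moreover have "parabola d s = of_real X" using True by (simp add: X_def Y_def complex_eq_iff)
    ultimately show ?thesis using st(3) cov_vtx by auto
  next
    case False
    have "X \<noteq> \<theta> (fst d)" "X \<noteq> \<theta> (snd d)" using False Y1 by auto
    moreover have "X \<noteq> \<theta> (fst ?e)" "X \<noteq> \<theta> (snd ?e)" using False unfolding Y2 by auto
    ultimately have strict: "\<theta> (fst d) < X" "X < \<theta> (snd d)" "\<theta> (fst ?e) < X" "X < \<theta> (snd ?e)"
      using X1 X2 by linarith+
    then have ov: "fst d < snd ?e" "fst ?e < snd d" using \<theta>_less by (meson less_trans)+
    have nested: False if d': "fst d \<le> fst e'" "snd e' \<le> snd d" "d \<noteq> e'"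
        and Y: "(X - \<theta> (fst d)) * (\<theta> (snd d) - X) = (X - \<theta> (fst e')) * (\<theta> (snd e') - X)"
        and s: "\<theta> (fst e') < X" "X < \<theta> (snd e')" for d e'
    proof -
      have le: "\<theta> (fst d) \<le> \<theta> (fst e')" "\<theta> (snd e') \<le> \<theta> (snd d)" using d' \<theta>_le by auto
      have "\<theta> (fst d) < \<theta> (fst e') \<or> \<theta> (snd e') < \<theta> (snd d)"
        using d' \<theta>_less by (metis order_le_less prod_eq_iff)
      then show False
      proof
        assume "\<theta> (fst d) < \<theta> (fst e')"
        then have "(X - \<theta> (fst e')) * (\<theta> (snd e') - X) < (X - \<theta> (fst d)) * (\<theta> (snd e') - X)"
          using s by (intro mult_strict_right_mono) auto
        also have "\<dots> \<le> (X - \<theta> (fst d)) * (\<theta> (snd d) - X)" using le s by (intro mult_left_mono) auto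
        finally show False using Y by simp
      next
        assume "\<theta> (snd e') < \<theta> (snd d)"
        then have "(X - \<theta> (fst e')) * (\<theta> (snd e') - X) < (X - \<theta> (fst e')) * (\<theta> (snd d) - X)"
          using s by (intro mult_strict_left_mono) auto
        also have "\<dots> \<le> (X - \<theta> (fst d)) * (\<theta> (snd d) - X)" using le s by (intro mult_right_mono) auto
        finally show False using Y by simp
      qed
    qed
    have "(fst d \<le> fst ?e \<and> snd ?e \<le> snd d) \<or> (fst ?e \<le> fst d \<and> snd d \<le> snd ?e)"
      using nc[of k] ov unfolding crosses_def by linarith
    then show ?thesis
      using nested[of d ?e] nested[of ?e d] neq[of k] Y1 Y2 strict by auto
  qed
qed

definition arc_of :: "int \<times> int \<Rightarrow> (real \<Rightarrow> complex) set" where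
  "arc_of d = arc_class P V x (std_arc d)"

abbreviation "D \<equiv> periodic_arcs M"

lemma D_iff: "(a, b) \<in> D \<longleftrightarrow> 0 \<le> a \<and> a < M \<and> a + 2 \<le> b \<and> b \<le> a + M" by (simp add: periodic_arcs_def)

lemma D_emb: "d \<in> D \<Longrightarrow> emb (std_arc d)" by (rule emb_std) (auto simp: periodic_arcs_def)

lemma std_in_arc_of: "d \<in> D \<Longrightarrow> std_arc d \<in> arc_of d"
  unfolding arc_of_def using class_iff[OF std_joins D_emb std_joins, of d d] by (metis add.right_neutral mult_zero_left)

lemma D_shift_eq:
  assumes "d \<in> D" "e \<in> D" "e = shift_arc M t d" shows "d = e"
  using reduce_shift[OF M0, of t d] reduce_rep[OF assms(1)] reduce_rep[OF assms(2)] assms(3) by metis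

lemma arc_of_cases:
  assumes p: "p \<in> arc_of d"
  obtains t where "lifts_join p (fst d + t * M) (snd d + t * M)" | t where "lifts_join (reversepath p) (fst d + t * M) (snd d + t * M)"
proof -
  have e: "emb p" using p class_emb by (simp add: arc_of_def)
  obtain k l where kl: "lifts_join p k l" using emb_joins[OF e] .
  obtain t where "(k = fst d + t * M \<and> l = snd d + t * M) \<or> (k = snd d + t * M \<and> l = fst d + t * M)"
    using class_iff[OF std_joins e kl] p unfolding arc_of_def by blast
  then show thesis using that kl joins_reverse[OF kl] by blast
qed

lemma arc_of_rep:
  assumes p: "p \<in> arc_of d"
  obtains p' where "emb p'" "path_image p' = path_image p" "lifts_join p' (fst d + k * M) (snd d + k * M)"
proof -
  have e: "emb p" using p class_emb by (simp add: arc_of_def)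
  have sh: "a + t * M + (k - t) * M = a + k * M" for a t by (simp add: algebra_simps)
  show thesis
    using p
  proof (rule arc_of_cases)
    fix t assume "lifts_join p (fst d + t * M) (snd d + t * M)"
    from joins_shift[OF this, of "k - t"] show thesis using that[OF e refl] unfolding sh by blast
  next
    fix t assume "lifts_join (reversepath p) (fst d + t * M) (snd d + t * M)"
    from joins_shift[OF this, of "k - t"] show thesis using that[OF emb_reverse[OF e] path_image_reversepath] unfolding sh by blast
  qed
qed

lemma inj_arc_of: "inj_on arc_of D"
proof (rule inj_onI)
  fix d e assume d: "d \<in> D" and e: "e \<in> D" and eq: "arc_of d = arc_of e"
  have "std_arc e \<in> arc_class P V x (std_arc d)" using std_in_arc_of[OF e] eq by (simp add: arc_of_def)
  then obtain t where t: "(fst e = fst d + t * M \<and> snd e = snd d + t * M) \<or> (fst e = snd d + t * M \<and> snd e = fst d + t * M)"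
    using class_iff[OF std_joins D_emb[OF e] std_joins] by blast
  have "fst d < snd d" "fst e < snd e" using d e by (auto simp: periodic_arcs_def)
  then have "e = shift_arc M t d" using t by (auto simp: shift_arc_def prod_eq_iff)
  then show "d = e" by (rule D_shift_eq[OF d e])
qed

lemma diagonals_eq: "punctured_diagonals P V x = arc_of ` D"
proof (intro equalityI subsetI)
  fix c assume "c \<in> punctured_diagonals P V x"
  then obtain p where p: "essential_arc P V x p" "c = arc_class P V x p" by (auto simp: punctured_diagonals_def)
  have e: "emb p" using p(1) by (simp add: essential_arc_def)
  obtain i j where ij: "lifts_join p i j" using emb_joins[OF e] .
  have span: "j \<le> i + M" "i \<le> j + M" using emb_span[OF e ij] emb_span[OF emb_reverse[OF e] joins_reverse[OF ij]] by auto
  have *: "\<exists>d\<in>D. arc_class P V x p = arc_of d"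
    if kl: "(k = i \<and> l = j) \<or> (k = j \<and> l = i)" "k + 2 \<le> l" "l \<le> k + M" for k l
  proof
    let ?d = "reduce M (k, l)"
    have d: "?d = (k + - (k div M) * M, l + - (k div M) * M)" by (simp add: reduce_def shift_arc_def)
    have "(k, l) \<in> arcs_in k (k + M)" using kl by (simp add: arcs_in_iff)
    then show "?d \<in> D" by (rule reduce_in[OF M0])
    show "arc_class P V x p = arc_of ?d"
      unfolding arc_of_def using kl(1) by (intro class_eq[OF ij std_joins, where t = "- (k div M)"]) (auto simp: d)
  qed
  have "i + 2 \<le> j \<or> j + 2 \<le> i" using essential_iff[OF e ij] p(1) by simp
  then have "\<exists>d\<in>D. arc_class P V x p = arc_of d" using *[of i j] *[of j i] span by blast
  then show "c \<in> arc_of ` D" using p(2) by blast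
next
  fix c assume "c \<in> arc_of ` D"
  then obtain d where d: "d \<in> D" "c = arc_of d" by blast
  have "essential_arc P V x (std_arc d)"
    using essential_iff[OF D_emb[OF d(1)] std_joins] d(1) by (auto simp: periodic_arcs_def)
  then show "c \<in> punctured_diagonals P V x" using d(2) unfolding punctured_diagonals_def arc_of_def by blast
qed

text \<open>
  Disjoint representatives have noninterlacing lifts. Conversely the projected parabolas are
  disjoint representatives of all classes of a noncrossing system at the same time.
\<close>

lemma realizable_iff:
  assumes S: "S \<subseteq> D"
  shows "(\<exists>r. (\<forall>d\<in>arc_of ` S. r d \<in> d) \<and> pairwise (\<lambda>d e. path_image (r d) \<inter> path_image (r e) \<subseteq> V) (arc_of ` S))
    \<longleftrightarrow> (\<forall>d\<in>S. \<forall>e\<in>S. \<forall>k. \<not> crosses d (shift_arc M k e))" (is "?L \<longleftrightarrow> ?R")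
proof
  assume ?L
  then obtain r where r: "\<And>d. d \<in> S \<Longrightarrow> r (arc_of d) \<in> arc_of d"
    and pw: "pairwise (\<lambda>d e. path_image (r d) \<inter> path_image (r e) \<subseteq> V) (arc_of ` S)" by blast
  have cr: False if d: "d \<in> S" "e \<in> S" "d \<noteq> e" and
    c: "fst d + i * M < fst e + j * M" "fst e + j * M < snd d + i * M" "snd d + i * M < snd e + j * M" for d e i j
  proof -
    obtain p where p: "emb p" "path_image p = path_image (r (arc_of d))" "lifts_join p (fst d + i * M) (snd d + i * M)"
      using arc_of_rep[OF r[OF d(1)]] by blast
    obtain p' where p': "emb p'" "path_image p' = path_image (r (arc_of e))" "lifts_join p' (fst e + j * M) (snd e + j * M)"
      using arc_of_rep[OF r[OF d(2)]] by blast
    have "arc_of d \<noteq> arc_of e" using inj_onD[OF inj_arc_of, of d e] d S by blast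
    then have "path_image p \<inter> path_image p' \<subseteq> V" using pw d p(2) p'(2) by (auto simp: pairwise_def)
    then show False using interlaced_arcs_meet[OF p(1,3) p'(1,3) c] by blast
  qed
  show ?R
  proof (intro ballI allI)
    fix d e k assume de: "d \<in> S" "e \<in> S"
    show "\<not> crosses d (shift_arc M k e)"
    proof (cases "d = e")
      case True
      have D: "fst d + 2 \<le> snd d" "snd d \<le> fst d + M" using de(1) S by (auto simp: periodic_arcs_def)
      consider "k = 0" | "1 \<le> k" | "k \<le> -1" by linarith
      then show ?thesis
      proof cases
        case 1 then show ?thesis using True not_crosses_self by simp
      next
        case 2
        then have "M \<le> k * M" using M0 by simp
        then show ?thesis using D unfolding True[symmetric] crosses_def shift_arc_def fst_conv snd_conv by linarith
      next
        case 3
        then have "k * M \<le> -1 * M" using M0 by (intro mult_right_mono) auto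
        then show ?thesis using D unfolding True[symmetric] crosses_def shift_arc_def fst_conv snd_conv by linarith
      qed
    next
      case False
      then show ?thesis using cr[OF de False, of 0 k] cr[OF de(2,1) False[symmetric], of k 0]
        unfolding crosses_def shift_arc_def by auto
    qed
  qed
next
  assume R: ?R
  let ?r = "\<lambda>c. std_arc (inv_into S arc_of c)"
  have injS: "inj_on arc_of S" using inj_arc_of S by (rule inj_on_subset)
  have inv: "inv_into S arc_of (arc_of d) = d" if "d \<in> S" for d using injS that by (rule inv_into_f_f)
  have "\<forall>c\<in>arc_of ` S. ?r c \<in> c" using inv std_in_arc_of S by auto
  moreover have "pairwise (\<lambda>c c'. path_image (?r c) \<inter> path_image (?r c') \<subseteq> V) (arc_of ` S)"
    unfolding pairwise_def
  proof (intro ballI impI)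
    fix c c' assume c: "c \<in> arc_of ` S" "c' \<in> arc_of ` S" "c \<noteq> c'"
    then obtain d e where de: "d \<in> S" "e \<in> S" "c = arc_of d" "c' = arc_of e" by blast
    have D: "d \<in> D" "e \<in> D" using de S by blast+
    have lt: "fst d < snd d" "fst e < snd e" using D by (auto simp: periodic_arcs_def)
    have "path_image (std_arc d) \<inter> path_image (std_arc e) \<subseteq> V"
    proof (rule std_disjoint[OF lt])
      show "\<not> crosses d (shift_arc M k e)" for k using R de by blast
      show "d \<noteq> shift_arc M k e" for k using D_shift_eq[OF D(2,1), of k] de c(3) by auto
    qed
    then show "path_image (?r c) \<inter> path_image (?r c') \<subseteq> V" unfolding de(3,4) inv[OF de(1)] inv[OF de(2)] .
  qed
  ultimately show ?L by (intro exI[of _ ?r] conjI)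
qed

lemma blue_iff:
  assumes RB: "bicolouring V R B" and d: "d \<in> D"
  shows "(\<forall>p\<in>arc_of d. pathstart p \<in> B \<or> pathfinish p \<in> B) \<longleftrightarrow>
    fst d \<notin> {k. cov (vtx k) \<in> R} \<or> snd d \<notin> {k. cov (vtx k) \<in> R}"
proof -
  have col: "cov (vtx k) \<in> B \<longleftrightarrow> cov (vtx k) \<notin> R" for k
    using RB cov_vtx[of k] unfolding bicolouring_def by blast
  have ends: "pathstart p = cov (vtx i)" "pathfinish p = cov (vtx j)" if j: "lifts_join p i j" for p i j
  proof -
    obtain q where q: "lifts p q" "q 0 = vtx i" "q 1 = vtx j" using j by (rule joinsE)
    show "pathstart p = cov (vtx i)" "pathfinish p = cov (vtx j)"
      using liftsD(3)[OF q(1), of 0] liftsD(3)[OF q(1), of 1] q by (simp_all add: pathstart_def pathfinish_def)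
  qed
  have ep: "(pathstart p \<in> B \<or> pathfinish p \<in> B) \<longleftrightarrow> (cov (vtx (fst d)) \<in> B \<or> cov (vtx (snd d)) \<in> B)"
    if p: "p \<in> arc_of d" for p
    using p
  proof (rule arc_of_cases)
    fix t assume "lifts_join p (fst d + t * M) (snd d + t * M)"
    from ends[OF this] show ?thesis by (simp add: cov_vtx_shift)
  next
    fix t assume "lifts_join (reversepath p) (fst d + t * M) (snd d + t * M)"
    from ends[OF this] show ?thesis by (auto simp: cov_vtx_shift)
  qed
  have "(\<forall>p\<in>arc_of d. pathstart p \<in> B \<or> pathfinish p \<in> B) \<longleftrightarrow> (cov (vtx (fst d)) \<in> B \<or> cov (vtx (snd d)) \<in> B)"
    using ep std_in_arc_of[OF d] by blast
  then show ?thesis by (simp add: col)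
qed

lemma punctured_Y_eq:
  assumes RB: "bicolouring V R B"
  shows "punctured_Y_complex P V x B = (`) arc_of ` periodic_complex M {k. cov (vtx k) \<in> R}"
proof -
  let ?R = "{k. cov (vtx k) \<in> R}"
  have col: "(\<forall>(a, b)\<in>S. a \<notin> ?R \<or> b \<notin> ?R) \<longleftrightarrow> (\<forall>d\<in>arc_of ` S. \<forall>p\<in>d. pathstart p \<in> B \<or> pathfinish p \<in> B)"
    if S: "S \<subseteq> D" for S
  proof -
    have "(\<forall>(a, b)\<in>S. a \<notin> ?R \<or> b \<notin> ?R) \<longleftrightarrow> (\<forall>d\<in>S. fst d \<notin> ?R \<or> snd d \<notin> ?R)"
      by (simp only: case_prod_unfold)
    also have "\<dots> \<longleftrightarrow> (\<forall>d\<in>S. \<forall>p\<in>arc_of d. pathstart p \<in> B \<or> pathfinish p \<in> B)"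
      by (rule ball_cong[OF refl], rule blue_iff[OF RB, symmetric], rule subsetD[OF S])
    finally show ?thesis by simp
  qed
  show ?thesis
  proof (intro equalityI subsetI)
    fix \<sigma> assume s: "\<sigma> \<in> punctured_Y_complex P V x B"
    then have s1: "\<sigma> \<in> punctured_arc_complex P V x" and s2: "\<forall>d\<in>\<sigma>. \<forall>p\<in>d. pathstart p \<in> B \<or> pathfinish p \<in> B"
      unfolding punctured_Y_complex_def by blast+
    have s3: "\<sigma> \<noteq> {}" "\<sigma> \<subseteq> arc_of ` D"
      "\<exists>r. (\<forall>d\<in>\<sigma>. r d \<in> d) \<and> pairwise (\<lambda>d e. path_image (r d) \<inter> path_image (r e) \<subseteq> V) \<sigma>"
      using s1 unfolding punctured_arc_complex_def diagonals_eq by blast+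
    obtain S where S: "S \<subseteq> D" "\<sigma> = arc_of ` S" using s3(2) by (metis subset_imageE)
    have "S \<in> periodic_complex M ?R"
      unfolding periodic_complex_def
    proof (intro CollectI conjI S(1))
      show "S \<noteq> {}" using s3(1) S(2) by blast
      show "\<forall>d\<in>S. \<forall>e\<in>S. \<forall>k. \<not> crosses d (shift_arc M k e)"
        using s3(3) unfolding S(2) realizable_iff[OF S(1)] .
      show "\<forall>(a, b)\<in>S. a \<notin> ?R \<or> b \<notin> ?R" using s2 unfolding S(2) col[OF S(1)] .
    qed
    then show "\<sigma> \<in> (`) arc_of ` periodic_complex M ?R" using S(2) by blast
  next
    fix \<sigma> assume "\<sigma> \<in> (`) arc_of ` periodic_complex M ?R"
    then obtain S where S: "S \<in> periodic_complex M ?R" "\<sigma> = arc_of ` S" by blast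
    have SD: "S \<subseteq> D" "S \<noteq> {}" "\<forall>d\<in>S. \<forall>e\<in>S. \<forall>k. \<not> crosses d (shift_arc M k e)" "\<forall>(a, b)\<in>S. a \<notin> ?R \<or> b \<notin> ?R"
      using S(1) unfolding periodic_complex_def by blast+
    show "\<sigma> \<in> punctured_Y_complex P V x B"
      unfolding punctured_Y_complex_def punctured_arc_complex_def diagonals_eq S(2)
    proof (intro CollectI conjI)
      show "arc_of ` S \<noteq> {}" using SD(2) by blast
      show "finite (arc_of ` S)" using SD(1) finite_periodic_arcs finite_subset by blast
      show "arc_of ` S \<subseteq> arc_of ` D" using SD(1) by blast
      show "\<exists>r. (\<forall>d\<in>arc_of ` S. r d \<in> d) \<and> pairwise (\<lambda>d e. path_image (r d) \<inter> path_image (r e) \<subseteq> V) (arc_of ` S)"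
        unfolding realizable_iff[OF SD(1)] by (rule SD(3))
      show "\<forall>d\<in>arc_of ` S. \<forall>p\<in>d. pathstart p \<in> B \<or> pathfinish p \<in> B"
        using SD(4) unfolding col[OF SD(1)] .
    qed
  qed
qed

lemma punctured_Y_ball:
  assumes RB: "bicolouring V R B"
  shows "is_closed_ball (punctured_Y_complex P V x B) (m - 2)"
proof -
  let ?R = "{k. cov (vtx k) \<in> R}"
  have onV: "\<exists>k. cov (vtx k) = v" if "v \<in> V" for v
  proof -
    have vP: "v \<in> P" "norm (\<phi> v) = 1" using that V(1) frontier_iff by auto
    let ?t = "Arg2pi (\<phi> v)"
    have "\<phi> v = exp (\<i> * of_real ?t)" using complex_norm_eq_1_exp[of "\<phi> v"] vP(2) by simp
    then have c: "cov (of_real ?t) = v" unfolding cov_def using \<psi>\<phi>[OF vP(1)] by simp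
    then have "?t \<in> range \<theta>" using range_\<theta>[of ?t] that by simp
    then show ?thesis using c by auto
  qed
  obtain vr vb where "vr \<in> R" "vb \<in> B" "vr \<in> V" "vb \<in> V" "vb \<notin> R" using RB unfolding bicolouring_def by blast
  then obtain r j0 where r: "r \<in> ?R" and j0: "j0 \<notin> ?R" using onV[of vr] onV[of vb] by auto
  have per: "j \<in> ?R" if "i mod M = j mod M" "i \<in> ?R" for i j
  proof -
    have "j = i + (j div M - i div M) * M"
      using that(1) div_mult_mod_eq[of i M] div_mult_mod_eq[of j M] unfolding left_diff_distrib by linarith
    then have "cov (vtx j) = cov (vtx i)" using cov_vtx_shift[of i "j div M - i div M"] by simp
    then show ?thesis using that(2) by simp
  qed
  have "is_closed_ball (periodic_complex M ?R) (m - 2)"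
    by (rule periodic_complex_ball[OF m2 refl per r j0])
  moreover have "\<Union> (periodic_complex M ?R) \<subseteq> D" unfolding periodic_complex_def by blast
  ultimately show ?thesis
    unfolding punctured_Y_eq[OF RB] by (intro is_closed_ball_relabel[OF inj_arc_of finite_complex_periodic])
qed

end

theorem punctured_Y_complex_closed_ball:
  assumes m: "2 \<le> m" and P: "punctured_polygon m P V x" and RB: "bicolouring V R B"
  shows "is_closed_ball (punctured_Y_complex P V x B) (m - 2)"
proof -
  have ball: "P homeomorphic cball (0::complex) 1" and V: "V \<subseteq> frontier P" "finite V" "card V = m" and x: "x \<in> interior P"
    using P unfolding punctured_polygon_def by blast+
  obtain f g where fg: "homeomorphism P (cball (0::complex) 1) f g" using ball unfolding homeomorphic_def by blast
  have xP: "x \<in> P" using x interior_subset by blast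
  have inj: "inj_on f P" using fg by (auto simp: homeomorphism_def intro!: inj_on_inverseI)
  have "f ` interior P \<subseteq> interior (cball 0 1)"
    using continuous_image_subset_interior[of P f] fg inj by (auto simp: homeomorphism_def Pi_iff)
  then have fx: "f x \<in> ball 0 1" using x by auto
  \<comment> \<open>Move the image of the puncture to the centre of the disc.\<close>
  have "f x \<in> ball 0 1 \<inter> UNIV" using fx by simp
  then obtain h k :: "complex \<Rightarrow> complex" where hk: "homeomorphism (cball 0 1) (cball 0 1) h k" "h 0 = f x"
  proof (rule homeomorphism_moving_point_1[OF affine_UNIV UNIV_I])
    fix h k :: "complex \<Rightarrow> complex"
    assume "homeomorphism (cball 0 1 \<inter> UNIV) (cball 0 1 \<inter> UNIV) h k" "h 0 = f x"
    then show thesis using that[of h k] by (simp only: Int_UNIV_right)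
  qed
  have kh: "homeomorphism (cball 0 1) (cball 0 1) k h" by (rule homeomorphism_symD[OF hk(1)])
  have "k (f x) = 0" using homeomorphism_apply1[OF hk(1), of 0] hk(2) by simp
  moreover have "homeomorphism P (cball 0 1) (k \<circ> f) (g \<circ> h)" by (rule homeomorphism_compose[OF fg kh])
  ultimately interpret punctured_disc P V x m "k \<circ> f" "g \<circ> h"
    using xP V m by unfold_locales auto
  obtain \<theta> :: "int \<Rightarrow> real" where "strict_mono \<theta>" "\<And>k j. \<theta> (k + j * M) = \<theta> k + 2 * pi * j"
    "\<And>t. cov (of_real t) \<in> V \<longleftrightarrow> t \<in> range \<theta>"
    using angles_exist by metis
  then interpret punctured_polygon_angles P V x m "k \<circ> f" "g \<circ> h" \<theta> by unfold_locales auto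
  show ?thesis by (rule punctured_Y_ball[OF RB])
qed

section \<open>Both parts together\<close>

theorem theorem4:
  shows "(\<forall>m P R B. m \<ge> 4 \<and> convex_polygon m P \<and> nontrivial_bicolouring P R B
            \<longrightarrow> is_closed_ball (Y_complex P B) (m - 4)) \<and>
         (\<forall>m P V x R B. m \<ge> 2 \<and> punctured_polygon m P V x \<and> bicolouring V R B
            \<longrightarrow> is_closed_ball (punctured_Y_complex P V x B) (m - 2))"
  using Y_complex_closed_ball punctured_Y_complex_closed_ball by blast

end
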